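(* Let $m>0$ and let $A:\mathbb{R}^3\to\mathbb{R}^3$ be Lipschitz. Then, for every $u\in H^1_A(\mathbb{R}^3,\mathbb{C})$, $$\lim_{s\nearrow 1}\frac{C_s}{2}m^{\frac{3+2s}{2}}\int_{\mathbb{R}^3\times\mathbb{R}^3}\frac{\left|u(x)-e^{i(x-y)\cdot A\left(\frac{x+y}{2}\right)}u(y)\right|^2}{|x-y|^{\frac{3+2s}{2}}}\,\mathcal{K}_{\frac{3+2s}{2}}(m|x-y|)\,dx\,dy=\int_{\mathbb{R}^3}|\nabla_A u|^2\,dx .$$
   Context: For $s\in(0,1)$, $C_s:=\dfrac{s\,2^{\frac{2s-1}{2}}}{\pi^{3/2}\,\Gamma(1-s)}$, where $\Gamma$ is the Gamma function. $\mathcal{K}_\nu$ is the modified Bessel function (also called MacDonald function, or modified Bessel function of the second/third kind) of order $\nu$: $\mathcal{K}_\nu(\zeta)=\frac12\left(\frac{\zeta}{2}\right)^\nu\int_0^{+\infty}e^{-\frac{\zeta^2}{4t}-t}t^{-1-\nu}\,dt$ for $\zeta>0$. $\nabla_A u:=(\nabla-iA)u$ (weak gradient), and $H^1_A(\mathbb{R}^3,\mathbb{C})$ is the space of all $u\in L^2(\mathbb{R}^3,\mathbb{C})$ with $\int_{\mathbb{R}^3}|\nabla_A u|^2\,dx<+\infty$. *)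

theory Defs
  imports "HOL-Analysis.Analysis"
begin

definition partial_derivative :: "'n::finite \<Rightarrow> (real ^ 'n \<Rightarrow> real) \<Rightarrow> real ^ 'n \<Rightarrow> real" where
  "partial_derivative j f x = frechet_derivative f (at x) (axis j 1)"

primrec continuously_differentiable :: "nat \<Rightarrow> (real ^ 'n::finite \<Rightarrow> real) \<Rightarrow> bool" where
  "continuously_differentiable 0 f \<longleftrightarrow> continuous_on UNIV f"
| "continuously_differentiable (Suc k) f \<longleftrightarrow>
     (\<forall>x. f differentiable (at x)) \<and>
     (\<forall>j. continuously_differentiable k (partial_derivative j f))"

definition test_function :: "(real ^ 'n::finite \<Rightarrow> real) \<Rightarrow> bool" where
  "test_function \<phi> \<longleftrightarrow>
     (\<forall>k. continuously_differentiable k \<phi>) \<and> compact (closure {x. \<phi> x \<noteq> 0})"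

definition locally_integrable :: "(real ^ 'n::finite \<Rightarrow> 'b::euclidean_space) \<Rightarrow> bool" where
  "locally_integrable f \<longleftrightarrow> (\<forall>K. compact K \<longrightarrow> f absolutely_integrable_on K)"

text \<open>Real-valued test functions suffice for complex-valued \<open>u\<close>, by linearity.\<close>

definition has_weak_gradient ::
  "(real ^ 'n::finite \<Rightarrow> complex) \<Rightarrow> (real ^ 'n \<Rightarrow> complex ^ 'n) \<Rightarrow> bool" where
  "has_weak_gradient u g \<longleftrightarrow>
     locally_integrable u \<and> locally_integrable g \<and>
     (\<forall>\<phi> j. test_function \<phi> \<longrightarrow>
        (LINT x|lebesgue. partial_derivative j \<phi> x *\<^sub>R u x) =
        - (LINT x|lebesgue. \<phi> x *\<^sub>R (g x $ j)))"

text \<open>A weak gradient is determined only up to a null set; this picks a representative, and is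
  meaningful only if a weak gradient exists.\<close>

definition weak_gradient ::
  "(real ^ 'n::finite \<Rightarrow> complex) \<Rightarrow> real ^ 'n \<Rightarrow> complex ^ 'n" where
  "weak_gradient u = (SOME g. has_weak_gradient u g)"

definition magnetic_gradient ::
  "(real ^ 'n::finite \<Rightarrow> real ^ 'n) \<Rightarrow> (real ^ 'n \<Rightarrow> complex) \<Rightarrow> real ^ 'n \<Rightarrow> complex ^ 'n" where
  "magnetic_gradient A u x =
     weak_gradient u x - (\<chi> j. \<i> * complex_of_real (A x $ j) * u x)"

text \<open>For locally bounded \<open>A\<close> and \<open>u\<close> in \<open>L\<^sup>2\<close>, the product \<open>A u\<close> is locally integrable, so the
  distribution \<open>(\<nabla> - iA) u\<close> is in \<open>L\<^sup>2\<close> only if the distributional gradient of \<open>u\<close> is a locally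
  integrable function. Requiring a weak gradient to exist therefore loses nothing.\<close>

definition H1_magnetic ::
  "(real ^ 'n::finite \<Rightarrow> real ^ 'n) \<Rightarrow> (real ^ 'n \<Rightarrow> complex) set" where
  "H1_magnetic A =
     {u. u \<in> borel_measurable lebesgue \<and>
         (\<integral>\<^sup>+ x. ennreal ((norm (u x))\<^sup>2) \<partial>lebesgue) < \<infinity> \<and>
         (\<exists>g. has_weak_gradient u g) \<and>
         (\<integral>\<^sup>+ x. ennreal ((norm (magnetic_gradient A u x))\<^sup>2) \<partial>lebesgue) < \<infinity>}"

text \<open>Intended for \<open>z > 0\<close> only.\<close>

definition bessel_K :: "real \<Rightarrow> real \<Rightarrow> real" where
  "bessel_K \<nu> z =
     1 / 2 * (z / 2) powr \<nu> *
     (LBINT t:{0<..}. exp (- (z\<^sup>2 / (4 * t)) - t) * t powr (- 1 - \<nu>))"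

definition C_const :: "real \<Rightarrow> real" where
  "C_const s = s * 2 powr ((2 * s - 1) / 2) / (pi powr (3 / 2) * Gamma (1 - s))"

text \<open>A nonnegative integral with values in \<open>[0, \<infinity>]\<close>. The integrand is irrelevant on the
  diagonal, a null set.\<close>

definition magnetic_seminorm_integral ::
  "real \<Rightarrow> (real ^ 3 \<Rightarrow> real ^ 3) \<Rightarrow> (real ^ 3 \<Rightarrow> complex) \<Rightarrow> real \<Rightarrow> ennreal" where
  "magnetic_seminorm_integral m A u s =
     (\<integral>\<^sup>+ (x, y). ennreal
        ((norm (u x - exp (\<i> * complex_of_real ((x - y) \<bullet> A ((1 / 2) *\<^sub>R (x + y)))) * u y))\<^sup>2
          / norm (x - y) powr ((3 + 2 * s) / 2)
          * bessel_K ((3 + 2 * s) / 2) (m * norm (x - y))) \<partial>lebesgue)"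

end

theory Submission
  imports Defs "HOL-Probability.Distributions" "HOL-Real_Asymp.Real_Asymp"
begin

text \<open>
  Write \<open>h = x - y\<close> and let \<open>F h\<close> be the integral over \<open>y\<close> of
  \<open>|u (y + h) - exp (i h \<bullet> A (y + h/2)) u y|\<^sup>2\<close> (\<open>defect\<close> below), so that the double integral is the
  integral of \<open>F\<close> against a radial kernel. Two observations turn the claim into two successive limits.

  The first concerns \<open>F\<close> near the origin. Along the segment from \<open>y\<close> to \<open>y + t v\<close> the function \<open>u\<close> is
  absolutely continuous for almost every \<open>y\<close>. Once the phase has been removed, its difference quotient is
  the average over the segment of the covariant derivative \<open>v \<bullet> \<nabla>\<^sub>A u\<close>, up to factors of modulus one and
  an error that comes only from the variation of \<open>A\<close> on the segment. Because \<open>A\<close> is Lipschitz, the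
  integrand of that error is at most \<open>L t |v|\<^sup>2 |u|\<close>, however large \<open>A\<close> itself may be.
  Continuity of translations in \<open>L\<^sup>2\<close> then gives \<open>F (t v) / t\<^sup>2 \<rightarrow> \<parallel>v \<bullet> \<nabla>\<^sub>A u\<parallel>\<^sup>2\<close> as \<open>t \<rightarrow> 0\<close>
  (\<open>quotient_L2_norm_tendsto\<close>), together with the bound
  \<open>F (t v) / t\<^sup>2 \<le> 2 |v|\<^sup>2 \<parallel>\<nabla>\<^sub>A u\<parallel>\<^sup>2 + 2 L\<^sup>2 t\<^sup>2 |v|\<^sup>4 \<parallel>u\<parallel>\<^sup>2\<close> (\<open>quotient_L2_bound\<close>).

  The second concerns the kernel. The integral formula for \<open>K\<^sub>\<nu>\<close> exhibits \<open>|h| powr (-\<nu>) K\<^sub>\<nu> (m |h|)\<close> as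
  a superposition over \<open>t > 0\<close> of centred Gaussians of variance \<open>2 t / m\<^sup>2\<close>. Hence, with \<open>\<Psi> r\<close> the
  average of \<open>F (r v) / r\<^sup>2\<close> over a standard Gaussian vector \<open>v\<close> (\<open>gauss_average\<close>), the whole left-hand
  side equals \<open>s m powr (2 s - 2)\<close> times the integral of \<open>\<Psi> (sqrt (2 t) / m)\<close> against the Gamma
  distribution with density \<open>exp (-t) t powr (-s) / \<Gamma> (1 - s)\<close>; the constant \<open>C\<^sub>s\<close> is exactly what makes
  this a probability density (\<open>bessel_kernel_integral\<close>, \<open>C_const_normalization\<close>).

  As \<open>s\<close> increases to \<open>1\<close>, this distribution has mean \<open>1 - s\<close> and collapses to \<open>0\<close>, so only the limit
  of \<open>\<Psi>\<close> at \<open>0\<close> survives (\<open>gamma_density_concentrates\<close>). By dominated convergence that limit is the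
  Gaussian average of \<open>\<parallel>v \<bullet> \<nabla>\<^sub>A u\<parallel>\<^sup>2\<close>, which is \<open>\<parallel>\<nabla>\<^sub>A u\<parallel>\<^sup>2\<close> since a standard Gaussian vector has
  identity covariance (\<open>gauss_average_cov\<close>).
\<close>

section \<open>Smooth bumps that approximate boxes\<close>

text \<open>
  The functions \<open>exp (-1/s) / s ^ k\<close>, extended by zero, are closed under differentiation up to linear
  combinations, which is why the power in the denominator is part of the family.
\<close>

definition flat_exp :: "nat \<Rightarrow> real \<Rightarrow> real" where
  "flat_exp k s = (if s > 0 then exp (- (1 / s)) / s ^ k else 0)"

lemma flat_exp_tendsto_0: "(flat_exp k \<longlongrightarrow> 0) (at_right 0)"
proof -
  have "((\<lambda>s::real. exp (- (1 / s)) / s ^ k) \<longlongrightarrow> 0) (at_right 0)"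
    by real_asymp
  then show ?thesis
    by (rule Lim_transform_eventually)
       (auto simp: flat_exp_def intro!: eventually_at_rightI[of 0 1])
qed

lemma flat_exp_has_derivative:
  "(flat_exp k has_real_derivative (flat_exp (k + 2) s - real k * flat_exp (k + 1) s)) (at s)"
proof -
  consider "s > 0" | "s < 0" | "s = 0" by linarith
  then show ?thesis
  proof cases
    case 1
    have pk: "real k * s ^ (k - 1) = real k * s ^ k / s"
      using 1 by (cases k) auto
    have "((\<lambda>s. exp (- (1 / s)) / s ^ k) has_real_derivative
        (exp (- (1 / s)) * (1 / (s * s)) * s ^ k - exp (- (1 / s)) * (real k * s ^ (k - 1))) / (s ^ k * s ^ k)) (at s)"
      using 1 by (auto intro!: derivative_eq_intros)
    also have "(exp (- (1 / s)) * (1 / (s * s)) * s ^ k - exp (- (1 / s)) * (real k * s ^ (k - 1))) / (s ^ k * s ^ k)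
        = flat_exp (k + 2) s - real k * flat_exp (k + 1) s"
      unfolding pk using 1 by (simp add: flat_exp_def field_simps)
    finally have "((\<lambda>s. exp (- (1 / s)) / s ^ k) has_real_derivative
        flat_exp (k + 2) s - real k * flat_exp (k + 1) s) (at s)" .
    then show ?thesis
      by (rule has_field_derivative_transform_within_open[where S="{0<..}"]) (use 1 in \<open>auto simp: flat_exp_def\<close>)
  next
    case 2
    have "((\<lambda>s. 0) has_real_derivative (flat_exp (k + 2) s - real k * flat_exp (k + 1) s)) (at s)"
      using 2 by (simp add: flat_exp_def)
    then show ?thesis
      by (rule has_field_derivative_transform_within_open[where S="{..<0}"]) (use 2 in \<open>auto simp: flat_exp_def\<close>)
  next
    case 3
    have "((\<lambda>h. (flat_exp k (0 + h) - flat_exp k 0) / h) \<longlongrightarrow> 0) (at 0)"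
    proof (rule filterlim_split_at)
      have "eventually (\<lambda>h. flat_exp (k+1) h = (flat_exp k (0 + h) - flat_exp k 0) / h) (at_right (0::real))"
        by (intro eventually_at_rightI[of 0 1]) (auto simp: flat_exp_def)
      then show "((\<lambda>h. (flat_exp k (0 + h) - flat_exp k 0) / h) \<longlongrightarrow> 0) (at_right 0)"
        by (rule Lim_transform_eventually[OF flat_exp_tendsto_0])
      have "eventually (\<lambda>h. 0 = (flat_exp k (0 + h) - flat_exp k 0) / h) (at_left (0::real))"
        by (intro eventually_at_leftI[of "-1"]) (auto simp: flat_exp_def)
      then show "((\<lambda>h. (flat_exp k (0 + h) - flat_exp k 0) / h) \<longlongrightarrow> 0) (at_left 0)"
        by (rule Lim_transform_eventually[OF tendsto_const])
    qed
    then show ?thesis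
      using 3 by (simp add: DERIV_def flat_exp_def)
  qed
qed

lemma flat_exp_0_bounds: "0 \<le> flat_exp 0 s" "flat_exp 0 s \<le> 1"
  by (auto simp: flat_exp_def)

text \<open>
  An algebra that contains all bumps used below together with all their directional derivatives. Since it
  is stable under differentiation, membership gives smoothness of every order at once.
\<close>

inductive flat_algebra :: "(real ^ 'n::finite \<Rightarrow> real) \<Rightarrow> bool" where
  const: "flat_algebra (\<lambda>x. c)"
| flat: "flat_algebra (\<lambda>x. flat_exp k (\<alpha> * x $ j + \<beta>))"
| add: "flat_algebra f \<Longrightarrow> flat_algebra g \<Longrightarrow> flat_algebra (\<lambda>x. f x + g x)"
| mult: "flat_algebra f \<Longrightarrow> flat_algebra g \<Longrightarrow> flat_algebra (\<lambda>x. f x * g x)"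

lemma flat_algebra_prod:
  assumes "\<And>i. i \<in> I \<Longrightarrow> flat_algebra (f i)"
  shows "flat_algebra (\<lambda>x. \<Prod>i\<in>I. f i x)"
  using assms
  by (induction I rule: infinite_finite_induct) (auto intro: flat_algebra.intros)

lemma flat_algebra_derivative:
  assumes "flat_algebra f"
  shows "\<exists>f'. (\<forall>x. (f has_derivative f' x) (at x)) \<and> (\<forall>v. flat_algebra (\<lambda>x. f' x v))"
  using assms
proof induction
  case (const c)
  show ?case by (intro exI[of _ "\<lambda>x v. 0"]) (auto intro: flat_algebra.intros)
next
  case (flat k \<alpha> j \<beta>)
  let ?D = "\<lambda>x. flat_exp (k + 2) (\<alpha> * x $ j + \<beta>) + (- real k) * flat_exp (k + 1) (\<alpha> * x $ j + \<beta>)"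
  have "((\<lambda>x. flat_exp k (\<alpha> * x $ j + \<beta>)) has_derivative (\<lambda>v. (\<alpha> * v $ j) * ?D x)) (at x)" for x
  proof -
    have 1: "((\<lambda>x. \<alpha> * x $ j + \<beta>) has_derivative (\<lambda>v. \<alpha> * v $ j)) (at x)"
      by (auto intro!: derivative_eq_intros bounded_linear_imp_has_derivative)
    have 2: "(flat_exp k has_derivative (\<lambda>y. y * ?D x)) (at (\<alpha> * x $ j + \<beta>))"
      using flat_exp_has_derivative[of k "\<alpha> * x $ j + \<beta>"]
      by (simp add: has_field_derivative_def mult.commute[of _ "_ - _"] flip: diff_conv_add_uminus)
    show ?thesis using has_derivative_compose[OF 1 2] by simp
  qed
  moreover have "flat_algebra (\<lambda>x. (\<alpha> * v $ j) * ?D x)" for v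
    by (intro flat_algebra.intros)
  ultimately show ?case by (intro exI[of _ "\<lambda>x v. (\<alpha> * v $ j) * ?D x"]) auto
next
  case (add f g)
  then obtain f' g' where "\<forall>x. (f has_derivative f' x) (at x)" "\<forall>v. flat_algebra (\<lambda>x. f' x v)"
      "\<forall>x. (g has_derivative g' x) (at x)" "\<forall>v. flat_algebra (\<lambda>x. g' x v)" by blast
  then show ?case
    by (intro exI[of _ "\<lambda>x v. f' x v + g' x v"]) (auto intro: flat_algebra.intros has_derivative_add)
next
  case (mult f g)
  then obtain f' g' where "\<forall>x. (f has_derivative f' x) (at x)" "\<forall>v. flat_algebra (\<lambda>x. f' x v)"
      "\<forall>x. (g has_derivative g' x) (at x)" "\<forall>v. flat_algebra (\<lambda>x. g' x v)" by blast
  with mult show ?case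
    by (intro exI[of _ "\<lambda>x v. f x * g' x v + f' x v * g x"])
       (auto intro!: flat_algebra.intros has_derivative_mult)
qed

lemma flat_algebra_frechet:
  assumes "flat_algebra f"
  shows "(f has_derivative frechet_derivative f (at x)) (at x)"
    and "flat_algebra (\<lambda>x. frechet_derivative f (at x) v)"
proof -
  obtain f' where f': "\<And>x. (f has_derivative f' x) (at x)" "\<And>v. flat_algebra (\<lambda>x. f' x v)"
    using flat_algebra_derivative[OF assms] by blast
  then have eq: "frechet_derivative f (at x) = f' x" for x
    using frechet_derivative_at by metis
  show "(f has_derivative frechet_derivative f (at x)) (at x)"
    "flat_algebra (\<lambda>x. frechet_derivative f (at x) v)"
    unfolding eq by (rule f')+
qed

lemma flat_algebra_continuous:
  assumes "flat_algebra f"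
  shows "continuous_on UNIV f"
  using flat_algebra_frechet(1)[OF assms] has_derivative_continuous_on[of UNIV f]
  by (auto intro!: continuous_at_imp_continuous_on has_derivative_continuous)

lemma flat_algebra_continuously_differentiable:
  "flat_algebra f \<Longrightarrow> continuously_differentiable k f"
proof (induction k arbitrary: f)
  case 0
  then show ?case by (simp add: flat_algebra_continuous)
next
  case (Suc k)
  have "flat_algebra (partial_derivative j f)" for j
    using flat_algebra_frechet(2)[OF Suc.prems, of "axis j 1"]
    by (simp add: partial_derivative_def[abs_def])
  then show ?case
    using Suc flat_algebra_frechet(1)[OF Suc.prems] by (auto simp: differentiable_def)
qed

text \<open>
  As \<open>n\<close> grows, \<open>exp (-1 / (n s))\<close> tends to \<open>1\<close> for every \<open>s > 0\<close>, so these test functions tend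
  pointwise to the indicator of the open box between \<open>a\<close> and \<open>b\<close>.
\<close>

definition box_bump :: "nat \<Rightarrow> real ^ 'n::finite \<Rightarrow> real ^ 'n \<Rightarrow> real ^ 'n \<Rightarrow> real" where
  "box_bump n a b x = (\<Prod>j\<in>UNIV. flat_exp 0 (real n * (x $ j - a $ j)) * flat_exp 0 (real n * (b $ j - x $ j)))"

lemma flat_algebra_box_bump: "flat_algebra (box_bump n a b)"
proof -
  have "flat_algebra (\<lambda>x. \<Prod>j\<in>UNIV. flat_exp 0 (real n * x $ j + - real n * a $ j) *
      flat_exp 0 (- real n * x $ j + real n * b $ j))"
    by (intro flat_algebra_prod flat_algebra.intros)
  then show ?thesis
    by (simp add: box_bump_def[abs_def] algebra_simps)
qed

lemma box_bump_bounds: "0 \<le> box_bump n a b x" "box_bump n a b x \<le> 1"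
  unfolding box_bump_def
  by (auto intro!: prod_nonneg prod_le_1 mult_nonneg_nonneg mult_le_one flat_exp_0_bounds)

lemma box_bump_eq_0:
  assumes "x \<notin> box a b"
  shows "box_bump n a b x = 0"
proof -
  obtain j where "\<not> (a $ j < x $ j \<and> x $ j < b $ j)"
    using assms by (auto simp: mem_box_cart)
  then have "flat_exp 0 (real n * (x $ j - a $ j)) * flat_exp 0 (real n * (b $ j - x $ j)) = 0"
    by (auto simp: flat_exp_def zero_less_mult_iff)
  then show ?thesis
    unfolding box_bump_def by (intro prod_zero) auto
qed

lemma box_bump_translate: "box_bump n a b (x - v) = box_bump n (a + v) (b + v) x"
  by (simp add: box_bump_def algebra_simps)

lemma test_function_box_bump: "test_function (box_bump n a b)"
  unfolding test_function_def
proof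
  have "{x. box_bump n a b x \<noteq> 0} \<subseteq> cbox a b"
    using box_bump_eq_0 box_subset_cbox by blast
  then have "bounded (closure {x. box_bump n a b x \<noteq> 0})"
    using bounded_subset bounded_cbox bounded_closure by blast
  then show "compact (closure {x. box_bump n a b x \<noteq> 0})"
    by (simp add: compact_eq_bounded_closed)
qed (simp add: flat_algebra_continuously_differentiable flat_algebra_box_bump)

lemma box_bump_tendsto_indicator:
  "(\<lambda>n. box_bump n a b x) \<longlonglongrightarrow> indicator (box a b) x"
proof (cases "x \<in> box a b")
  case True
  have "(\<lambda>n. flat_exp 0 (real n * s)) \<longlonglongrightarrow> 1" if "s > 0" for s
  proof (rule Lim_transform_eventually)
    show "(\<lambda>n. exp (- (1 / (real n * s)))) \<longlonglongrightarrow> 1" using that by real_asymp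
    show "\<forall>\<^sub>F n in sequentially. exp (- (1 / (real n * s))) = flat_exp 0 (real n * s)"
      using that by (intro eventually_sequentiallyI[of 1]) (auto simp: flat_exp_def)
  qed
  then have "(\<lambda>n. box_bump n a b x) \<longlonglongrightarrow> (\<Prod>j\<in>(UNIV::'a set). 1 * 1)"
    unfolding box_bump_def using True
    by (intro tendsto_prod tendsto_mult) (auto simp: mem_box_cart)
  then show ?thesis using True by simp
next
  case False
  then show ?thesis by (simp add: box_bump_eq_0)
qed

lemma box_bump_deriv:
  "(box_bump n a b has_derivative frechet_derivative (box_bump n a b) (at x)) (at x)"
  by (rule flat_algebra_frechet[OF flat_algebra_box_bump])

lemma box_bump_deriv_continuous:
  "continuous_on UNIV (\<lambda>x. frechet_derivative (box_bump n a b) (at x) v)"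
  by (rule flat_algebra_continuous flat_algebra_frechet flat_algebra_box_bump)+

lemma box_bump_deriv_eq_0:
  assumes "x \<notin> cbox a b"
  shows "frechet_derivative (box_bump n a b) (at x) v = 0"
proof -
  have *: "0 = box_bump n a b y" if "y \<notin> cbox a b" for y
    using that box_bump_eq_0[of y a b n] box_subset_cbox[of a b] by auto
  have "((\<lambda>_. 0) has_derivative (\<lambda>_. 0)) (at x)" by simp
  then have "(box_bump n a b has_derivative (\<lambda>_. 0)) (at x)"
    by (rule has_derivative_transform_within_open[where s="- cbox a b"]) (use assms * in auto)
  then show ?thesis by (metis frechet_derivative_at)
qed

section \<open>Translations in \<open>L\<^sup>1\<close> and \<open>L\<^sup>2\<close>\<close>

text \<open>
  Limits in \<open>[0, \<infinity>]\<close> are obtained below from additive estimates in both directions; this form avoids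
  subtraction of extended reals.
\<close>

lemma tendsto_ennreal_two_sided:
  fixes X :: "'a \<Rightarrow> ennreal" and Y :: ennreal
  assumes Y: "Y < \<infinity>"
    and le: "\<And>e. e > (0::real) \<Longrightarrow> \<forall>\<^sub>F n in F. X n \<le> Y + ennreal e \<and> Y \<le> X n + ennreal e"
  shows "(X \<longlongrightarrow> Y) F"
proof (rule order_tendstoI)
  obtain y where y: "Y = ennreal y" "y \<ge> 0" using Y by (cases Y) auto
  fix a assume "a < Y"
  then obtain b where b: "a = ennreal b" "b \<ge> 0" "b < y"
    using y by (cases a) (auto simp: ennreal_less_iff)
  have "\<forall>\<^sub>F n in F. Y \<le> X n + ennreal ((y - b) / 2)"
    using le[of "(y - b) / 2"] b by (auto elim: eventually_mono)
  then show "\<forall>\<^sub>F n in F. a < X n"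
  proof eventually_elim
    case (elim n)
    show ?case
    proof (rule ccontr)
      assume "\<not> a < X n"
      then have "Y \<le> ennreal b + ennreal ((y - b) / 2)"
        using elim b by (metis add_right_mono linorder_not_less order_trans)
      then have "y \<le> b + (y - b) / 2" using y b by (simp flip: ennreal_plus)
      then show False using b by (simp add: field_simps)
    qed
  qed
next
  obtain y where y: "Y = ennreal y" "y \<ge> 0" using Y by (cases Y) auto
  fix a assume "Y < a"
  obtain b where b: "b > y" "ennreal b \<le> a"
  proof (cases a)
    case (real r)
    then show ?thesis using that[of r] y \<open>Y < a\<close> by (simp add: ennreal_less_iff)
  qed (use that[of "y + 1"] in auto)
  have "\<forall>\<^sub>F n in F. X n \<le> Y + ennreal ((b - y) / 2)"
    using le[of "(b - y) / 2"] b by (auto elim: eventually_mono)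
  then show "\<forall>\<^sub>F n in F. X n < a"
  proof eventually_elim
    case (elim n)
    have "Y + ennreal ((b - y) / 2) < ennreal b"
      using y b by (simp add: ennreal_less_iff field_simps flip: ennreal_plus)
    then show ?case using elim b by (meson le_less_trans less_le_trans)
  qed
qed

lemma nn_integral_lborel_shift:
  fixes k :: "'a::euclidean_space"
  assumes [measurable]: "g \<in> borel_measurable borel"
  shows "(\<integral>\<^sup>+x. g (x + k) \<partial>lborel) = (\<integral>\<^sup>+x. g x \<partial>lborel)"
proof -
  have "(\<integral>\<^sup>+x. g x \<partial>lborel) = (\<integral>\<^sup>+x. g x \<partial>distr lborel borel ((+) k))"
    by (simp add: lborel_distr_plus)
  also have "\<dots> = (\<integral>\<^sup>+x. g (k + x) \<partial>lborel)"
    by (subst nn_integral_distr) auto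
  finally show ?thesis by (simp add: add.commute)
qed

text \<open>
  Outer regularity suffices: for an open \<open>U\<close> that contains \<open>A\<close>, a small translation of a point of \<open>A\<close>
  stays in \<open>U\<close>, while \<open>U - A\<close> has small measure and translations do not change it.
\<close>

lemma translation_diff_indicator:
  fixes A :: "'a::euclidean_space set"
  assumes A[measurable]: "A \<in> sets borel" and fin: "emeasure lborel A < \<infinity>" and k: "k \<longlonglongrightarrow> 0"
  shows "(\<lambda>n. \<integral>\<^sup>+x. indicator A x * indicator (- A) (x + k n) \<partial>lborel) \<longlonglongrightarrow> 0"
proof (rule tendsto_ennreal_two_sided)
  fix e :: real assume "e > 0"
  have AL: "A \<in> sets lebesgue" by (rule sets_completionI_sets) (use A in simp)
  have e2: "e / 2 > 0" using \<open>e > 0\<close> by simp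
  obtain U where U: "open U" "A \<subseteq> U" "U - A \<in> lmeasurable" "emeasure lebesgue (U - A) < ennreal (e / 2)"
    by (rule sets_lebesgue_outer_open[OF AL e2])
  have [measurable]: "U \<in> sets borel" by (rule borel_open[OF U(1)])
  have UA: "emeasure lborel (U - A) < ennreal (e / 2)" using U(4) by simp
  have "(\<lambda>n. \<integral>\<^sup>+x. indicator A x * indicator (- U) (x + k n) \<partial>lborel) \<longlonglongrightarrow> (\<integral>\<^sup>+x. 0 \<partial>(lborel::'a measure))"
  proof (rule nn_integral_dominated_convergence[where w="indicator A"])
    show "AE x in lborel. (\<lambda>n. indicator A x * indicator (- U) (x + k n)) \<longlonglongrightarrow> (0::ennreal)"
    proof (rule AE_I2)
      fix x
      show "(\<lambda>n. indicator A x * indicator (- U) (x + k n)) \<longlonglongrightarrow> (0::ennreal)"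
      proof (cases "x \<in> A")
        case True
        have "(\<lambda>n. x + k n) \<longlonglongrightarrow> x + 0" by (intro tendsto_intros k)
        then have "\<forall>\<^sub>F n in sequentially. x + k n \<in> U"
          using U True by (intro topological_tendstoD) auto
        then have "\<forall>\<^sub>F n in sequentially. 0 = indicator A x * (indicator (- U) (x + k n) :: ennreal)"
          by eventually_elim auto
        then show ?thesis by (rule Lim_transform_eventually[OF tendsto_const])
      qed auto
    qed
  qed (use fin in \<open>auto split: split_indicator\<close>)
  then have "\<forall>\<^sub>F n in sequentially. (\<integral>\<^sup>+x. indicator A x * indicator (- U) (x + k n) \<partial>lborel) < ennreal (e / 2)"
    using \<open>e > 0\<close> by (intro order_tendstoD(2)) auto
  then show "\<forall>\<^sub>F n in sequentially.
      (\<integral>\<^sup>+x. indicator A x * indicator (- A) (x + k n) \<partial>lborel) \<le> 0 + ennreal e \<and>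
      0 \<le> (\<integral>\<^sup>+x. indicator A x * indicator (- A) (x + k n) \<partial>lborel) + ennreal e"
  proof eventually_elim
    case (elim n)
    have "(\<integral>\<^sup>+x. indicator A x * indicator (- A) (x + k n) \<partial>lborel)
        \<le> (\<integral>\<^sup>+x. indicator A x * indicator (- U) (x + k n) + indicator (U - A) (x + k n) \<partial>lborel)"
      by (intro nn_integral_mono) (auto simp: indicator_def)
    also have "\<dots> = (\<integral>\<^sup>+x. indicator A x * indicator (- U) (x + k n) \<partial>lborel) + emeasure lborel (U - A)"
      by (subst nn_integral_add) (auto simp: nn_integral_lborel_shift[of "indicator (U - A)"])
    also have "\<dots> \<le> ennreal (e / 2) + ennreal (e / 2)"
      using elim UA by (intro add_mono) auto
    also have "\<dots> = ennreal e" using \<open>e > 0\<close> by (simp flip: ennreal_plus)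
    finally show ?case by simp
  qed
qed auto

text \<open>
  The indicator case extends to all integrable functions by approximation. The symmetric difference in
  the base case splits into two one-sided differences, for \<open>k\<close> and for \<open>- k\<close>.
\<close>

lemma translation_continuous_L1:
  fixes f :: "'a::euclidean_space \<Rightarrow> real"
  assumes "integrable lborel f" and "k \<longlonglongrightarrow> 0"
  shows "(\<lambda>n. \<integral>\<^sup>+x. ennreal (norm (f (x + k n) - f x)) \<partial>lborel) \<longlonglongrightarrow> 0"
  using assms(1)
proof (induction rule: integrable_induct)
  case (base A c)
  then have A[measurable]: "A \<in> sets borel" by simp
  let ?i = "\<lambda>k x. indicator A x * indicator (- A) (x + k) :: ennreal"
  have mk: "(\<lambda>n. - k n) \<longlonglongrightarrow> 0" using tendsto_minus[OF assms(2)] by simp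
  have 1: "(\<integral>\<^sup>+x. ennreal (norm (indicator A (x + k n) *\<^sub>R c - indicator A x *\<^sub>R c)) \<partial>lborel)
      = ennreal \<bar>c\<bar> * ((\<integral>\<^sup>+x. ?i (k n) x \<partial>lborel) + (\<integral>\<^sup>+x. ?i (- k n) x \<partial>lborel))" for n
  proof -
    have "(\<integral>\<^sup>+x. ?i (- k n) x \<partial>lborel) = (\<integral>\<^sup>+x. indicator A (x + k n) * indicator (- A) x \<partial>lborel)"
      using nn_integral_lborel_shift[of "?i (- k n)" "k n"] by simp
    then show ?thesis
      by (simp add: nn_integral_cmult[symmetric] nn_integral_add[symmetric])
         (auto intro!: nn_integral_cong simp: indicator_def)
  qed
  show ?case
    unfolding 1
    using tendsto_mult_ennreal[OF tendsto_const tendsto_add[OF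
        translation_diff_indicator[OF A base(2) assms(2)] translation_diff_indicator[OF A base(2) mk]], of "ennreal \<bar>c\<bar>"]
    by simp
next
  case (add f g)
  have [measurable]: "f \<in> borel_measurable borel" "g \<in> borel_measurable borel" 
    using add by (auto dest: borel_measurable_integrable)
  show ?case
  proof (rule tendsto_sandwich[OF _ _ tendsto_const])
    show "(\<lambda>n. (\<integral>\<^sup>+x. ennreal (norm (f (x + k n) - f x)) \<partial>lborel) +
        (\<integral>\<^sup>+x. ennreal (norm (g (x + k n) - g x)) \<partial>lborel)) \<longlonglongrightarrow> 0"
      using tendsto_add[OF add(3,4)] by simp
    show "\<forall>\<^sub>F n in sequentially. (\<integral>\<^sup>+x. ennreal (norm (f (x + k n) + g (x + k n) - (f x + g x))) \<partial>lborel)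
      \<le> (\<integral>\<^sup>+x. ennreal (norm (f (x + k n) - f x)) \<partial>lborel) + (\<integral>\<^sup>+x. ennreal (norm (g (x + k n) - g x)) \<partial>lborel)"
      by (intro always_eventually allI, subst nn_integral_add[symmetric])
         (auto intro!: nn_integral_mono simp flip: ennreal_plus)
  qed auto
next
  case (lim f s)
  have [measurable]: "f \<in> borel_measurable borel" "\<And>i. s i \<in> borel_measurable borel"
    using lim by (auto dest: borel_measurable_integrable)
  have approx: "(\<lambda>i. (\<integral>\<^sup>+x. norm (f x - s i x) \<partial>lborel)) \<longlonglongrightarrow> 0"
    using lim by (intro nn_integral_dominated_convergence_norm[where w="\<lambda>x. 2 * norm (f x)"])
      (auto simp: integrable_iff_bounded ennreal_mult nn_integral_cmult ennreal_mult_less_top)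
  show ?case
  proof (rule tendsto_ennreal_two_sided)
    fix e :: real assume "e > 0"
    have "\<forall>\<^sub>F i in sequentially. (\<integral>\<^sup>+x. norm (f x - s i x) \<partial>lborel) < ennreal (e / 3)"
      using \<open>e > 0\<close> by (intro order_tendstoD(2)[OF approx]) auto
    then obtain i where i: "(\<integral>\<^sup>+x. norm (f x - s i x) \<partial>lborel) < ennreal (e / 3)"
      by (auto simp: eventually_sequentially)
    have "\<forall>\<^sub>F n in sequentially. (\<integral>\<^sup>+x. norm (s i (x + k n) - s i x) \<partial>lborel) < ennreal (e / 3)"
      using \<open>e > 0\<close> by (intro order_tendstoD(2)[OF lim.IH]) auto
    then show "\<forall>\<^sub>F n in sequentially. (\<integral>\<^sup>+x. ennreal (norm (f (x + k n) - f x)) \<partial>lborel) \<le> 0 + ennreal e \<and>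
      0 \<le> (\<integral>\<^sup>+x. ennreal (norm (f (x + k n) - f x)) \<partial>lborel) + ennreal e"
    proof eventually_elim
      case (elim n)
      have "(\<integral>\<^sup>+x. ennreal (norm (f (x + k n) - f x)) \<partial>lborel)
        \<le> (\<integral>\<^sup>+x. ennreal (norm (f (x + k n) - s i (x + k n))) + (ennreal (norm (f x - s i x))
            + ennreal (norm (s i (x + k n) - s i x))) \<partial>lborel)"
        by (intro nn_integral_mono) (auto simp flip: ennreal_plus)
      also have "\<dots> = (\<integral>\<^sup>+x. norm (f x - s i x) \<partial>lborel) + ((\<integral>\<^sup>+x. norm (f x - s i x) \<partial>lborel)
          + (\<integral>\<^sup>+x. norm (s i (x + k n) - s i x) \<partial>lborel))"
        using nn_integral_lborel_shift[of "\<lambda>x. ennreal (norm (f x - s i x))" "k n"]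
        by (simp add: nn_integral_add)
      also have "\<dots> \<le> ennreal (e / 3) + (ennreal (e / 3) + ennreal (e / 3))"
        using elim i by (intro add_mono) auto
      also have "\<dots> = ennreal e" using \<open>e > 0\<close> by (simp flip: ennreal_plus)
      finally show ?case by simp
    qed
  qed auto
qed

text \<open>
  Continuity of translations in \<open>L\<^sup>2\<close> follows from the \<open>L\<^sup>1\<close> case for squares, because
  \<open>(a - b)\<^sup>2 \<le> |a\<^sup>2 - b\<^sup>2|\<close> for nonnegative \<open>a\<close> and \<open>b\<close>; signed functions are split into their two parts.
\<close>

lemma power2_diff_le_parts:
  fixes x y :: real
  shows "(x - y)\<^sup>2 \<le> 2 * (\<bar>(max x 0)\<^sup>2 - (max y 0)\<^sup>2\<bar> + \<bar>(max (- x) 0)\<^sup>2 - (max (- y) 0)\<^sup>2\<bar>)"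
proof -
  have nn: "(a - b)\<^sup>2 \<le> \<bar>a\<^sup>2 - b\<^sup>2\<bar>" if "a \<ge> 0" "b \<ge> 0" for a b :: real
  proof -
    have "(a - b)\<^sup>2 = \<bar>a - b\<bar> * \<bar>a - b\<bar>" by (simp add: power2_eq_square abs_mult_self_eq)
    also have "\<dots> \<le> \<bar>a - b\<bar> * (a + b)" using that by (intro mult_left_mono) auto
    also have "\<dots> = \<bar>a\<^sup>2 - b\<^sup>2\<bar>" using that
      by (simp add: power2_eq_square square_diff_square_factored abs_mult mult.commute)
    finally show ?thesis .
  qed
  let ?a = "max x 0 - max y 0" and ?b = "max (- x) 0 - max (- y) 0"
  have "x - y = ?a - ?b" by auto
  moreover have "(a - b)\<^sup>2 \<le> 2 * (a\<^sup>2 + b\<^sup>2)" for a b :: real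
    using zero_le_power2[of "a + b"] by (simp add: power2_eq_square algebra_simps)
  ultimately have "(x - y)\<^sup>2 \<le> 2 * (?a\<^sup>2 + ?b\<^sup>2)" by metis
  also have "\<dots> \<le> 2 * (\<bar>(max x 0)\<^sup>2 - (max y 0)\<^sup>2\<bar> + \<bar>(max (- x) 0)\<^sup>2 - (max (- y) 0)\<^sup>2\<bar>)"
    by (intro mult_left_mono add_mono nn) auto
  finally show ?thesis .
qed

lemma translation_continuous_L2_real:
  fixes f :: "'a::euclidean_space \<Rightarrow> real"
  assumes [measurable]: "f \<in> borel_measurable borel"
    and fin: "(\<integral>\<^sup>+x. ennreal ((f x)\<^sup>2) \<partial>lborel) < \<infinity>" and k: "k \<longlonglongrightarrow> 0"
  shows "(\<lambda>n. \<integral>\<^sup>+x. ennreal ((f (x + k n) - f x)\<^sup>2) \<partial>lborel) \<longlonglongrightarrow> 0"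
proof (rule tendsto_sandwich[OF _ _ tendsto_const])
  let ?p = "\<lambda>x. (max (f x) 0)\<^sup>2" and ?q = "\<lambda>x. (max (- f x) 0)\<^sup>2"
  have pq: "?p x \<le> (f x)\<^sup>2" "?q x \<le> (f x)\<^sup>2" for x
    by (auto simp: max_def)
  have int: "integrable lborel ?p" "integrable lborel ?q"
    unfolding integrable_iff_bounded
    by (intro conjI le_less_trans[OF nn_integral_mono fin] ennreal_leI; use pq in simp)+
  let ?P = "\<lambda>n. \<integral>\<^sup>+x. ennreal (norm (?p (x + k n) - ?p x)) \<partial>lborel"
  let ?Q = "\<lambda>n. \<integral>\<^sup>+x. ennreal (norm (?q (x + k n) - ?q x)) \<partial>lborel"
  have "(\<lambda>n. 2 * (?P n + ?Q n)) \<longlonglongrightarrow> 2 * (0 + 0)"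
    by (intro tendsto_mult_ennreal tendsto_add tendsto_const translation_continuous_L1 int k) auto
  then show "(\<lambda>n. 2 * (?P n + ?Q n)) \<longlonglongrightarrow> 0" by simp
  show "\<forall>\<^sub>F n in sequentially. (\<integral>\<^sup>+x. ennreal ((f (x + k n) - f x)\<^sup>2) \<partial>lborel) \<le> 2 * (?P n + ?Q n)"
  proof (intro always_eventually allI)
    fix n
    have "(\<integral>\<^sup>+x. ennreal ((f (x + k n) - f x)\<^sup>2) \<partial>lborel)
      \<le> (\<integral>\<^sup>+x. ennreal (2 * (norm (?p (x + k n) - ?p x) + norm (?q (x + k n) - ?q x))) \<partial>lborel)"
      unfolding real_norm_def by (intro nn_integral_mono ennreal_leI power2_diff_le_parts)
    also have "\<dots> = 2 * (?P n + ?Q n)"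
      by (simp add: ennreal_mult nn_integral_cmult nn_integral_add)
    finally show "(\<integral>\<^sup>+x. ennreal ((f (x + k n) - f x)\<^sup>2) \<partial>lborel) \<le> 2 * (?P n + ?Q n)" .
  qed
qed auto

lemma translation_continuous_L2:
  fixes f :: "'a::euclidean_space \<Rightarrow> complex"
  assumes [measurable]: "f \<in> borel_measurable borel"
    and fin: "(\<integral>\<^sup>+x. ennreal ((norm (f x))\<^sup>2) \<partial>lborel) < \<infinity>" and k: "k \<longlonglongrightarrow> 0"
  shows "(\<lambda>n. \<integral>\<^sup>+x. ennreal ((norm (f (x + k n) - f x))\<^sup>2) \<partial>lborel) \<longlonglongrightarrow> 0"
proof -
  have fin': "(\<integral>\<^sup>+x. ennreal ((Re (f x))\<^sup>2) \<partial>lborel) < \<infinity>" "(\<integral>\<^sup>+x. ennreal ((Im (f x))\<^sup>2) \<partial>lborel) < \<infinity>"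
    by (intro le_less_trans[OF nn_integral_mono fin] ennreal_leI; simp add: cmod_power2)+
  have "(\<lambda>n. (\<integral>\<^sup>+x. ennreal ((Re (f (x + k n)) - Re (f x))\<^sup>2) \<partial>lborel)
      + (\<integral>\<^sup>+x. ennreal ((Im (f (x + k n)) - Im (f x))\<^sup>2) \<partial>lborel)) \<longlonglongrightarrow> 0 + 0"
    by (intro tendsto_add translation_continuous_L2_real fin' k) auto
  then show ?thesis
    by (simp add: cmod_power2 nn_integral_add)
qed

lemma has_bochner_integral_lborel_shift:
  fixes g :: "'a::euclidean_space \<Rightarrow> 'b::{banach, second_countable_topology}"
  assumes [measurable]: "g \<in> borel_measurable borel"
  shows integrable_lborel_shift: "integrable lborel (\<lambda>x. g (x + k)) \<longleftrightarrow> integrable lborel g"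
    and integral_lborel_shift: "(\<integral>x. g (x + k) \<partial>lborel) = (\<integral>x. g x \<partial>lborel)"
proof -
  have eq: "distr lborel borel (\<lambda>x. x + k) = lborel"
  proof -
    have "(\<lambda>x. x + k) = (+) k" by (rule ext) (rule add.commute)
    then show ?thesis by (simp only: lborel_distr_plus)
  qed
  show "integrable lborel (\<lambda>x. g (x + k)) \<longleftrightarrow> integrable lborel g"
    by (subst (2) eq[symmetric], subst integrable_distr_eq) auto
  show "(\<integral>x. g (x + k) \<partial>lborel) = (\<integral>x. g x \<partial>lborel)"
    by (subst (2) eq[symmetric], subst integral_distr) auto
qed

section \<open>The fundamental lemma of the calculus of variations\<close>

text \<open>
  The positive and the negative part of \<open>w\<close> are densities of two measures that agree on boxes, hence on
  all Borel sets.
\<close>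

lemma AE_eq_0_if_box_integrals_0_real:
  fixes w :: "'a::euclidean_space \<Rightarrow> real"
  assumes [measurable]: "w \<in> borel_measurable borel"
    and int: "\<And>a b. set_integrable lborel (box a b) w"
    and zero: "\<And>a b. (LINT x:box a b|lborel. w x) = 0"
  shows "AE x in lborel. w x = 0"
proof -
  have "density lborel (\<lambda>x. ennreal (w x)) = density lborel (\<lambda>x. ennreal (- w x))"
  proof (rule measure_eqI_generator_eq)
    let ?E = "range (\<lambda>(a, b). box a b::'a set)"
    show "Int_stable ?E"
      by (auto simp: Int_stable_def box_Int_box)
    show "?E \<subseteq> Pow UNIV" "sets (density lborel (\<lambda>x. ennreal (w x))) = sigma_sets UNIV ?E"
        "sets (density lborel (\<lambda>x. ennreal (- w x))) = sigma_sets UNIV ?E"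
      by (simp_all add: borel_eq_box)
    have em: "emeasure (density lborel (\<lambda>x. ennreal (s * w x))) (box a b)
        = (\<integral>\<^sup>+x. ennreal (s * (indicator (box a b) x *\<^sub>R w x)) \<partial>lborel)" for a b s
      by (subst emeasure_density) (auto intro!: nn_integral_cong split: split_indicator)
    note em1 = em[of 1, unfolded mult_1] and em2 = em[of "-1", unfolded mult_minus1]
    have fin: "(\<integral>\<^sup>+x. ennreal (indicator (box a b) x *\<^sub>R w x) \<partial>lborel) < \<infinity>"
      "(\<integral>\<^sup>+x. ennreal (- (indicator (box a b) x *\<^sub>R w x)) \<partial>lborel) < \<infinity>" for a b
      using int[of a b] unfolding set_integrable_def real_integrable_def by (auto simp: less_top)
    let ?A = "\<lambda>n::nat. box (- (real n *\<^sub>R One)) (real n *\<^sub>R One) :: 'a set"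
    show "range ?A \<subseteq> ?E" "(\<Union>i. ?A i) = UNIV"
      unfolding UN_box_eq_UNIV by auto
    show "emeasure (density lborel (\<lambda>x. ennreal (w x))) (?A i) \<noteq> \<infinity>" for i
      unfolding em1 using fin(1)[of "- (real i *\<^sub>R One)" "real i *\<^sub>R One"] by auto
    show "emeasure (density lborel (\<lambda>x. ennreal (w x))) X = emeasure (density lborel (\<lambda>x. ennreal (- w x))) X"
      if "X \<in> ?E" for X
    proof -
      obtain a b where X: "X = box a b" using \<open>X \<in> ?E\<close> by auto
      have "enn2real (\<integral>\<^sup>+x. ennreal (indicator (box a b) x *\<^sub>R w x) \<partial>lborel)
          = enn2real (\<integral>\<^sup>+x. ennreal (- (indicator (box a b) x *\<^sub>R w x)) \<partial>lborel)"
        using zero[of a b] int[of a b]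
        unfolding set_lebesgue_integral_def set_integrable_def by (subst (asm) real_lebesgue_integral_def) auto
      from arg_cong[OF this, of ennreal] show ?thesis
        unfolding X em1 em2 using fin[of a b] by (simp only: ennreal_enn2real infinity_ennreal_def)
    qed
  qed
  then have "AE x in lborel. ennreal (w x) = ennreal (- w x)"
    by (subst (asm) sigma_finite_measure.density_unique_iff[OF sigma_finite_lborel]) auto
  then show ?thesis
  proof eventually_elim
    case (elim x)
    then show ?case by (cases "w x" "0::real" rule: linorder_cases) (auto simp: ennreal_neg)
  qed
qed

lemma AE_eq_0_if_box_integrals_0:
  fixes w :: "'a::euclidean_space \<Rightarrow> complex"
  assumes [measurable]: "w \<in> borel_measurable borel"
    and int: "\<And>a b. set_integrable lborel (box a b) w"
    and zero: "\<And>a b. (LINT x:box a b|lborel. w x) = 0"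
  shows "AE x in lborel. w x = 0"
proof -
  have "AE x in lborel. Re (w x) = 0"
  proof (rule AE_eq_0_if_box_integrals_0_real)
    fix a b :: 'a
    show "set_integrable lborel (box a b) (\<lambda>x. Re (w x))"
      using integrable_Re[OF int[of a b, unfolded set_integrable_def]] by (simp add: set_integrable_def)
    show "(LINT x:box a b|lborel. Re (w x)) = 0"
      using integral_Re[OF int[of a b, unfolded set_integrable_def]] zero[of a b]
      by (simp add: set_lebesgue_integral_def)
  qed auto
  moreover have "AE x in lborel. Im (w x) = 0"
  proof (rule AE_eq_0_if_box_integrals_0_real)
    fix a b :: 'a
    show "set_integrable lborel (box a b) (\<lambda>x. Im (w x))"
      using integrable_Im[OF int[of a b, unfolded set_integrable_def]] by (simp add: set_integrable_def)
    show "(LINT x:box a b|lborel. Im (w x)) = 0"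
      using integral_Im[OF int[of a b, unfolded set_integrable_def]] zero[of a b]
      by (simp add: set_lebesgue_integral_def)
  qed auto
  ultimately show ?thesis
    by eventually_elim (simp add: complex_eq_iff)
qed

text \<open>
  The fundamental lemma of the calculus of variations. The bumps increase to box indicators, so the
  orthogonality passes to integrals over boxes.
\<close>

lemma AE_eq_0_if_orthogonal_to_box_bumps:
  fixes w :: "real ^ 'n::finite \<Rightarrow> complex"
  assumes w[measurable]: "w \<in> borel_measurable borel"
    and int: "\<And>a b. set_integrable lborel (cbox a b) w"
    and zero: "\<And>n a b. (\<integral>x. box_bump n a b x *\<^sub>R w x \<partial>lborel) = 0"
  shows "AE x in lborel. w x = 0"
proof (rule AE_eq_0_if_box_integrals_0[OF w])
  fix a b :: "real ^ 'n"
  have [measurable]: "box_bump n a b \<in> borel_measurable borel" for n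
    by (intro borel_measurable_continuous_onI flat_algebra_continuous flat_algebra_box_bump)
  show box: "set_integrable lborel (box a b) w"
    by (rule set_integrable_subset[OF int[of a b]]) (auto simp: box_subset_cbox)
  have "(\<lambda>n. \<integral>x. box_bump n a b x *\<^sub>R w x \<partial>lborel) \<longlonglongrightarrow> (LINT x:box a b|lborel. w x)"
    unfolding set_lebesgue_integral_def
  proof (rule integral_dominated_convergence[where w="\<lambda>x. norm (indicator (box a b) x *\<^sub>R w x)"])
    show "integrable lborel (\<lambda>x. norm (indicator (box a b) x *\<^sub>R w x))"
      using box unfolding set_integrable_def by (rule integrable_norm)
    show "AE x in lborel. (\<lambda>n. box_bump n a b x *\<^sub>R w x) \<longlonglongrightarrow> indicator (box a b) x *\<^sub>R w x"
      by (intro AE_I2 tendsto_intros box_bump_tendsto_indicator)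
    show "AE x in lborel. norm (box_bump n a b x *\<^sub>R w x) \<le> norm (indicator (box a b) x *\<^sub>R w x)" for n
    proof (rule AE_I2)
      fix x
      show "norm (box_bump n a b x *\<^sub>R w x) \<le> norm (indicator (box a b) x *\<^sub>R w x)"
        using box_bump_bounds[of n a b x] box_bump_eq_0[of x a b n]
        by (cases "x \<in> box a b") (auto intro!: mult_left_le_one_le)
    qed
  qed auto
  then show "(LINT x:box a b|lborel. w x) = 0"
    unfolding zero by (simp add: LIMSEQ_const_iff)
qed

section \<open>Weakly differentiable functions on segments\<close>

lemma integrable_pair_mult:
  fixes f :: "'a::euclidean_space \<Rightarrow> real" and g :: "'b::euclidean_space \<Rightarrow> real"
  assumes f: "integrable lborel f" and g: "integrable lborel g"
  shows "integrable (lborel \<Otimes>\<^sub>M lborel) (\<lambda>(x, y). f x * g y)"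
proof (rule lborel_pair.Fubini_integrable)
  have [measurable]: "f \<in> borel_measurable borel" "g \<in> borel_measurable borel"
    using assms by (auto dest: borel_measurable_integrable)
  show "(\<lambda>(x, y). f x * g y) \<in> borel_measurable (lborel \<Otimes>\<^sub>M lborel)" by measurable
  show "integrable lborel (\<lambda>x. \<integral>y. norm (case (x, y) of (x, y) \<Rightarrow> f x * g y) \<partial>lborel)"
    using f by (simp add: abs_mult)
qed (use g in auto)

lemma cbox_sweep:
  fixes a b h :: "'a::euclidean_space"
  obtains a' b' where "\<And>y \<sigma>. y \<in> cbox a b \<Longrightarrow> \<sigma> \<in> {0..1} \<Longrightarrow> y + \<sigma> *\<^sub>R h \<in> cbox a' b'"
proof -
  have "compact ((\<lambda>(y, \<sigma>). y + \<sigma> *\<^sub>R h) ` (cbox a b \<times> {0..1::real}))"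
    by (intro compact_continuous_image compact_Times compact_cbox compact_Icc)
       (auto intro!: continuous_intros simp: split_beta)
  then have "bounded ((\<lambda>(y, \<sigma>). y + \<sigma> *\<^sub>R h) ` (cbox a b \<times> {0..1::real}))"
    by (rule compact_imp_bounded)
  then obtain c where "(\<lambda>(y, \<sigma>). y + \<sigma> *\<^sub>R h) ` (cbox a b \<times> {0..1::real}) \<subseteq> cbox (- c) c"
    using bounded_subset_cbox_symmetric by blast
  from subsetD[OF this imageI] show ?thesis by (intro that[of "- c" c]) fastforce
qed

text \<open>
  The set of points \<open>y + \<sigma> h\<close> with \<open>y\<close> in a box and \<open>\<sigma>\<close> in the unit interval is bounded, so local
  integrability of \<open>p\<close> makes \<open>p (y + \<sigma> h)\<close> jointly integrable. By Fubini, \<open>p\<close> is then integrable on almost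
  every segment in direction \<open>h\<close>.
\<close>

lemma integrable_along_segments:
  fixes p :: "'a::euclidean_space \<Rightarrow> complex"
  assumes [measurable]: "p \<in> borel_measurable borel"
    and int: "\<And>a b. set_integrable lborel (cbox a b) p"
  shows "integrable (lborel \<Otimes>\<^sub>M lborel)
    (\<lambda>(y, \<sigma>::real). indicator {0..1} \<sigma> *\<^sub>R indicator (cbox a b) y *\<^sub>R p (y + \<sigma> *\<^sub>R h))"
proof (rule integrableI_bounded)
  obtain a' b' where sub: "\<And>y \<sigma>. y \<in> cbox a b \<Longrightarrow> \<sigma> \<in> {0..1} \<Longrightarrow> y + \<sigma> *\<^sub>R h \<in> cbox a' b'"
    using cbox_sweep[of a b h] by blast
  let ?I = "\<integral>\<^sup>+x. norm (indicator (cbox a' b') x *\<^sub>R p x) \<partial>lborel"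
  have fin: "?I < \<infinity>"
    using int[of a' b'] unfolding set_integrable_def integrable_iff_bounded by blast
  have "(\<integral>\<^sup>+z. norm (case z of (y, \<sigma>::real) \<Rightarrow> indicator {0..1} \<sigma> *\<^sub>R indicator (cbox a b) y *\<^sub>R p (y + \<sigma> *\<^sub>R h))
      \<partial>(lborel \<Otimes>\<^sub>M lborel))
    = (\<integral>\<^sup>+\<sigma>. \<integral>\<^sup>+y. norm (indicator {0..1::real} \<sigma> *\<^sub>R indicator (cbox a b) y *\<^sub>R p (y + \<sigma> *\<^sub>R h)) \<partial>lborel \<partial>lborel)"
    by (subst lborel_pair.nn_integral_snd[symmetric]) auto
  also have "\<dots> \<le> (\<integral>\<^sup>+\<sigma>. indicator {0..1::real} \<sigma> * ?I \<partial>lborel)"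
  proof (intro nn_integral_mono)
    fix \<sigma> :: real
    show "(\<integral>\<^sup>+y. norm (indicator {0..1::real} \<sigma> *\<^sub>R indicator (cbox a b) y *\<^sub>R p (y + \<sigma> *\<^sub>R h)) \<partial>lborel)
      \<le> indicator {0..1::real} \<sigma> * ?I"
    proof (cases "\<sigma> \<in> {0..1}")
      case True
      then have "(\<integral>\<^sup>+y. norm (indicator {0..1::real} \<sigma> *\<^sub>R indicator (cbox a b) y *\<^sub>R p (y + \<sigma> *\<^sub>R h)) \<partial>lborel)
          \<le> (\<integral>\<^sup>+y. norm (indicator (cbox a' b') (y + \<sigma> *\<^sub>R h) *\<^sub>R p (y + \<sigma> *\<^sub>R h)) \<partial>lborel)"
        by (intro nn_integral_mono) (auto intro: sub split: split_indicator)
      also have "\<dots> = ?I"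
        by (rule nn_integral_lborel_shift[of "\<lambda>x. ennreal (norm (indicator (cbox a' b') x *\<^sub>R p x))"]) simp
      finally show ?thesis using True by simp
    qed simp
  qed
  also have "\<dots> = ?I" by (simp add: nn_integral_multc)
  finally show "(\<integral>\<^sup>+z. norm (case z of (y, \<sigma>::real) \<Rightarrow> indicator {0..1} \<sigma> *\<^sub>R indicator (cbox a b) y *\<^sub>R p (y + \<sigma> *\<^sub>R h))
      \<partial>(lborel \<Otimes>\<^sub>M lborel)) < \<infinity>" using fin by simp
qed simp

lemma AE_integrable_segment:
  fixes p :: "'a::euclidean_space \<Rightarrow> complex"
  assumes [measurable]: "p \<in> borel_measurable borel"
    and int: "\<And>a b. set_integrable lborel (cbox a b) p"
  shows "AE y in lborel. set_integrable lborel {0..1} (\<lambda>\<sigma>::real. p (y + \<sigma> *\<^sub>R h))"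
proof -
  let ?c = "\<lambda>n. real n *\<^sub>R One :: 'a"
  have "AE y in lborel. \<forall>n. integrable lborel
      (\<lambda>\<sigma>::real. indicator {0..1} \<sigma> *\<^sub>R indicator (cbox (- ?c n) (?c n)) y *\<^sub>R p (y + \<sigma> *\<^sub>R h))"
    unfolding AE_all_countable
    using lborel_pair.AE_integrable_fst'[OF integrable_along_segments[OF assms]] by simp
  then show ?thesis
  proof eventually_elim
    case (elim y)
    obtain n where "y \<in> box (- ?c n) (?c n)"
      using UN_box_eq_UNIV[where 'a='a] by auto
    then have "y \<in> cbox (- ?c n) (?c n)" by (rule subsetD[OF box_subset_cbox])
    then show ?case using elim[rule_format, of n] by (simp add: set_integrable_def)
  qed
qed

lemma has_vector_derivative_cis_linear:
  "((\<lambda>\<sigma>. cis (- (c * \<sigma>))) has_vector_derivative - \<i> * c * cis (- (c * \<sigma>))) (at \<sigma> within S)"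
proof -
  have "((\<lambda>z. exp (- \<i> * c * z)) has_field_derivative - \<i> * c * exp (- \<i> * c * of_real \<sigma>)) (at (of_real \<sigma>))"
    by (auto intro!: derivative_eq_intros)
  from has_vector_derivative_real_field[OF this]
  show ?thesis by (simp add: cis_conv_exp mult.assoc)
qed

lemma integral_lincomb:
  fixes f g :: "'a \<Rightarrow> complex"
  assumes "integrable M f" "integrable M g"
  shows "(\<integral>x. \<alpha> * f x - g x \<partial>M) = \<alpha> * (\<integral>x. f x \<partial>M) - (\<integral>x. g x \<partial>M)"
    and "(\<integral>x. \<alpha> * (\<beta> * f x - g x) \<partial>M) = \<alpha> * (\<beta> * (\<integral>x. f x \<partial>M) - (\<integral>x. g x \<partial>M))"
    and "(\<integral>x. \<alpha> * (\<beta> * f x + g x) \<partial>M) = \<alpha> * (\<beta> * (\<integral>x. f x \<partial>M) + (\<integral>x. g x \<partial>M))"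
  using assms by simp_all

text \<open>
  Absolute continuity on segments, twisted by a constant phase speed \<open>c\<close>. Formally the right-hand side
  integrates the derivative of \<open>\<sigma> \<mapsto> exp (-i c \<sigma>) u (y + \<sigma> h)\<close>, where \<open>f\<close> is the weak derivative of \<open>u\<close> in
  direction \<open>h\<close>. Against a test function \<open>\<phi>\<close> the derivative can be moved to \<open>\<phi>\<close>, where the classical
  fundamental theorem of calculus applies; Fubini and translations then carry the result back to \<open>u\<close>.
\<close>

lemma twisted_increment_AE_fixed_phase:
  fixes u f :: "real ^ 'n::finite \<Rightarrow> complex" and c :: real
  assumes u[measurable]: "u \<in> borel_measurable borel" and f[measurable]: "f \<in> borel_measurable borel"
    and uint: "\<And>a b. set_integrable lborel (cbox a b) u"
    and fint: "\<And>a b. set_integrable lborel (cbox a b) f"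
    and weak: "\<And>n a b. (\<integral>x. frechet_derivative (box_bump n a b) (at x) h *\<^sub>R u x \<partial>lborel)
      = - (\<integral>x. box_bump n a b x *\<^sub>R f x \<partial>lborel)"
  shows "AE y in lborel. cis (- c) * u (y + h) - u y
     = (LINT \<sigma>:{0..1}|lborel. cis (- (c * \<sigma>)) * (f (y + \<sigma> *\<^sub>R h) - \<i> * c * u (y + \<sigma> *\<^sub>R h)))"
proof -
  define p where "p x = f x - \<i> * c * u x" for x
  have p[measurable]: "p \<in> borel_measurable borel" unfolding p_def by measurable
  have pint: "set_integrable lborel (cbox a b) p" for a b
    unfolding p_def[abs_def] using uint[of a b] fint[of a b]
    by (intro set_integral_diff set_integrable_mult_right) auto
  define R where "R y = (LINT \<sigma>:{0..1}|lborel. cis (- (c * \<sigma>)) * p (y + \<sigma> *\<^sub>R h))" for y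
  have cis[measurable]: "cis \<in> borel_measurable borel"
    by (intro borel_measurable_continuous_onI continuous_intros)
  have R[measurable]: "R \<in> borel_measurable borel"
    unfolding R_def[abs_def] set_lebesgue_integral_def by measurable

  have joint: "integrable (lborel \<Otimes>\<^sub>M lborel)
      (\<lambda>(y, \<sigma>). q y *\<^sub>R indicator {0..1} \<sigma> *\<^sub>R (cis (- (c * \<sigma>)) * p (y + \<sigma> *\<^sub>R h)))"
    if [measurable]: "q \<in> borel_measurable borel" and q: "\<And>y. \<bar>q y\<bar> \<le> indicator (cbox a b) y" for q a b
  proof (rule Bochner_Integration.integrable_bound[OF integrable_along_segments[OF p pint, of a b h]])
    show "AE z in lborel \<Otimes>\<^sub>M lborel.
      norm (case z of (y, \<sigma>) \<Rightarrow> q y *\<^sub>R indicator {0..1} \<sigma> *\<^sub>R (cis (- (c * \<sigma>)) * p (y + \<sigma> *\<^sub>R h)))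
      \<le> norm (case z of (y, \<sigma>) \<Rightarrow> indicator {0..1::real} \<sigma> *\<^sub>R indicator (cbox a b) y *\<^sub>R p (y + \<sigma> *\<^sub>R h))"
    proof (rule AE_I2, clarify)
      fix y and \<sigma> :: real
      have "norm (q y *\<^sub>R indicator {0..1} \<sigma> *\<^sub>R (cis (- (c * \<sigma>)) * p (y + \<sigma> *\<^sub>R h)))
          = \<bar>q y\<bar> * (indicator {0..1} \<sigma> * norm (p (y + \<sigma> *\<^sub>R h)))"
        by (simp add: norm_mult abs_mult)
      also have "\<dots> \<le> indicator (cbox a b) y * (indicator {0..1} \<sigma> * norm (p (y + \<sigma> *\<^sub>R h)))"
        by (intro mult_right_mono q) auto
      finally show "norm (q y *\<^sub>R indicator {0..1} \<sigma> *\<^sub>R (cis (- (c * \<sigma>)) * p (y + \<sigma> *\<^sub>R h)))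
          \<le> norm (indicator {0..1::real} \<sigma> *\<^sub>R indicator (cbox a b) y *\<^sub>R p (y + \<sigma> *\<^sub>R h))"
        by (simp add: mult.left_commute)
    qed
  qed measurable

  define w where "w y = cis (- c) * u (y + h) - u y - R y" for y
  have w[measurable]: "w \<in> borel_measurable borel" unfolding w_def by measurable
  have Rint: "set_integrable lborel (cbox a b) R" for a b
  proof -
    have "integrable lborel (\<lambda>y. \<integral>\<sigma>. indicator (cbox a b) y *\<^sub>R indicator {0..1} \<sigma> *\<^sub>R (cis (- (c * \<sigma>)) * p (y + \<sigma> *\<^sub>R h)) \<partial>lborel)"
      using lborel_pair.integrable_fst'[OF joint[of "indicator (cbox a b)" a b]] by simp
    moreover have "(\<integral>\<sigma>. indicator (cbox a b) y *\<^sub>R indicator {0..1} \<sigma> *\<^sub>R (cis (- (c * \<sigma>)) * p (y + \<sigma> *\<^sub>R h)) \<partial>lborel)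
        = indicator (cbox a b) y *\<^sub>R R y" for y
      unfolding R_def set_lebesgue_integral_def by (cases "y \<in> cbox a b") auto
    ultimately show ?thesis by (simp only: set_integrable_def)
  qed
  have uhint: "set_integrable lborel (cbox a b) (\<lambda>y. u (y + h))" for a b
  proof -
    have "integrable lborel (\<lambda>y. indicator (cbox (a + h) (b + h)) (y + h) *\<^sub>R u (y + h))"
      using uint[of "a + h" "b + h"] unfolding set_integrable_def
      by (subst integrable_lborel_shift[where g="\<lambda>x. indicator (cbox (a + h) (b + h)) x *\<^sub>R u x"]) auto
    moreover have "indicator (cbox (a + h) (b + h)) (y + h) = (indicator (cbox a b) y :: real)" for y
      by (auto simp: indicator_def mem_box_cart)
    ultimately show ?thesis by (simp only: set_integrable_def)
  qed
  have wint: "set_integrable lborel (cbox a b) w" for a b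
    unfolding w_def[abs_def]
    by (intro set_integral_diff set_integrable_mult_right uint uhint Rint)

  have "AE y in lborel. w y = 0"
  proof (rule AE_eq_0_if_orthogonal_to_box_bumps[OF w wint])
    fix n and a b :: "real ^ 'n"
    let ?\<phi> = "box_bump n a b"
    define D where "D x = frechet_derivative ?\<phi> (at x) h" for x
    have \<phi>c: "continuous_on UNIV ?\<phi>" by (intro flat_algebra_continuous flat_algebra_box_bump)
    have Dc: "continuous_on UNIV D" unfolding D_def by (rule box_bump_deriv_continuous)
    have [measurable]: "?\<phi> \<in> borel_measurable borel" "D \<in> borel_measurable borel"
      using \<phi>c Dc by (auto intro: borel_measurable_continuous_onI)
    have \<phi>b: "\<bar>?\<phi> y\<bar> \<le> indicator (cbox a b) y" for y
      using box_bump_bounds[of n a b y] box_bump_eq_0[of y a b n] box_subset_cbox[of a b]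
      by (auto split: split_indicator)
    have "compact (D ` cbox a b)"
      using Dc by (intro compact_continuous_image compact_cbox) (auto intro: continuous_on_subset)
    then obtain M where M: "\<And>x. x \<in> cbox a b \<Longrightarrow> \<bar>D x\<bar> \<le> M"
      using compact_imp_bounded[of "D ` cbox a b"] unfolding bounded_iff by auto
    have Db: "\<bar>D y\<bar> \<le> \<bar>M\<bar> * indicator (cbox a b) y" for y
      using M[of y] box_bump_deriv_eq_0[of y a b n h] by (auto simp: D_def split: split_indicator)

    define G where "G x \<sigma> = cis (- (c * \<sigma>)) * (- \<i> * c * ?\<phi> (x - \<sigma> *\<^sub>R h) - D (x - \<sigma> *\<^sub>R h))" for x \<sigma>
    have FTC: "(\<integral>\<sigma>. indicator {0..1} \<sigma> *\<^sub>R G x \<sigma> \<partial>lborel) = cis (- c) * ?\<phi> (x - h) - ?\<phi> x" for x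
    proof -
      have "(\<integral>\<sigma>. indicator {0..1} \<sigma> *\<^sub>R G x \<sigma> \<partial>lborel)
        = (\<lambda>\<sigma>. cis (- (c * \<sigma>)) * complex_of_real (?\<phi> (x - \<sigma> *\<^sub>R h))) 1
          - (\<lambda>\<sigma>. cis (- (c * \<sigma>)) * complex_of_real (?\<phi> (x - \<sigma> *\<^sub>R h))) 0"
      proof (rule integral_FTC_atLeastAtMost)
        fix \<sigma> :: real
        have "((\<lambda>\<sigma>. x - \<sigma> *\<^sub>R h) has_derivative (\<lambda>t. - t *\<^sub>R h)) (at \<sigma> within {0..1})"
          by (auto intro!: derivative_eq_intros)
        from has_derivative_compose[OF this box_bump_deriv]
        have "((\<lambda>\<sigma>. ?\<phi> (x - \<sigma> *\<^sub>R h)) has_derivative (\<lambda>t. frechet_derivative ?\<phi> (at (x - \<sigma> *\<^sub>R h)) (- t *\<^sub>R h))) (at \<sigma> within {0..1})" .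
        moreover have "frechet_derivative ?\<phi> (at z) (- t *\<^sub>R h) = t *\<^sub>R (- D z)" for z t
          unfolding D_def
          using linear_scale[OF has_derivative_linear[OF box_bump_deriv[of n a b z]], of "- t" h] by simp
        ultimately have "((\<lambda>\<sigma>. ?\<phi> (x - \<sigma> *\<^sub>R h)) has_real_derivative - D (x - \<sigma> *\<^sub>R h)) (at \<sigma> within {0..1})"
          by (simp add: has_real_derivative_iff_has_vector_derivative has_vector_derivative_def)
        note \<phi>' = has_vector_derivative_of_real[OF this]
        have G: "G x \<sigma> = cis (- (c * \<sigma>)) * complex_of_real (- D (x - \<sigma> *\<^sub>R h))
            + (- \<i> * c * cis (- (c * \<sigma>))) * complex_of_real (?\<phi> (x - \<sigma> *\<^sub>R h))"
          by (simp add: G_def algebra_simps)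
        show "((\<lambda>\<sigma>. cis (- (c * \<sigma>)) * complex_of_real (?\<phi> (x - \<sigma> *\<^sub>R h))) has_vector_derivative G x \<sigma>) (at \<sigma> within {0..1})"
          unfolding G by (rule has_vector_derivative_mult[OF has_vector_derivative_cis_linear \<phi>'])
      next
        show "continuous_on {0..1} (G x)"
          unfolding G_def by (intro continuous_intros continuous_on_compose2[OF \<phi>c] continuous_on_compose2[OF Dc]) auto
      qed simp
      then show ?thesis by simp
    qed

    obtain a' b' where sub: "\<And>y \<sigma>. y \<in> cbox a b \<Longrightarrow> \<sigma> \<in> {0..1} \<Longrightarrow> y + \<sigma> *\<^sub>R h \<in> cbox a' b'"
      using cbox_sweep[of a b h] by blast
    have Gint: "integrable (lborel \<Otimes>\<^sub>M lborel) (\<lambda>(x, \<sigma>). indicator {0..1} \<sigma> *\<^sub>R (G x \<sigma> * u x))"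
    proof (rule Bochner_Integration.integrable_bound)
      have "integrable lborel (\<lambda>x. norm (indicator (cbox a' b') x *\<^sub>R u x))"
        using uint[of a' b'] unfolding set_integrable_def by (rule integrable_norm)
      then show "integrable (lborel \<Otimes>\<^sub>M lborel) (\<lambda>(x, \<sigma>). norm (indicator (cbox a' b') x *\<^sub>R u x) * ((\<bar>c\<bar> + \<bar>M\<bar>) * indicator {0..1::real} \<sigma>))"
        by (rule integrable_pair_mult) simp
      show "(\<lambda>(x, \<sigma>). indicator {0..1} \<sigma> *\<^sub>R (G x \<sigma> * u x)) \<in> borel_measurable (lborel \<Otimes>\<^sub>M lborel)"
        unfolding G_def by measurable
      show "AE z in lborel \<Otimes>\<^sub>M lborel. norm (case z of (x, \<sigma>) \<Rightarrow> indicator {0..1} \<sigma> *\<^sub>R (G x \<sigma> * u x)) \<le>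
        norm (case z of (x, \<sigma>) \<Rightarrow> norm (indicator (cbox a' b') x *\<^sub>R u x) * ((\<bar>c\<bar> + \<bar>M\<bar>) * indicator {0..1::real} \<sigma>))"
      proof (rule AE_I2, clarify)
        fix x and \<sigma> :: real
        have "norm (G x \<sigma>) \<le> (\<bar>c\<bar> + \<bar>M\<bar>) * indicator (cbox a' b') x" if \<sigma>: "\<sigma> \<in> {0..1}"
        proof -
          let ?y = "x - \<sigma> *\<^sub>R h"
          have "norm (G x \<sigma>) \<le> \<bar>c\<bar> * \<bar>?\<phi> ?y\<bar> + \<bar>D ?y\<bar>"
            unfolding G_def norm_mult norm_cis
            by (rule order_trans[OF mult_left_mono[OF norm_triangle_ineq4]]) (auto simp: norm_mult)
          also have "\<dots> \<le> \<bar>c\<bar> * indicator (cbox a b) ?y + \<bar>M\<bar> * indicator (cbox a b) ?y"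
            by (intro add_mono mult_left_mono \<phi>b Db) auto
          also have "\<dots> \<le> (\<bar>c\<bar> + \<bar>M\<bar>) * indicator (cbox a' b') x"
            using sub[of ?y \<sigma>] \<sigma> by (auto split: split_indicator)
          finally show ?thesis .
        qed
        then show "norm (indicator {0..1} \<sigma> *\<^sub>R (G x \<sigma> * u x)) \<le>
          norm (norm (indicator (cbox a' b') x *\<^sub>R u x) * ((\<bar>c\<bar> + \<bar>M\<bar>) * indicator {0..1::real} \<sigma>))"
          by (cases "\<sigma> \<in> {0..1}") (auto simp: norm_mult mult.commute[of "norm (u x)"] intro!: mult_right_mono split: split_indicator_asm split_indicator)
      qed
    qed

    \<comment> \<open>For fixed \<open>\<sigma>\<close> the translated bump is again a bump, so the weak derivative may be used.\<close>
    have inner: "(\<integral>x. G x \<sigma> * u x \<partial>lborel) = (\<integral>y. ?\<phi> y *\<^sub>R (cis (- (c * \<sigma>)) * p (y + \<sigma> *\<^sub>R h)) \<partial>lborel)"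
      if "\<sigma> \<in> {0..1}" for \<sigma>
    proof -
      let ?\<psi> = "box_bump n (a + \<sigma> *\<^sub>R h) (b + \<sigma> *\<^sub>R h)"
      have \<psi>: "?\<phi> (x - \<sigma> *\<^sub>R h) = ?\<psi> x" for x by (rule box_bump_translate)
      have D\<psi>: "D (x - \<sigma> *\<^sub>R h) = frechet_derivative ?\<psi> (at x) h" for x
      proof -
        have "((\<lambda>x. x - \<sigma> *\<^sub>R h) has_derivative (\<lambda>t. t)) (at x)" by (auto intro!: derivative_eq_intros)
        from has_derivative_compose[OF this box_bump_deriv[of n a b]]
        have "(?\<psi> has_derivative frechet_derivative ?\<phi> (at (x - \<sigma> *\<^sub>R h))) (at x)"
          by (simp only: \<psi>)
        from fun_cong[OF frechet_derivative_at[OF this]] show ?thesis unfolding D_def .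
      qed
      have \<psi>int: "integrable lborel (\<lambda>x. ?\<psi> x *\<^sub>R q x)" if [measurable]: "q \<in> borel_measurable borel"
          and q: "\<And>a b. set_integrable lborel (cbox a b) q" for q :: "_ \<Rightarrow> complex"
      proof (rule Bochner_Integration.integrable_bound[OF q[of a' b', unfolded set_integrable_def]])
        have [measurable]: "?\<psi> \<in> borel_measurable borel"
          by (intro borel_measurable_continuous_onI flat_algebra_continuous flat_algebra_box_bump)
        show "(\<lambda>x. ?\<psi> x *\<^sub>R q x) \<in> borel_measurable lborel" by measurable
        show "AE x in lborel. norm (?\<psi> x *\<^sub>R q x) \<le> norm (indicator (cbox a' b') x *\<^sub>R q x)"
          using \<phi>b sub[of "_ - \<sigma> *\<^sub>R h" \<sigma>] \<open>\<sigma> \<in> {0..1}\<close> unfolding \<psi>[symmetric]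
          by (intro AE_I2) (fastforce split: split_indicator split_indicator_asm intro!: mult_left_le_one_le)
      qed
      have D\<psi>int: "integrable lborel (\<lambda>x. D (x - \<sigma> *\<^sub>R h) *\<^sub>R u x)"
      proof (rule Bochner_Integration.integrable_bound[OF integrable_scaleR_right[OF uint[of a' b', unfolded set_integrable_def]]])
        show "AE x in lborel. norm (D (x - \<sigma> *\<^sub>R h) *\<^sub>R u x) \<le> norm (M *\<^sub>R indicator (cbox a' b') x *\<^sub>R u x)"
          using Db sub[of "_ - \<sigma> *\<^sub>R h" \<sigma>] \<open>\<sigma> \<in> {0..1}\<close>
          by (intro AE_I2) (fastforce split: split_indicator split_indicator_asm intro!: mult_right_mono)
      qed measurable
      have "(\<integral>x. G x \<sigma> * u x \<partial>lborel) = (\<integral>x. cis (- (c * \<sigma>)) *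
          (- \<i> * c * (?\<psi> x *\<^sub>R u x) - D (x - \<sigma> *\<^sub>R h) *\<^sub>R u x) \<partial>lborel)"
        unfolding G_def \<psi> by (intro Bochner_Integration.integral_cong) (auto simp: scaleR_conv_of_real algebra_simps)
      also have "\<dots> = cis (- (c * \<sigma>)) * (- \<i> * c * (\<integral>x. ?\<psi> x *\<^sub>R u x \<partial>lborel) - (\<integral>x. D (x - \<sigma> *\<^sub>R h) *\<^sub>R u x \<partial>lborel))"
        by (rule integral_lincomb(2)[OF \<psi>int[OF u uint] D\<psi>int])
      also have "(\<integral>x. D (x - \<sigma> *\<^sub>R h) *\<^sub>R u x \<partial>lborel) = - (\<integral>x. ?\<psi> x *\<^sub>R f x \<partial>lborel)"
        unfolding D\<psi> by (rule weak)
      also have "cis (- (c * \<sigma>)) * (- \<i> * c * (\<integral>x. ?\<psi> x *\<^sub>R u x \<partial>lborel) - - (\<integral>x. ?\<psi> x *\<^sub>R f x \<partial>lborel))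
          = (\<integral>x. cis (- (c * \<sigma>)) * (- \<i> * c * (?\<psi> x *\<^sub>R u x) + ?\<psi> x *\<^sub>R f x) \<partial>lborel)"
        unfolding diff_minus_eq_add by (rule integral_lincomb(3)[OF \<psi>int[OF u uint] \<psi>int[OF f fint], symmetric])
      also have "\<dots> = (\<integral>x. ?\<psi> x *\<^sub>R (cis (- (c * \<sigma>)) * p x) \<partial>lborel)"
        by (intro Bochner_Integration.integral_cong) (auto simp: p_def scaleR_conv_of_real algebra_simps)
      also have "\<dots> = (\<integral>x. (\<lambda>x. ?\<phi> (x - \<sigma> *\<^sub>R h) *\<^sub>R (cis (- (c * \<sigma>)) * p x)) (x + \<sigma> *\<^sub>R h) \<partial>lborel)"
        unfolding \<psi>[symmetric]
        by (rule integral_lborel_shift[where g="\<lambda>x. ?\<phi> (x - \<sigma> *\<^sub>R h) *\<^sub>R (cis (- (c * \<sigma>)) * p x)", symmetric]) measurable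
      finally show ?thesis by simp
    qed

    have "(\<integral>x. (cis (- c) * ?\<phi> (x - h) - ?\<phi> x) * u x \<partial>lborel)
      = (\<integral>x. (\<integral>\<sigma>. indicator {0..1} \<sigma> *\<^sub>R (G x \<sigma> * u x) \<partial>lborel) \<partial>lborel)"
      unfolding FTC[symmetric]
      by (intro Bochner_Integration.integral_cong refl, subst integral_mult_left_zero[symmetric]) simp
    also have "\<dots> = (\<integral>\<sigma>. (\<integral>x. indicator {0..1} \<sigma> *\<^sub>R (G x \<sigma> * u x) \<partial>lborel) \<partial>lborel)"
      by (rule lborel_pair.Fubini_integral[OF Gint, symmetric])
    also have "\<dots> = (\<integral>\<sigma>. (\<integral>y. ?\<phi> y *\<^sub>R indicator {0..1} \<sigma> *\<^sub>R (cis (- (c * \<sigma>)) * p (y + \<sigma> *\<^sub>R h)) \<partial>lborel) \<partial>lborel)"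
    proof (rule Bochner_Integration.integral_cong[OF refl])
      fix \<sigma> :: real
      show "(\<integral>x. indicator {0..1} \<sigma> *\<^sub>R (G x \<sigma> * u x) \<partial>lborel)
          = (\<integral>y. ?\<phi> y *\<^sub>R indicator {0..1} \<sigma> *\<^sub>R (cis (- (c * \<sigma>)) * p (y + \<sigma> *\<^sub>R h)) \<partial>lborel)"
        using inner[of \<sigma>] by (cases "\<sigma> \<in> {0..1}") auto
    qed
    also have "\<dots> = (\<integral>y. (\<integral>\<sigma>. ?\<phi> y *\<^sub>R indicator {0..1} \<sigma> *\<^sub>R (cis (- (c * \<sigma>)) * p (y + \<sigma> *\<^sub>R h)) \<partial>lborel) \<partial>lborel)"
      by (rule lborel_pair.Fubini_integral[OF joint[of ?\<phi> a b]]) (use \<phi>b in auto)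
    also have "\<dots> = (\<integral>y. ?\<phi> y *\<^sub>R R y \<partial>lborel)"
      unfolding R_def set_lebesgue_integral_def scaleR_conv_of_real[of "?\<phi> _"]
      by (simp only: integral_mult_right_zero)
    finally have main: "(\<integral>x. (cis (- c) * ?\<phi> (x - h) - ?\<phi> x) * u x \<partial>lborel) = (\<integral>y. ?\<phi> y *\<^sub>R R y \<partial>lborel)" .

    have \<phi>int: "integrable lborel (\<lambda>x. ?\<phi> x *\<^sub>R q x)" if [measurable]: "q \<in> borel_measurable borel"
        and q: "\<And>a b. set_integrable lborel (cbox a b) q" for q :: "_ \<Rightarrow> complex"
    proof (rule Bochner_Integration.integrable_bound[OF q[of a b, unfolded set_integrable_def]])
      show "AE x in lborel. norm (?\<phi> x *\<^sub>R q x) \<le> norm (indicator (cbox a b) x *\<^sub>R q x)"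
        using \<phi>b by (intro AE_I2) (fastforce split: split_indicator split_indicator_asm intro!: mult_left_le_one_le)
    qed measurable
    have uh\<phi>: "integrable lborel (\<lambda>y. ?\<phi> y *\<^sub>R u (y + h))" by (rule \<phi>int[OF _ uhint]) simp
    then have uh\<phi>': "integrable lborel (\<lambda>y. ?\<phi> (y - h) *\<^sub>R u y)"
      using integrable_lborel_shift[of "\<lambda>y. ?\<phi> (y - h) *\<^sub>R u y" h] by simp
    have "(\<integral>y. ?\<phi> y *\<^sub>R w y \<partial>lborel)
      = (\<integral>y. cis (- c) * (?\<phi> y *\<^sub>R u (y + h)) - ?\<phi> y *\<^sub>R u y - ?\<phi> y *\<^sub>R R y \<partial>lborel)"
      by (intro Bochner_Integration.integral_cong refl) (simp add: w_def scaleR_conv_of_real algebra_simps)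
    also have "\<dots> = cis (- c) * (\<integral>y. ?\<phi> y *\<^sub>R u (y + h) \<partial>lborel) - (\<integral>y. ?\<phi> y *\<^sub>R u y \<partial>lborel) - (\<integral>y. ?\<phi> y *\<^sub>R R y \<partial>lborel)"
      using uh\<phi> \<phi>int[OF u uint] \<phi>int[OF R Rint]
      by (simp only: integral_lincomb(1) integrable_mult_right Bochner_Integration.integral_diff Bochner_Integration.integrable_diff)
    also have "(\<integral>y. ?\<phi> y *\<^sub>R u (y + h) \<partial>lborel) = (\<integral>y. ?\<phi> (y - h) *\<^sub>R u y \<partial>lborel)"
      using integral_lborel_shift[of "\<lambda>y. ?\<phi> (y - h) *\<^sub>R u y" h] by simp
    also have "cis (- c) * (\<integral>y. ?\<phi> (y - h) *\<^sub>R u y \<partial>lborel) - (\<integral>y. ?\<phi> y *\<^sub>R u y \<partial>lborel)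
        = (\<integral>y. cis (- c) * (?\<phi> (y - h) *\<^sub>R u y) - ?\<phi> y *\<^sub>R u y \<partial>lborel)"
      by (rule integral_lincomb(1)[OF uh\<phi>' \<phi>int[OF u uint], symmetric])
    also have "\<dots> = (\<integral>x. (cis (- c) * ?\<phi> (x - h) - ?\<phi> x) * u x \<partial>lborel)"
      by (intro Bochner_Integration.integral_cong refl) (simp add: scaleR_conv_of_real algebra_simps)
    finally show "(\<integral>y. ?\<phi> y *\<^sub>R w y \<partial>lborel) = 0" using main by simp
  qed
  then show ?thesis
    by eventually_elim (simp add: w_def R_def p_def)
qed

text \<open>
  The magnetic phase \<open>h \<bullet> A (y + h/2)\<close> depends on \<open>y\<close>, so one exceptional null set must serve every phase
  speed \<open>c\<close>. Countably many rational \<open>c\<close> share a null set, and off it both sides are continuous in \<open>c\<close> by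
  dominated convergence.
\<close>

lemma twisted_increment_AE:
  fixes u f :: "real ^ 'n::finite \<Rightarrow> complex"
  assumes u[measurable]: "u \<in> borel_measurable borel" and f[measurable]: "f \<in> borel_measurable borel"
    and uint: "\<And>a b. set_integrable lborel (cbox a b) u"
    and fint: "\<And>a b. set_integrable lborel (cbox a b) f"
    and weak: "\<And>n a b. (\<integral>x. frechet_derivative (box_bump n a b) (at x) h *\<^sub>R u x \<partial>lborel)
      = - (\<integral>x. box_bump n a b x *\<^sub>R f x \<partial>lborel)"
  shows "AE y in lborel. \<forall>c::real.
     set_integrable lborel {0..1} (\<lambda>\<sigma>::real. cis (- (c * \<sigma>)) * (f (y + \<sigma> *\<^sub>R h) - \<i> * c * u (y + \<sigma> *\<^sub>R h))) \<and>
     cis (- c) * u (y + h) - u y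
     = (LINT \<sigma>:{0..1}|lborel. cis (- (c * \<sigma>)) * (f (y + \<sigma> *\<^sub>R h) - \<i> * c * u (y + \<sigma> *\<^sub>R h)))"
proof -
  have [measurable]: "cis \<in> borel_measurable borel"
    by (intro borel_measurable_continuous_onI continuous_intros)
  have "AE y in lborel. \<forall>c\<in>\<rat>. cis (- c) * u (y + h) - u y
     = (LINT \<sigma>:{0..1}|lborel. cis (- (c * \<sigma>)) * (f (y + \<sigma> *\<^sub>R h) - \<i> * c * u (y + \<sigma> *\<^sub>R h)))"
    using twisted_increment_AE_fixed_phase[OF assms] by (subst AE_ball_countable) (auto simp: countable_rat)
  then show ?thesis
    using AE_integrable_segment[OF f fint, of h] AE_integrable_segment[OF u uint, of h]
  proof eventually_elim
    case (elim y)
    let ?r = "\<lambda>c \<sigma>. cis (- (c * \<sigma>)) * (f (y + \<sigma> *\<^sub>R h) - \<i> * complex_of_real c * u (y + \<sigma> *\<^sub>R h))"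
    show ?case
    proof
      fix c :: real
      have "c \<in> closure \<rat>" by (simp add: Rats_closure_real)
      then obtain X where X: "\<And>n. X n \<in> \<rat>" "X \<longlonglongrightarrow> c"
        by (auto simp: closure_sequential)
      obtain C where C: "\<And>n. \<bar>X n\<bar> \<le> C"
        using convergent_imp_Bseq[OF convergentI[OF X(2)]] by (auto simp: Bseq_def)
      let ?w = "\<lambda>\<sigma>. norm (indicator {0..1} \<sigma> *\<^sub>R f (y + \<sigma> *\<^sub>R h)) + C * norm (indicator {0..1} \<sigma> *\<^sub>R u (y + \<sigma> *\<^sub>R h))"
      have w: "integrable lborel ?w"
        using elim(2,3) unfolding set_integrable_def
        by (intro Bochner_Integration.integrable_add integrable_mult_right integrable_norm)
      have bound: "AE \<sigma> in lborel. norm (indicator {0..1} \<sigma> *\<^sub>R ?r (X n) \<sigma>) \<le> ?w \<sigma>" for n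
      proof (rule AE_I2)
        fix \<sigma> :: real
        have "norm (f (y + \<sigma> *\<^sub>R h) - \<i> * complex_of_real (X n) * u (y + \<sigma> *\<^sub>R h))
            \<le> norm (f (y + \<sigma> *\<^sub>R h)) + \<bar>X n\<bar> * norm (u (y + \<sigma> *\<^sub>R h))"
          by (rule order_trans[OF norm_triangle_ineq4]) (simp add: norm_mult)
        also have "\<dots> \<le> norm (f (y + \<sigma> *\<^sub>R h)) + C * norm (u (y + \<sigma> *\<^sub>R h))"
          by (intro add_left_mono mult_right_mono C) auto
        finally show "norm (indicator {0..1} \<sigma> *\<^sub>R ?r (X n) \<sigma>) \<le> ?w \<sigma>"
          by (simp add: norm_mult split: split_indicator)
      qed
      have lim: "AE \<sigma> in lborel. (\<lambda>n. indicator {0..1} \<sigma> *\<^sub>R ?r (X n) \<sigma>) \<longlonglongrightarrow> indicator {0..1} \<sigma> *\<^sub>R ?r c \<sigma>"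
        by (intro AE_I2 tendsto_intros X)
      have meas: "(\<lambda>\<sigma>. indicator {0..1} \<sigma> *\<^sub>R ?r c \<sigma>) \<in> borel_measurable lborel" for c
        by measurable
      have "set_integrable lborel {0..1} (?r c)"
        unfolding set_integrable_def
        by (rule integrable_dominated_convergence[OF meas meas w lim bound])
      moreover have "(\<lambda>n. LINT \<sigma>:{0..1}|lborel. ?r (X n) \<sigma>) \<longlonglongrightarrow> (LINT \<sigma>:{0..1}|lborel. ?r c \<sigma>)"
        unfolding set_lebesgue_integral_def
        by (rule integral_dominated_convergence[OF meas meas w lim bound])
      moreover have "(LINT \<sigma>:{0..1}|lborel. ?r (X n) \<sigma>) = cis (- X n) * u (y + h) - u y" for n
        using elim(1) X(1)[of n] by simp
      moreover have "(\<lambda>n. cis (- X n) * u (y + h) - u y) \<longlonglongrightarrow> cis (- c) * u (y + h) - u y"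
        by (intro tendsto_intros X)
      ultimately show "set_integrable lborel {0..1} (?r c) \<and>
          cis (- c) * u (y + h) - u y = (LINT \<sigma>:{0..1}|lborel. ?r c \<sigma>)"
        by (simp add: LIMSEQ_unique)
    qed
  qed
qed

text \<open>
  Jensen's inequality for the square on the unit interval.
\<close>

lemma power2_norm_LINT_le:
  fixes r :: "real \<Rightarrow> complex"
  assumes r: "set_integrable lborel {0..1} r"
  shows "ennreal ((norm (LINT \<sigma>:{0..1}|lborel. r \<sigma>))\<^sup>2)
    \<le> (\<integral>\<^sup>+\<sigma>. indicator {0..1} \<sigma> * ennreal ((norm (r \<sigma>))\<^sup>2) \<partial>lborel)"
proof -
  let ?f = "\<lambda>\<sigma>. ennreal (norm (indicator {0..1} \<sigma> *\<^sub>R r \<sigma>))"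
  have m: "(\<lambda>\<sigma>. indicator {0..1} \<sigma> *\<^sub>R r \<sigma>) \<in> borel_measurable borel"
    using r unfolding set_integrable_def by (auto dest: borel_measurable_integrable)
  have [measurable]: "?f \<in> borel_measurable borel"
    by (rule measurable_compose[OF measurable_compose[OF m borel_measurable_norm] measurable_ennreal])
  have "ennreal (norm (LINT \<sigma>:{0..1}|lborel. r \<sigma>)) \<le> (\<integral>\<^sup>+\<sigma>. ?f \<sigma> \<partial>lborel)"
    unfolding set_lebesgue_integral_def by (rule integral_norm_bound_ennreal) (use r in \<open>simp add: set_integrable_def\<close>)
  also have "\<dots> = (\<integral>\<^sup>+\<sigma>. ?f \<sigma> * indicator {0..1} \<sigma> \<partial>lborel)"
    by (intro nn_integral_cong) (auto split: split_indicator)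
  finally have "(ennreal (norm (LINT \<sigma>:{0..1}|lborel. r \<sigma>)))\<^sup>2 \<le> (\<integral>\<^sup>+\<sigma>. ?f \<sigma> * indicator {0..1} \<sigma> \<partial>lborel)\<^sup>2"
    by (rule power_mono) simp
  also have "\<dots> \<le> (\<integral>\<^sup>+\<sigma>. (?f \<sigma>)\<^sup>2 \<partial>lborel) * (\<integral>\<^sup>+\<sigma>. (indicator {0..1} \<sigma>)\<^sup>2 \<partial>(lborel::real measure))"
    by (rule Cauchy_Schwarz_nn_integral) measurable
  also have "(\<lambda>\<sigma>. (indicator {0..1} \<sigma>)\<^sup>2) = (indicator {0..1} :: real \<Rightarrow> ennreal)"
    by (auto simp: fun_eq_iff split: split_indicator)
  also have "(\<integral>\<^sup>+\<sigma>. indicator {0..1} \<sigma> \<partial>(lborel::real measure)) = 1" by simp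
  also have "(\<integral>\<^sup>+\<sigma>. (?f \<sigma>)\<^sup>2 \<partial>lborel) = (\<integral>\<^sup>+\<sigma>. indicator {0..1} \<sigma> * ennreal ((norm (r \<sigma>))\<^sup>2) \<partial>lborel)"
    by (intro nn_integral_cong) (auto simp: ennreal_power split: split_indicator)
  finally show ?thesis by (simp add: ennreal_power)
qed

section \<open>Covariant difference quotients\<close>

text \<open>
  Borel representatives of \<open>u\<close> and of its weak gradient \<open>g\<close>, tested against the bumps. The components \<open>g - i A u\<close> of the covariant
  gradient are square integrable although \<open>g\<close> itself need not be.
\<close>

locale magnetic_sobolev =
  fixes A :: "real ^ 'n::finite \<Rightarrow> real ^ 'n" and u :: "real ^ 'n \<Rightarrow> complex"
    and g :: "real ^ 'n \<Rightarrow> complex ^ 'n" and L :: real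
  assumes lip: "L-lipschitz_on UNIV A"
    and u_measurable[measurable]: "u \<in> borel_measurable borel"
    and g_measurable[measurable]: "\<And>j. (\<lambda>x. g x $ j) \<in> borel_measurable borel"
    and u_local: "\<And>a b. set_integrable lborel (cbox a b) u"
    and g_local: "\<And>j a b. set_integrable lborel (cbox a b) (\<lambda>x. g x $ j)"
    and weak: "\<And>n a b j. (\<integral>x. frechet_derivative (box_bump n a b) (at x) (axis j 1) *\<^sub>R u x \<partial>lborel)
      = - (\<integral>x. box_bump n a b x *\<^sub>R (g x $ j) \<partial>lborel)"
    and u_L2: "(\<integral>\<^sup>+x. ennreal ((norm (u x))\<^sup>2) \<partial>lborel) < \<infinity>"
    and grad_L2: "\<And>j. (\<integral>\<^sup>+x. ennreal ((norm (g x $ j - \<i> * complex_of_real (A x $ j) * u x))\<^sup>2) \<partial>lborel) < \<infinity>"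
begin

text \<open>
  \<open>cov v\<close> is the covariant derivative \<open>v \<bullet> (\<nabla> - i A) u\<close>; \<open>phase v t y\<close> is the magnetic phase of the step
  \<open>t v\<close> starting at \<open>y\<close>; and \<open>rate v t y\<close> is the derivative of the twisted function along that step, divided
  by \<open>t\<close>. In \<open>rate\<close> the potential at the midpoint has been absorbed into the phase, which leaves only its
  variation on the segment.
\<close>

definition cov :: "real ^ 'n \<Rightarrow> real ^ 'n \<Rightarrow> complex" where
  "cov v x = (\<Sum>j\<in>UNIV. complex_of_real (v $ j) * (g x $ j - \<i> * complex_of_real (A x $ j) * u x))"

definition phase :: "real ^ 'n \<Rightarrow> real \<Rightarrow> real ^ 'n \<Rightarrow> real" where
  "phase v t y = t * (v \<bullet> A (y + (t / 2) *\<^sub>R v))"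

definition rate :: "real ^ 'n \<Rightarrow> real \<Rightarrow> real ^ 'n \<Rightarrow> real \<Rightarrow> complex" where
  "rate v t y \<sigma> = cis (- (phase v t y * \<sigma>)) * (cov v (y + (\<sigma> * t) *\<^sub>R v) +
     \<i> * complex_of_real (v \<bullet> (A (y + (\<sigma> * t) *\<^sub>R v) - A (y + (t / 2) *\<^sub>R v))) * u (y + (\<sigma> * t) *\<^sub>R v))"

lemma A_continuous: "continuous_on UNIV A"
  using lip by (rule lipschitz_on_continuous_on)

lemma A_measurable[measurable]: "A \<in> borel_measurable borel"
  by (rule borel_measurable_continuous_onI[OF A_continuous])

lemma A_component_measurable[measurable]: "(\<lambda>x. A x $ j) \<in> borel_measurable borel"
  by (intro borel_measurable_continuous_onI continuous_on_component A_continuous)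

lemma cis_measurable[measurable]: "cis \<in> borel_measurable borel"
  by (intro borel_measurable_continuous_onI continuous_intros)

lemma cov_measurable[measurable]: "cov v \<in> borel_measurable borel"
  unfolding cov_def by measurable

lemma phase_measurable[measurable]: "phase v t \<in> borel_measurable borel"
  unfolding phase_def by measurable

lemma weak_directional:
  "(\<integral>x. frechet_derivative (box_bump n a b) (at x) h *\<^sub>R u x \<partial>lborel)
    = - (\<integral>x. box_bump n a b x *\<^sub>R (\<Sum>j\<in>UNIV. complex_of_real (h $ j) * g x $ j) \<partial>lborel)"
proof -
  let ?\<phi> = "box_bump n a b"
  let ?D = "\<lambda>j x. frechet_derivative ?\<phi> (at x) (axis j 1)"
  have [measurable]: "?\<phi> \<in> borel_measurable borel" "?D j \<in> borel_measurable borel" for j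
    by (intro borel_measurable_continuous_onI flat_algebra_continuous flat_algebra_box_bump box_bump_deriv_continuous)+
  have lin: "frechet_derivative ?\<phi> (at x) h = (\<Sum>j\<in>UNIV. h $ j * ?D j x)" for x
  proof -
    have l: "linear (frechet_derivative ?\<phi> (at x))"
      by (rule has_derivative_linear[OF box_bump_deriv])
    have "h = (\<Sum>j\<in>UNIV. h $ j *\<^sub>R axis j 1)"
      using basis_expansion[of h] by (simp add: scalar_mult_eq_scaleR)
    then have "frechet_derivative ?\<phi> (at x) h = frechet_derivative ?\<phi> (at x) (\<Sum>j\<in>UNIV. h $ j *\<^sub>R axis j 1)"
      by (rule arg_cong)
    then show ?thesis by (simp add: linear_sum[OF l] linear_scale[OF l])
  qed
  have Dint: "integrable lborel (\<lambda>x. ?D j x *\<^sub>R u x)" for j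
  proof -
    have "compact (?D j ` cbox a b)"
      by (intro compact_continuous_image compact_cbox continuous_on_subset[OF box_bump_deriv_continuous]) simp
    then obtain M where M: "\<And>x. x \<in> cbox a b \<Longrightarrow> \<bar>?D j x\<bar> \<le> M"
      using compact_imp_bounded[of "?D j ` cbox a b"] unfolding bounded_iff by auto
    show ?thesis
    proof (rule Bochner_Integration.integrable_bound[OF integrable_scaleR_right[OF u_local[of a b, unfolded set_integrable_def]]])
      show "AE x in lborel. norm (?D j x *\<^sub>R u x) \<le> norm (M *\<^sub>R indicator (cbox a b) x *\<^sub>R u x)"
      proof (rule AE_I2)
        fix x
        show "norm (?D j x *\<^sub>R u x) \<le> norm (M *\<^sub>R indicator (cbox a b) x *\<^sub>R u x)"
          using M[of x] box_bump_deriv_eq_0[of x a b n "axis j 1"]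
          by (cases "x \<in> cbox a b") (auto intro!: mult_right_mono)
      qed
    qed measurable
  qed
  have gint: "integrable lborel (\<lambda>x. ?\<phi> x *\<^sub>R (g x $ j))" for j
  proof (rule Bochner_Integration.integrable_bound[OF g_local[of a b j, unfolded set_integrable_def]])
    show "AE x in lborel. norm (?\<phi> x *\<^sub>R (g x $ j)) \<le> norm (indicator (cbox a b) x *\<^sub>R (g x $ j))"
    proof (rule AE_I2)
      fix x
      show "norm (?\<phi> x *\<^sub>R (g x $ j)) \<le> norm (indicator (cbox a b) x *\<^sub>R (g x $ j))"
        using box_bump_bounds[of n a b x] box_bump_eq_0[of x a b n] subsetD[OF box_subset_cbox, of x a b]
        by (cases "x \<in> box a b") (auto intro!: mult_left_le_one_le)
    qed
  qed measurable
  have "(\<integral>x. frechet_derivative ?\<phi> (at x) h *\<^sub>R u x \<partial>lborel)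
      = (\<integral>x. (\<Sum>j\<in>UNIV. complex_of_real (h $ j) * (?D j x *\<^sub>R u x)) \<partial>lborel)"
    unfolding lin by (intro Bochner_Integration.integral_cong refl)
      (simp add: scaleR_conv_of_real sum_distrib_right mult.assoc)
  also have "\<dots> = (\<Sum>j\<in>UNIV. complex_of_real (h $ j) * (\<integral>x. ?D j x *\<^sub>R u x \<partial>lborel))"
    by (subst Bochner_Integration.integral_sum)
       (use Dint in \<open>auto simp only: integral_mult_right_zero intro!: integrable_mult_right\<close>)
  also have "\<dots> = - (\<Sum>j\<in>UNIV. complex_of_real (h $ j) * (\<integral>x. ?\<phi> x *\<^sub>R (g x $ j) \<partial>lborel))"
    unfolding weak by (simp add: sum_negf)
  also have "(\<Sum>j\<in>UNIV. complex_of_real (h $ j) * (\<integral>x. ?\<phi> x *\<^sub>R (g x $ j) \<partial>lborel))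
      = (\<integral>x. (\<Sum>j\<in>UNIV. complex_of_real (h $ j) * (?\<phi> x *\<^sub>R (g x $ j))) \<partial>lborel)"
    by (subst Bochner_Integration.integral_sum)
       (use gint in \<open>auto simp only: integral_mult_right_zero intro!: integrable_mult_right\<close>)
  also have "\<dots> = (\<integral>x. ?\<phi> x *\<^sub>R (\<Sum>j\<in>UNIV. complex_of_real (h $ j) * g x $ j) \<partial>lborel)"
    by (intro Bochner_Integration.integral_cong refl)
       (simp add: scaleR_conv_of_real sum_distrib_left mult.left_commute)
  finally show ?thesis .
qed

text \<open>
  The segment formula for \<open>h = t v\<close> and the phase speed of the midpoint. The weak derivative along \<open>v\<close> is
  \<open>cov v + i (v \<bullet> A) u\<close>, so the phase cancels the potential up to the difference kept in \<open>rate\<close>.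
\<close>

lemma twisted_quotient_AE:
  assumes t: "t > 0"
  shows "AE y in lborel. set_integrable lborel {0..1} (rate v t y) \<and>
    (cis (- phase v t y) * u (y + t *\<^sub>R v) - u y) / t = (LINT \<sigma>:{0..1}|lborel. rate v t y \<sigma>)"
proof -
  let ?f = "\<lambda>x. \<Sum>j\<in>UNIV. complex_of_real ((t *\<^sub>R v) $ j) * g x $ j"
  have fint: "set_integrable lborel (cbox a b) ?f" for a b
    unfolding set_integrable_def scaleR_sum_right mult_scaleR_right[symmetric]
    using g_local unfolding set_integrable_def
    by (intro Bochner_Integration.integrable_sum integrable_mult_right)
  have "AE y in lborel. \<forall>c::real.
     set_integrable lborel {0..1} (\<lambda>\<sigma>::real. cis (- (c * \<sigma>)) * (?f (y + \<sigma> *\<^sub>R t *\<^sub>R v) - \<i> * c * u (y + \<sigma> *\<^sub>R t *\<^sub>R v))) \<and>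
     cis (- c) * u (y + t *\<^sub>R v) - u y
     = (LINT \<sigma>:{0..1}|lborel. cis (- (c * \<sigma>)) * (?f (y + \<sigma> *\<^sub>R t *\<^sub>R v) - \<i> * c * u (y + \<sigma> *\<^sub>R t *\<^sub>R v)))"
    by (rule twisted_increment_AE[OF u_measurable _ u_local fint weak_directional]) measurable
  then show ?thesis
  proof eventually_elim
    case (elim y)
    have f: "?f x = complex_of_real t * (cov v x + \<i> * complex_of_real (v \<bullet> A x) * u x)" for x
      by (simp add: cov_def inner_vec_def sum_distrib_left sum_distrib_right sum_subtractf[symmetric]
          sum.distrib[symmetric] algebra_simps)
    have rate: "cis (- (phase v t y * \<sigma>)) * (?f (y + \<sigma> *\<^sub>R t *\<^sub>R v) - \<i> * phase v t y * u (y + \<sigma> *\<^sub>R t *\<^sub>R v))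
        = complex_of_real t * rate v t y \<sigma>" for \<sigma>
      unfolding f rate_def phase_def by (simp add: inner_diff_right algebra_simps)
    note e = elim[rule_format, of "phase v t y", unfolded rate]
    have "set_integrable lborel {0..1} (\<lambda>\<sigma>. inverse (complex_of_real t) * (complex_of_real t * rate v t y \<sigma>))"
      using e by (intro set_integrable_mult_right) auto
    moreover have "inverse (complex_of_real t) * (complex_of_real t * z) = z" for z
      using t by (simp add: field_simps)
    moreover have "(LINT \<sigma>:{0..1}|lborel. complex_of_real t * rate v t y \<sigma>)
        = complex_of_real t * (LINT \<sigma>:{0..1}|lborel. rate v t y \<sigma>)"
      by (rule set_integral_mult_right)
    ultimately show ?case using e t by (auto simp: field_simps)
  qed
qed

end

lemma power2_norm_add_le:
  fixes a b c :: complex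
  shows "(norm (a + b))\<^sup>2 \<le> 2 * (norm a)\<^sup>2 + 2 * (norm b)\<^sup>2"
    and "(norm (a + b + c))\<^sup>2 \<le> 3 * (norm a)\<^sup>2 + 3 * (norm b)\<^sup>2 + 3 * (norm c)\<^sup>2"
proof -
  have "(norm (a + b))\<^sup>2 \<le> (norm a + norm b)\<^sup>2"
    by (intro power_mono norm_triangle_ineq) simp
  also have "\<dots> \<le> 2 * (norm a)\<^sup>2 + 2 * (norm b)\<^sup>2"
    using zero_le_power2[of "norm a - norm b"] by (simp add: power2_eq_square algebra_simps)
  finally show "(norm (a + b))\<^sup>2 \<le> 2 * (norm a)\<^sup>2 + 2 * (norm b)\<^sup>2" .
  have "norm (a + b + c) \<le> norm a + norm b + norm c"
    by (intro order_trans[OF norm_triangle_ineq] add_right_mono norm_triangle_ineq)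
  then have "(norm (a + b + c))\<^sup>2 \<le> (norm a + norm b + norm c)\<^sup>2"
    by (intro power_mono) auto
  also have "\<dots> \<le> 3 * (norm a)\<^sup>2 + 3 * (norm b)\<^sup>2 + 3 * (norm c)\<^sup>2"
    using zero_le_power2[of "norm a - norm b"] zero_le_power2[of "norm a - norm c"] zero_le_power2[of "norm b - norm c"]
    by (simp add: power2_eq_square algebra_simps)
  finally show "(norm (a + b + c))\<^sup>2 \<le> 3 * (norm a)\<^sup>2 + 3 * (norm b)\<^sup>2 + 3 * (norm c)\<^sup>2" .
qed

text \<open>
  Convergence in \<open>L\<^sup>2\<close> implies convergence of the squared norms, by
  \<open>||a|\<^sup>2 - |b|\<^sup>2| \<le> d |b|\<^sup>2 + (1 + 1/d) |a - b|\<^sup>2\<close>. The number \<open>d\<close> is chosen so that the first term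
  contributes at most half of the error after integration.
\<close>

lemma tendsto_L2_norm:
  fixes f :: "'a \<Rightarrow> complex" and F :: "nat \<Rightarrow> 'a \<Rightarrow> complex"
  assumes [measurable]: "f \<in> borel_measurable M" "\<And>n. F n \<in> borel_measurable M"
    and fin: "(\<integral>\<^sup>+x. ennreal ((norm (f x))\<^sup>2) \<partial>M) < \<infinity>"
    and lim: "(\<lambda>n. \<integral>\<^sup>+x. ennreal ((norm (F n x - f x))\<^sup>2) \<partial>M) \<longlonglongrightarrow> 0"
  shows "(\<lambda>n. \<integral>\<^sup>+x. ennreal ((norm (F n x))\<^sup>2) \<partial>M) \<longlonglongrightarrow> (\<integral>\<^sup>+x. ennreal ((norm (f x))\<^sup>2) \<partial>M)"
proof (rule tendsto_ennreal_two_sided[OF fin])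
  fix e :: real assume e: "e > 0"
  obtain I where I: "(\<integral>\<^sup>+x. ennreal ((norm (f x))\<^sup>2) \<partial>M) = ennreal I" "I \<ge> 0"
    using fin by (cases "\<integral>\<^sup>+x. ennreal ((norm (f x))\<^sup>2) \<partial>M") auto
  define d where "d = e / (2 * (I + 1))"
  have d: "d > 0" "d * I \<le> e / 2" using e I by (auto simp: d_def field_simps)
  define K where "K = 1 + 1 / d"
  have K: "K > 0" using d by (simp add: K_def add_pos_pos)
  have ab: "(norm a)\<^sup>2 \<le> (norm b)\<^sup>2 + d * (norm b)\<^sup>2 + K * (norm (a - b))\<^sup>2"
    and ba: "(norm b)\<^sup>2 \<le> (norm a)\<^sup>2 + d * (norm b)\<^sup>2 + K * (norm (a - b))\<^sup>2" for a b :: complex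
  proof -
    let ?x = "norm a" and ?y = "norm b" and ?z = "norm (a - b)"
    have z: "\<bar>?x - ?y\<bar> \<le> ?z" by (rule norm_triangle_ineq3)
    have "\<bar>?x\<^sup>2 - ?y\<^sup>2\<bar> = \<bar>?x - ?y\<bar> * (?x + ?y)"
      by (simp add: power2_eq_square square_diff_square_factored abs_mult mult.commute)
    also have "\<dots> \<le> ?z * (?z + 2 * ?y)" using z by (intro mult_mono) auto
    also have "\<dots> \<le> d * ?y\<^sup>2 + K * ?z\<^sup>2"
      using zero_le_power2[of "d * ?y - ?z"] d
      by (simp add: K_def power2_eq_square field_simps)
    finally show "?x\<^sup>2 \<le> ?y\<^sup>2 + d * ?y\<^sup>2 + K * ?z\<^sup>2" "?y\<^sup>2 \<le> ?x\<^sup>2 + d * ?y\<^sup>2 + K * ?z\<^sup>2" by auto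
  qed
  have "\<forall>\<^sub>F n in sequentially. (\<integral>\<^sup>+x. ennreal ((norm (F n x - f x))\<^sup>2) \<partial>M) < ennreal (e / (2 * K))"
    using e K by (intro order_tendstoD(2)[OF lim]) auto
  then show "\<forall>\<^sub>F n in sequentially.
      (\<integral>\<^sup>+x. ennreal ((norm (F n x))\<^sup>2) \<partial>M) \<le> (\<integral>\<^sup>+x. ennreal ((norm (f x))\<^sup>2) \<partial>M) + ennreal e \<and>
      (\<integral>\<^sup>+x. ennreal ((norm (f x))\<^sup>2) \<partial>M) \<le> (\<integral>\<^sup>+x. ennreal ((norm (F n x))\<^sup>2) \<partial>M) + ennreal e"
  proof eventually_elim
    case (elim n)
    let ?f = "\<lambda>x. ennreal ((norm (f x))\<^sup>2)" and ?F = "\<lambda>x. ennreal ((norm (F n x))\<^sup>2)"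
      and ?D = "\<lambda>x. ennreal ((norm (F n x - f x))\<^sup>2)"
    have small: "ennreal d * (\<integral>\<^sup>+x. ?f x \<partial>M) + ennreal K * (\<integral>\<^sup>+x. ?D x \<partial>M) \<le> ennreal e"
    proof -
      have "ennreal K * (\<integral>\<^sup>+x. ?D x \<partial>M) \<le> ennreal K * ennreal (e / (2 * K))"
        using elim by (intro mult_left_mono) auto
      also have "\<dots> = ennreal (e / 2)" using K e by (simp flip: ennreal_mult)
      finally have "ennreal d * (\<integral>\<^sup>+x. ?f x \<partial>M) + ennreal K * (\<integral>\<^sup>+x. ?D x \<partial>M) \<le> ennreal (e / 2) + ennreal (e / 2)"
        using d I e by (intro add_mono) (auto simp flip: ennreal_mult)
      also have "\<dots> = ennreal e" using e by (simp flip: ennreal_plus)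
      finally show ?thesis .
    qed
    have "(\<integral>\<^sup>+x. ?F x \<partial>M) \<le> (\<integral>\<^sup>+x. ?f x + (ennreal d * ?f x + ennreal K * ?D x) \<partial>M)"
      using ab d K by (intro nn_integral_mono) (simp add: add.assoc flip: ennreal_mult ennreal_plus)
    also have "\<dots> = (\<integral>\<^sup>+x. ?f x \<partial>M) + (ennreal d * (\<integral>\<^sup>+x. ?f x \<partial>M) + ennreal K * (\<integral>\<^sup>+x. ?D x \<partial>M))"
      by (simp add: nn_integral_add nn_integral_cmult)
    also have "\<dots> \<le> (\<integral>\<^sup>+x. ?f x \<partial>M) + ennreal e" by (intro add_left_mono small)
    finally have 1: "(\<integral>\<^sup>+x. ?F x \<partial>M) \<le> (\<integral>\<^sup>+x. ?f x \<partial>M) + ennreal e" .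
    have "(\<integral>\<^sup>+x. ?f x \<partial>M) \<le> (\<integral>\<^sup>+x. ?F x + (ennreal d * ?f x + ennreal K * ?D x) \<partial>M)"
      using ba d K by (intro nn_integral_mono) (simp add: add.assoc flip: ennreal_mult ennreal_plus)
    also have "\<dots> = (\<integral>\<^sup>+x. ?F x \<partial>M) + (ennreal d * (\<integral>\<^sup>+x. ?f x \<partial>M) + ennreal K * (\<integral>\<^sup>+x. ?D x \<partial>M))"
      by (simp add: nn_integral_add nn_integral_cmult)
    also have "\<dots> \<le> (\<integral>\<^sup>+x. ?F x \<partial>M) + ennreal e" by (intro add_left_mono small)
    finally show ?case using 1 by blast
  qed
qed

context magnetic_sobolev
begin

definition energy :: ennreal where
  "energy = (\<Sum>j\<in>UNIV. \<integral>\<^sup>+x. ennreal ((norm (g x $ j - \<i> * complex_of_real (A x $ j) * u x))\<^sup>2) \<partial>lborel)"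

definition mass :: ennreal where
  "mass = (\<integral>\<^sup>+x. ennreal ((norm (u x))\<^sup>2) \<partial>lborel)"

definition quotient :: "real ^ 'n \<Rightarrow> real \<Rightarrow> real ^ 'n \<Rightarrow> complex" where
  "quotient v t y = (cis (- phase v t y) * u (y + t *\<^sub>R v) - u y) / t"

lemma quotient_measurable[measurable]: "quotient v t \<in> borel_measurable borel"
  unfolding quotient_def by measurable

lemma energy_finite: "energy < \<infinity>"
  using grad_L2 by (auto simp: energy_def)

lemma mass_finite: "mass < \<infinity>"
  using u_L2 by (simp add: mass_def)

lemma cov_L2_le: "(\<integral>\<^sup>+x. ennreal ((norm (cov v x))\<^sup>2) \<partial>lborel) \<le> ennreal ((norm v)\<^sup>2) * energy"
proof -
  let ?w = "\<lambda>j x. g x $ j - \<i> * complex_of_real (A x $ j) * u x"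
  have "(norm (cov v x))\<^sup>2 \<le> (norm v)\<^sup>2 * (\<Sum>j\<in>UNIV. (norm (?w j x))\<^sup>2)" for x
  proof -
    have "norm (cov v x) \<le> (\<Sum>j\<in>UNIV. \<bar>v $ j\<bar> * norm (?w j x))"
      unfolding cov_def by (rule order_trans[OF norm_sum]) (simp add: norm_mult)
    then have "(norm (cov v x))\<^sup>2 \<le> (\<Sum>j\<in>UNIV. \<bar>v $ j\<bar> * norm (?w j x))\<^sup>2"
      by (intro power_mono) auto
    also have "\<dots> \<le> (\<Sum>j\<in>UNIV. \<bar>v $ j\<bar>\<^sup>2) * (\<Sum>j\<in>UNIV. (norm (?w j x))\<^sup>2)"
      by (rule Cauchy_Schwarz_ineq_sum)
    also have "(\<Sum>j\<in>UNIV. \<bar>v $ j\<bar>\<^sup>2) = (norm v)\<^sup>2"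
      by (simp add: norm_vec_def L2_set_def sum_nonneg)
    finally show ?thesis .
  qed
  then have "(\<integral>\<^sup>+x. ennreal ((norm (cov v x))\<^sup>2) \<partial>lborel)
      \<le> (\<integral>\<^sup>+x. ennreal ((norm v)\<^sup>2) * (\<Sum>j\<in>UNIV. ennreal ((norm (?w j x))\<^sup>2)) \<partial>lborel)"
    by (intro nn_integral_mono) (simp add: sum_ennreal sum_nonneg flip: ennreal_mult)
  also have "\<dots> = ennreal ((norm v)\<^sup>2) * energy"
    by (simp add: nn_integral_cmult nn_integral_sum energy_def del: sum_ennreal)
  finally show ?thesis .
qed

lemma cov_L2: "(\<integral>\<^sup>+x. ennreal ((norm (cov v x))\<^sup>2) \<partial>lborel) < \<infinity>"
  using cov_L2_le[of v] energy_finite by (auto simp: ennreal_mult_less_top intro: le_less_trans)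

text \<open>
  The only place where the regularity of \<open>A\<close> enters quantitatively: every point of the segment has distance
  at most \<open>t |v|\<close> from its midpoint.
\<close>

lemma potential_variation:
  assumes "\<sigma> \<in> {0..1}" "t > 0"
  shows "\<bar>v \<bullet> (A (y + (\<sigma> * t) *\<^sub>R v) - A (y + (t / 2) *\<^sub>R v))\<bar> \<le> L * t * (norm v)\<^sup>2"
proof -
  have "norm (A (y + (\<sigma> * t) *\<^sub>R v) - A (y + (t / 2) *\<^sub>R v)) \<le> L * norm ((y + (\<sigma> * t) *\<^sub>R v) - (y + (t / 2) *\<^sub>R v))"
    using lipschitz_onD[OF lip, of "y + (\<sigma> * t) *\<^sub>R v" "y + (t / 2) *\<^sub>R v"] unfolding dist_norm by blast
  also have "(y + (\<sigma> * t) *\<^sub>R v) - (y + (t / 2) *\<^sub>R v) = ((\<sigma> - 1 / 2) * t) *\<^sub>R v"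
    by (simp add: algebra_simps)
  also have "norm \<dots> = \<bar>\<sigma> - 1 / 2\<bar> * t * norm v"
    using assms by (simp add: abs_mult)
  also have "L * (\<bar>\<sigma> - 1 / 2\<bar> * t * norm v) \<le> L * (1 * t * norm v)"
    using assms lipschitz_on_nonneg[OF lip] by (intro mult_left_mono mult_right_mono) (auto simp: abs_le_iff)
  finally have "norm v * norm (A (y + (\<sigma> * t) *\<^sub>R v) - A (y + (t / 2) *\<^sub>R v)) \<le> norm v * (L * (1 * t * norm v))"
    by (rule mult_left_mono) simp
  then show ?thesis
    using Cauchy_Schwarz_ineq2[of v "A (y + (\<sigma> * t) *\<^sub>R v) - A (y + (t / 2) *\<^sub>R v)"]
    by (simp add: power2_eq_square algebra_simps)
qed

lemma average_shift:
  assumes [measurable]: "f \<in> borel_measurable borel"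
  shows "(\<integral>\<^sup>+y. \<integral>\<^sup>+\<sigma>. indicator {0..1::real} \<sigma> * f (y + (\<sigma> * t) *\<^sub>R v) \<partial>lborel \<partial>lborel) = (\<integral>\<^sup>+y. f y \<partial>lborel)"
proof -
  have "(\<integral>\<^sup>+y. \<integral>\<^sup>+\<sigma>. indicator {0..1::real} \<sigma> * f (y + (\<sigma> * t) *\<^sub>R v) \<partial>lborel \<partial>lborel)
      = (\<integral>\<^sup>+\<sigma>. \<integral>\<^sup>+y. indicator {0..1::real} \<sigma> * f (y + (\<sigma> * t) *\<^sub>R v) \<partial>lborel \<partial>lborel)"
    by (rule lborel_pair.Fubini'[symmetric]) measurable
  also have "\<dots> = (\<integral>\<^sup>+\<sigma>. indicator {0..1::real} \<sigma> * (\<integral>\<^sup>+y. f y \<partial>lborel) \<partial>lborel)"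
    by (intro nn_integral_cong) (simp add: nn_integral_cmult nn_integral_lborel_shift)
  also have "\<dots> = (\<integral>\<^sup>+y. f y \<partial>lborel)" by (simp add: nn_integral_multc)
  finally show ?thesis .
qed

text \<open>
  Averaging \<open>|rate|\<^sup>2\<close> over the segment and integrating over \<open>y\<close> reproduces the \<open>L\<^sup>2\<close> norms, because
  translations preserve the measure.
\<close>

lemma quotient_L2_bound:
  assumes t: "t > 0"
  shows "(\<integral>\<^sup>+y. ennreal ((norm (quotient v t y))\<^sup>2) \<partial>lborel)
    \<le> 2 * (ennreal ((norm v)\<^sup>2) * energy) + ennreal (2 * (L * t * (norm v)\<^sup>2)\<^sup>2) * mass"
proof -
  let ?c = "2 * (L * t * (norm v)\<^sup>2)\<^sup>2"
  let ?q = "\<lambda>x. ennreal ((norm (cov v x))\<^sup>2)" and ?u = "\<lambda>x. ennreal ((norm (u x))\<^sup>2)"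
  have rate: "ennreal ((norm (rate v t y \<sigma>))\<^sup>2) \<le> 2 * ?q (y + (\<sigma> * t) *\<^sub>R v) + ennreal ?c * ?u (y + (\<sigma> * t) *\<^sub>R v)"
    if "\<sigma> \<in> {0..1}" for y \<sigma>
  proof -
    let ?z = "y + (\<sigma> * t) *\<^sub>R v"
    let ?d = "v \<bullet> (A ?z - A (y + (t / 2) *\<^sub>R v))"
    have "norm (rate v t y \<sigma>) = norm (cov v ?z + \<i> * complex_of_real ?d * u ?z)"
      unfolding rate_def by (simp only: norm_mult norm_cis mult_1)
    then have "(norm (rate v t y \<sigma>))\<^sup>2 \<le> 2 * (norm (cov v ?z))\<^sup>2 + 2 * (norm (\<i> * complex_of_real ?d * u ?z))\<^sup>2"
      by (simp only: power2_norm_add_le(1))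
    also have "(norm (\<i> * complex_of_real ?d * u ?z))\<^sup>2 = ?d\<^sup>2 * (norm (u ?z))\<^sup>2"
      by (simp add: norm_mult power_mult_distrib)
    also have "?d\<^sup>2 \<le> (L * t * (norm v)\<^sup>2)\<^sup>2"
      using potential_variation[OF that t, of v y] power_mono[OF _ abs_ge_zero, of ?d _ 2] by simp
    finally have "(norm (rate v t y \<sigma>))\<^sup>2 \<le> 2 * (norm (cov v ?z))\<^sup>2 + ?c * (norm (u ?z))\<^sup>2"
      by (simp add: mult_right_mono)
    then have "ennreal ((norm (rate v t y \<sigma>))\<^sup>2) \<le> ennreal (2 * (norm (cov v ?z))\<^sup>2 + ?c * (norm (u ?z))\<^sup>2)"
      by (rule ennreal_leI)
    then show ?thesis by (simp add: ennreal_mult)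
  qed
  have "(\<integral>\<^sup>+y. ennreal ((norm (quotient v t y))\<^sup>2) \<partial>lborel)
      \<le> (\<integral>\<^sup>+y. \<integral>\<^sup>+\<sigma>. indicator {0..1::real} \<sigma> * (2 * ?q (y + (\<sigma> * t) *\<^sub>R v) + ennreal ?c * ?u (y + (\<sigma> * t) *\<^sub>R v)) \<partial>lborel \<partial>lborel)"
  proof (rule nn_integral_mono_AE, use twisted_quotient_AE[OF t, of v] in eventually_elim)
    case (elim y)
    have "ennreal ((norm (quotient v t y))\<^sup>2) \<le> (\<integral>\<^sup>+\<sigma>. indicator {0..1} \<sigma> * ennreal ((norm (rate v t y \<sigma>))\<^sup>2) \<partial>lborel)"
      unfolding quotient_def using elim power2_norm_LINT_le[of "rate v t y"] by simp
    also have "\<dots> \<le> (\<integral>\<^sup>+\<sigma>. indicator {0..1::real} \<sigma> * (2 * ?q (y + (\<sigma> * t) *\<^sub>R v) + ennreal ?c * ?u (y + (\<sigma> * t) *\<^sub>R v)) \<partial>lborel)"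
      using rate by (intro nn_integral_mono) (simp split: split_indicator)
    finally show ?case .
  qed
  also have "\<dots> = 2 * (\<integral>\<^sup>+y. ?q y \<partial>lborel) + ennreal ?c * mass"
    unfolding mass_def by (subst average_shift[of "\<lambda>z. 2 * ?q z + ennreal ?c * ?u z"]) (simp_all add: nn_integral_add nn_integral_cmult)
  also have "\<dots> \<le> 2 * (ennreal ((norm v)\<^sup>2) * energy) + ennreal ?c * mass"
    by (intro add_right_mono mult_left_mono cov_L2_le) simp
  finally show ?thesis .
qed

lemma cis_minus_1_bound: "(norm (cis (- (p * \<sigma>)) - 1))\<^sup>2 \<le> min 4 (p\<^sup>2)" if "\<sigma> \<in> {0..1}"
proof -
  have "norm (cis (- (p * \<sigma>)) - 1) = 2 * \<bar>sin (- (p * \<sigma>) / 2)\<bar>"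
    unfolding cis_conv_exp by (rule dist_exp_i_1)
  moreover have "\<bar>sin (- (p * \<sigma>) / 2)\<bar> \<le> \<bar>- (p * \<sigma>) / 2\<bar>" by (rule abs_sin_x_le_abs_x)
  moreover have "\<bar>p * \<sigma>\<bar> \<le> \<bar>p\<bar>" using that by (simp add: abs_mult mult_left_le)
  moreover have "\<bar>sin (- (p * \<sigma>) / 2)\<bar> \<le> 1" by simp
  ultimately have "norm (cis (- (p * \<sigma>)) - 1) \<le> 2" "norm (cis (- (p * \<sigma>)) - 1) \<le> \<bar>p\<bar>" by simp_all
  from power_mono[OF this(1), of 2] power_mono[OF this(2), of 2] show ?thesis by simp
qed

text \<open>
  The difference \<open>rate - cov v\<close> splits into three terms: the translation error of \<open>cov v\<close> (\<open>T1\<close>), the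
  deviation of the phase factor from \<open>1\<close> (\<open>T2\<close>), and the variation of the potential. The first tends to zero
  by continuity of translations, the third is of order \<open>t\<close>. Since \<open>A\<close> is unbounded, the second is small
  only pointwise in \<open>y\<close>, but it is dominated by \<open>4 |cov v|\<^sup>2\<close>.
\<close>

lemma quotient_tendsto_cov_L2:
  assumes X: "\<And>n. X n > 0" "X \<longlonglongrightarrow> 0"
  shows "(\<lambda>n. \<integral>\<^sup>+y. ennreal ((norm (quotient v (X n) y - cov v y))\<^sup>2) \<partial>lborel) \<longlonglongrightarrow> 0"
proof -
  let ?c = "\<lambda>t. (L * t * (norm v)\<^sup>2)\<^sup>2"
  let ?q = "\<lambda>x. ennreal ((norm (cov v x))\<^sup>2)" and ?u = "\<lambda>x. ennreal ((norm (u x))\<^sup>2)"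
  let ?dq = "\<lambda>k y. ennreal ((norm (cov v (y + k) - cov v y))\<^sup>2)"
  let ?m = "\<lambda>t y. ennreal (min 4 ((phase v t y)\<^sup>2))"
  define T1 where "T1 t = (\<integral>\<^sup>+\<sigma>. indicator {0..1::real} \<sigma> * (\<integral>\<^sup>+y. ?dq ((\<sigma> * t) *\<^sub>R v) y \<partial>lborel) \<partial>lborel)" for t
  define T2 where "T2 t = (\<integral>\<^sup>+y. ?m t y * ?q y \<partial>lborel)" for t

  have T1: "(\<lambda>n. T1 (X n)) \<longlonglongrightarrow> (\<integral>\<^sup>+\<sigma>. 0 \<partial>(lborel::real measure))"
    unfolding T1_def
  proof (rule nn_integral_dominated_convergence[where w="\<lambda>\<sigma>. indicator {0..1} \<sigma> * (4 * (\<integral>\<^sup>+y. ?q y \<partial>lborel))"])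
    show "AE \<sigma> in lborel. indicator {0..1} \<sigma> * (\<integral>\<^sup>+y. ?dq ((\<sigma> * X n) *\<^sub>R v) y \<partial>lborel)
        \<le> indicator {0..1} \<sigma> * (4 * (\<integral>\<^sup>+y. ?q y \<partial>lborel))" for n
    proof (intro AE_I2 mult_left_mono)
      fix \<sigma>
      let ?k = "(\<sigma> * X n) *\<^sub>R v"
      have "(\<integral>\<^sup>+y. ?dq ?k y \<partial>lborel) \<le> (\<integral>\<^sup>+y. 2 * ?q (y + ?k) + 2 * ?q y \<partial>lborel)"
      proof (intro nn_integral_mono)
        fix y
        have "?dq ?k y \<le> ennreal (2 * (norm (cov v (y + ?k)))\<^sup>2 + 2 * (norm (cov v y))\<^sup>2)"
          using power2_norm_add_le(1)[of "cov v (y + ?k)" "- cov v y"] by (intro ennreal_leI) simp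
        then show "?dq ?k y \<le> 2 * ?q (y + ?k) + 2 * ?q y" by (simp add: ennreal_mult)
      qed
      also have "\<dots> = 2 * (\<integral>\<^sup>+y. ?q y \<partial>lborel) + 2 * (\<integral>\<^sup>+y. ?q y \<partial>lborel)"
        using nn_integral_lborel_shift[of ?q ?k] by (simp add: nn_integral_add nn_integral_cmult)
      also have "\<dots> = 4 * (\<integral>\<^sup>+y. ?q y \<partial>lborel)"
        by (simp flip: distrib_right)
      finally show "(\<integral>\<^sup>+y. ?dq ?k y \<partial>lborel) \<le> 4 * (\<integral>\<^sup>+y. ?q y \<partial>lborel)" .
    qed simp
    show "(\<integral>\<^sup>+\<sigma>. indicator {0..1} \<sigma> * (4 * (\<integral>\<^sup>+y. ?q y \<partial>lborel)) \<partial>(lborel::real measure)) < \<infinity>"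
      using cov_L2[of v] by (simp add: nn_integral_multc ennreal_mult_less_top)
    show "AE \<sigma> in lborel. (\<lambda>n. indicator {0..1} \<sigma> * (\<integral>\<^sup>+y. ?dq ((\<sigma> * X n) *\<^sub>R v) y \<partial>lborel)) \<longlonglongrightarrow> 0"
    proof (rule AE_I2)
      fix \<sigma> :: real
      have "(\<lambda>n. (\<sigma> * X n) *\<^sub>R v) \<longlonglongrightarrow> (\<sigma> * 0) *\<^sub>R v" by (intro tendsto_intros X)
      then have "(\<lambda>n. \<integral>\<^sup>+y. ?dq ((\<sigma> * X n) *\<^sub>R v) y \<partial>lborel) \<longlonglongrightarrow> 0"
        by (intro translation_continuous_L2 cov_L2) auto
      then show "(\<lambda>n. indicator {0..1} \<sigma> * (\<integral>\<^sup>+y. ?dq ((\<sigma> * X n) *\<^sub>R v) y \<partial>lborel)) \<longlonglongrightarrow> 0"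
        by (cases "\<sigma> \<in> {0..1}") auto
    qed
  qed measurable

  have T2: "(\<lambda>n. T2 (X n)) \<longlonglongrightarrow> (\<integral>\<^sup>+y. 0 \<partial>(lborel::(real ^ 'n) measure))"
    unfolding T2_def
  proof (rule nn_integral_dominated_convergence[where w="\<lambda>y. 4 * ?q y"])
    have "?m t y \<le> ennreal 4" for t y by (intro ennreal_leI) simp
    then show "AE y in lborel. ?m (X n) y * ?q y \<le> 4 * ?q y" for n
      by (intro AE_I2 mult_right_mono) auto
    show "(\<integral>\<^sup>+y. 4 * ?q y \<partial>lborel) < \<infinity>"
      using cov_L2[of v] by (simp add: nn_integral_cmult ennreal_mult_less_top)
    show "AE y in lborel. (\<lambda>n. ?m (X n) y * ?q y) \<longlonglongrightarrow> 0"
    proof (rule AE_I2)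
      fix y
      have "(\<lambda>n. y + (X n / 2) *\<^sub>R v) \<longlonglongrightarrow> y + (0 / 2) *\<^sub>R v" by (intro tendsto_intros X) simp
      from continuous_on_tendsto_compose[OF A_continuous this]
      have "(\<lambda>n. A (y + (X n / 2) *\<^sub>R v)) \<longlonglongrightarrow> A y" by simp
      then have "(\<lambda>n. min 4 ((phase v (X n) y)\<^sup>2)) \<longlonglongrightarrow> min 4 ((0 * (v \<bullet> A y))\<^sup>2)"
        unfolding phase_def by (intro tendsto_intros X)
      then have "(\<lambda>n. ?m (X n) y) \<longlonglongrightarrow> ennreal 0"
        by (intro tendsto_ennrealI) simp
      then have "(\<lambda>n. ?m (X n) y * ?q y) \<longlonglongrightarrow> ennreal 0 * ?q y"
        by (intro tendsto_mult_ennreal tendsto_const) auto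
      then show "(\<lambda>n. ?m (X n) y * ?q y) \<longlonglongrightarrow> 0" by simp
    qed
  qed measurable

  have bound: "(\<integral>\<^sup>+y. ennreal ((norm (quotient v t y - cov v y))\<^sup>2) \<partial>lborel) \<le> 3 * T1 t + 3 * T2 t + ennreal (3 * ?c t) * mass"
    if t: "t > 0" for t
  proof -
    let ?z = "\<lambda>y \<sigma>. y + (\<sigma> * t) *\<^sub>R v"
    let ?R = "\<lambda>y \<sigma>. 3 * ?dq ((\<sigma> * t) *\<^sub>R v) y + 3 * (?m t y * ?q y) + ennreal (3 * ?c t) * ?u (?z y \<sigma>)"
    have rate: "ennreal ((norm (rate v t y \<sigma> - cov v y))\<^sup>2) \<le> ?R y \<sigma>" if \<sigma>: "\<sigma> \<in> {0..1}" for y \<sigma>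
    proof -
      let ?d = "v \<bullet> (A (?z y \<sigma>) - A (y + (t / 2) *\<^sub>R v))" and ?e = "cis (- (phase v t y * \<sigma>))"
      have "rate v t y \<sigma> - cov v y = ?e * (cov v (?z y \<sigma>) - cov v y) + (?e - 1) * cov v y + ?e * (\<i> * complex_of_real ?d * u (?z y \<sigma>))"
        unfolding rate_def by (simp add: algebra_simps)
      then have "(norm (rate v t y \<sigma> - cov v y))\<^sup>2 \<le> 3 * (norm (?e * (cov v (?z y \<sigma>) - cov v y)))\<^sup>2
          + 3 * (norm ((?e - 1) * cov v y))\<^sup>2 + 3 * (norm (?e * (\<i> * complex_of_real ?d * u (?z y \<sigma>))))\<^sup>2"
        by (simp only: power2_norm_add_le(2))
      also have "\<dots> = 3 * (norm (cov v (?z y \<sigma>) - cov v y))\<^sup>2 + 3 * ((norm (?e - 1))\<^sup>2 * (norm (cov v y))\<^sup>2)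
          + 3 * (?d\<^sup>2 * (norm (u (?z y \<sigma>)))\<^sup>2)"
        by (simp add: norm_mult power_mult_distrib)
      also have "\<dots> \<le> 3 * (norm (cov v (?z y \<sigma>) - cov v y))\<^sup>2 + 3 * (min 4 ((phase v t y)\<^sup>2) * (norm (cov v y))\<^sup>2)
          + 3 * (?c t * (norm (u (?z y \<sigma>)))\<^sup>2)"
      proof -
        have "?d\<^sup>2 \<le> ?c t"
          using potential_variation[OF \<sigma> t, of v y] power_mono[OF _ abs_ge_zero, of ?d _ 2] by simp
        then show ?thesis
          by (intro add_mono mult_left_mono mult_right_mono cis_minus_1_bound[OF \<sigma>]) auto
      qed
      finally have "ennreal ((norm (rate v t y \<sigma> - cov v y))\<^sup>2)
         \<le> ennreal (3 * (norm (cov v (?z y \<sigma>) - cov v y))\<^sup>2 + 3 * (min 4 ((phase v t y)\<^sup>2) * (norm (cov v y))\<^sup>2)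
          + 3 * (?c t * (norm (u (?z y \<sigma>)))\<^sup>2))" by (rule ennreal_leI)
      also have "\<dots> = ?R y \<sigma>"
        by (simp add: ennreal_mult mult.assoc)
      finally show ?thesis .
    qed
    have "(\<integral>\<^sup>+y. ennreal ((norm (quotient v t y - cov v y))\<^sup>2) \<partial>lborel)
        \<le> (\<integral>\<^sup>+y. \<integral>\<^sup>+\<sigma>. indicator {0..1::real} \<sigma> * ?R y \<sigma> \<partial>lborel \<partial>lborel)"
    proof (rule nn_integral_mono_AE, use twisted_quotient_AE[OF t, of v] in eventually_elim)
      case (elim y)
      have c: "set_integrable lborel {0..1::real} (\<lambda>\<sigma>. cov v y)"
        by (simp add: set_integrable_def)
      have "quotient v t y - cov v y = (LINT \<sigma>:{0..1}|lborel. rate v t y \<sigma> - cov v y)"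
        unfolding quotient_def using elim c by (subst set_integral_diff) (auto simp: set_lebesgue_integral_def)
      then have "ennreal ((norm (quotient v t y - cov v y))\<^sup>2)
          \<le> (\<integral>\<^sup>+\<sigma>. indicator {0..1} \<sigma> * ennreal ((norm (rate v t y \<sigma> - cov v y))\<^sup>2) \<partial>lborel)"
        using power2_norm_LINT_le[of "\<lambda>\<sigma>. rate v t y \<sigma> - cov v y"] elim c by (simp add: set_integral_diff)
      also have "\<dots> \<le> (\<integral>\<^sup>+\<sigma>. indicator {0..1::real} \<sigma> * ?R y \<sigma> \<partial>lborel)"
        using rate by (intro nn_integral_mono) (simp split: split_indicator)
      finally show ?case .
    qed
    also have "\<dots> = (\<integral>\<^sup>+y. 3 * (\<integral>\<^sup>+\<sigma>. indicator {0..1::real} \<sigma> * ?dq ((\<sigma> * t) *\<^sub>R v) y \<partial>lborel) + 3 * (?m t y * ?q y)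
        + (\<integral>\<^sup>+\<sigma>. indicator {0..1::real} \<sigma> * (ennreal (3 * ?c t) * ?u (?z y \<sigma>)) \<partial>lborel) \<partial>lborel)"
    proof (intro nn_integral_cong)
      fix y
      have "(\<integral>\<^sup>+\<sigma>. indicator {0..1::real} \<sigma> * ?R y \<sigma> \<partial>lborel)
        = (\<integral>\<^sup>+\<sigma>. 3 * (indicator {0..1::real} \<sigma> * ?dq ((\<sigma> * t) *\<^sub>R v) y) + (3 * (?m t y * ?q y)) * indicator {0..1::real} \<sigma>
          + indicator {0..1::real} \<sigma> * (ennreal (3 * ?c t) * ?u (?z y \<sigma>)) \<partial>lborel)"
        by (intro nn_integral_cong) (auto split: split_indicator)
      also have "\<dots> = 3 * (\<integral>\<^sup>+\<sigma>. indicator {0..1::real} \<sigma> * ?dq ((\<sigma> * t) *\<^sub>R v) y \<partial>lborel) + 3 * (?m t y * ?q y)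
        + (\<integral>\<^sup>+\<sigma>. indicator {0..1::real} \<sigma> * (ennreal (3 * ?c t) * ?u (?z y \<sigma>)) \<partial>lborel)"
        by (simp add: nn_integral_add nn_integral_cmult)
      finally show "(\<integral>\<^sup>+\<sigma>. indicator {0..1::real} \<sigma> * ?R y \<sigma> \<partial>lborel) = \<dots>" .
    qed
    also have "\<dots> = 3 * (\<integral>\<^sup>+y. \<integral>\<^sup>+\<sigma>. indicator {0..1::real} \<sigma> * ?dq ((\<sigma> * t) *\<^sub>R v) y \<partial>lborel \<partial>lborel) + 3 * T2 t
        + (\<integral>\<^sup>+y. \<integral>\<^sup>+\<sigma>. indicator {0..1::real} \<sigma> * (ennreal (3 * ?c t) * ?u (?z y \<sigma>)) \<partial>lborel \<partial>lborel)"
      unfolding T2_def by (simp add: nn_integral_add nn_integral_cmult)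
    also have "(\<integral>\<^sup>+y. \<integral>\<^sup>+\<sigma>. indicator {0..1::real} \<sigma> * (ennreal (3 * ?c t) * ?u (?z y \<sigma>)) \<partial>lborel \<partial>lborel) = ennreal (3 * ?c t) * mass"
      unfolding mass_def by (subst average_shift[of "\<lambda>z. ennreal (3 * ?c t) * ?u z"]) (simp_all add: nn_integral_cmult)
    also have "(\<integral>\<^sup>+y. \<integral>\<^sup>+\<sigma>. indicator {0..1::real} \<sigma> * ?dq ((\<sigma> * t) *\<^sub>R v) y \<partial>lborel \<partial>lborel)
        = (\<integral>\<^sup>+\<sigma>. \<integral>\<^sup>+y. indicator {0..1::real} \<sigma> * ?dq ((\<sigma> * t) *\<^sub>R v) y \<partial>lborel \<partial>lborel)"
      by (rule lborel_pair.Fubini'[symmetric]) measurable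
    also have "\<dots> = T1 t"
      unfolding T1_def by (intro nn_integral_cong) (simp add: nn_integral_cmult)
    finally show ?thesis .
  qed
  show ?thesis
  proof (rule tendsto_sandwich[OF _ _ tendsto_const])
    have "(\<lambda>n. 3 * ?c (X n)) \<longlonglongrightarrow> 3 * ?c 0" by (intro tendsto_intros X)
    then have "(\<lambda>n. ennreal (3 * ?c (X n))) \<longlonglongrightarrow> ennreal 0" by (intro tendsto_ennrealI) simp
    then have "(\<lambda>n. 3 * T1 (X n) + 3 * T2 (X n) + ennreal (3 * ?c (X n)) * mass) \<longlonglongrightarrow> 3 * 0 + 3 * 0 + ennreal 0 * mass"
      using T1 T2 mass_finite by (intro tendsto_add tendsto_mult_ennreal tendsto_const) auto
    then show "(\<lambda>n. 3 * T1 (X n) + 3 * T2 (X n) + ennreal (3 * ?c (X n)) * mass) \<longlonglongrightarrow> 0" by simp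
    show "\<forall>\<^sub>F n in sequentially. (\<integral>\<^sup>+y. ennreal ((norm (quotient v (X n) y - cov v y))\<^sup>2) \<partial>lborel)
        \<le> 3 * T1 (X n) + 3 * T2 (X n) + ennreal (3 * ?c (X n)) * mass"
      using X bound by (intro always_eventually allI) blast
  qed auto
qed

lemma quotient_L2_norm_tendsto:
  assumes X: "\<And>n. X n > 0" "X \<longlonglongrightarrow> 0"
  shows "(\<lambda>n. \<integral>\<^sup>+y. ennreal ((norm (quotient v (X n) y))\<^sup>2) \<partial>lborel)
    \<longlonglongrightarrow> (\<integral>\<^sup>+y. ennreal ((norm (cov v y))\<^sup>2) \<partial>lborel)"
  by (rule tendsto_L2_norm[OF _ _ cov_L2 quotient_tendsto_cov_L2[OF X]]) auto

end

section \<open>Gaussian averages\<close>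

definition gauss :: "'a::euclidean_space \<Rightarrow> real" where
  "gauss v = (\<Prod>b\<in>Basis. std_normal_density (v \<bullet> b))"

lemma gauss_nonneg[simp]: "0 \<le> gauss v"
  by (simp add: gauss_def prod_nonneg)

lemma gauss_measurable[measurable]: "gauss \<in> borel_measurable borel"
  unfolding gauss_def[abs_def] by measurable

lemma power2_norm_eq_sum_coordinates: "(norm v)\<^sup>2 = (\<Sum>b\<in>Basis. (v \<bullet> b)\<^sup>2)"
  unfolding power2_norm_eq_inner by (subst euclidean_inner) (simp add: power2_eq_square)

lemma gauss_eq: "gauss (v::'a::euclidean_space) = exp (- (norm v)\<^sup>2 / 2) / sqrt (2 * pi) ^ DIM('a)"
  unfolding power2_norm_eq_sum_coordinates
  by (simp add: gauss_def normal_density_def prod_dividef exp_sum sum_negf[symmetric] sum_divide_distrib)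

lemma nn_integral_gauss_coordinate:
  fixes b :: "'a::euclidean_space"
  assumes b: "b \<in> Basis" and [measurable]: "f \<in> borel_measurable borel"
  shows "(\<integral>\<^sup>+v. ennreal (gauss v) * f (v \<bullet> b) \<partial>lborel) = (\<integral>\<^sup>+x. ennreal (std_normal_density x) * f x \<partial>lborel)"
proof -
  let ?F = "\<lambda>c x. ennreal (std_normal_density x) * (if c = b then f x else 1)"
  have one: "(\<integral>\<^sup>+x. ennreal (std_normal_density x) \<partial>lborel) = 1"
    using nn_integral_eq_integral[of lborel std_normal_density] by simp
  have "(\<integral>\<^sup>+v. ennreal (gauss v) * f (v \<bullet> b) \<partial>lborel) = (\<integral>\<^sup>+v. (\<Prod>c\<in>Basis. ?F c (v \<bullet> c)) \<partial>lborel)"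
    using b by (intro nn_integral_cong)
      (simp add: gauss_def prod.distrib prod_ennreal prod.delta[of Basis b "\<lambda>c. f (_ \<bullet> c)"])
  also have "\<dots> = (\<Prod>c\<in>Basis. \<integral>\<^sup>+x. ?F c x \<partial>lborel)"
    by (rule nn_integral_lborel_prod) auto
  also have "\<dots> = (\<Prod>c\<in>Basis. if c = b then \<integral>\<^sup>+x. ennreal (std_normal_density x) * f x \<partial>lborel else 1)"
    by (intro prod.cong) (auto simp: one)
  also have "\<dots> = (\<integral>\<^sup>+x. ennreal (std_normal_density x) * f x \<partial>lborel)"
    using b by simp
  finally show ?thesis .
qed

lemma nn_integral_gauss_moment:
  assumes b: "b \<in> Basis"
  shows "(\<integral>\<^sup>+v. ennreal (gauss v) * ennreal ((v \<bullet> b) ^ (2 * k)) \<partial>lborel) = ennreal (fact (2 * k) / (2 ^ k * fact k))"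
proof -
  have "(\<integral>\<^sup>+v. ennreal (gauss v) * ennreal ((v \<bullet> b) ^ (2 * k)) \<partial>lborel)
      = (\<integral>\<^sup>+x. ennreal (std_normal_density x * x ^ (2 * k)) \<partial>lborel)"
    by (subst nn_integral_gauss_coordinate[OF b, of "\<lambda>x. ennreal (x ^ (2 * k))"])
       (auto simp: ennreal_mult' zero_le_even_power)
  also have "\<dots> = ennreal (fact (2 * k) / (2 ^ k * fact k))"
    using std_normal_moment_even[of k] has_bochner_integral_iff
    by (subst nn_integral_eq_integral) (auto simp: has_bochner_integral_iff zero_le_even_power)
  finally show ?thesis .
qed

lemma nn_integral_lborel_reflect:
  fixes b :: "'a::euclidean_space"
  assumes b: "b \<in> Basis" and [measurable]: "f \<in> borel_measurable borel"
  shows "(\<integral>\<^sup>+v. f (v - (2 * (v \<bullet> b)) *\<^sub>R b) \<partial>lborel) = (\<integral>\<^sup>+v. f v \<partial>lborel)"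
proof -
  let ?c = "\<lambda>j. if j = b then - 1 else 1 :: real"
  have T: "0 + (\<Sum>j\<in>Basis. (?c j * (x \<bullet> j)) *\<^sub>R j) = x - (2 * (x \<bullet> b)) *\<^sub>R b" for x
    by (rule euclidean_eqI) (use b in \<open>auto simp: inner_diff_left inner_Basis\<close>)
  have one: "(\<Prod>j\<in>(Basis::'a set). \<bar>?c j\<bar>) = 1" by (intro prod.neutral) auto
  have "lborel = density (distr lborel borel (\<lambda>x. 0 + (\<Sum>j\<in>Basis. (?c j * (x \<bullet> j)) *\<^sub>R j)))
      (\<lambda>_. ennreal (\<Prod>j\<in>(Basis::'a set). \<bar>?c j\<bar>))"
    by (rule lborel_affine_euclidean) auto
  then have eq: "lborel = distr lborel borel (\<lambda>x. x - (2 * (x \<bullet> b)) *\<^sub>R b)"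
    unfolding T one by (simp add: density_1)
  have "(\<integral>\<^sup>+v. f v \<partial>lborel) = (\<integral>\<^sup>+v. f v \<partial>distr lborel borel (\<lambda>x. x - (2 * (x \<bullet> b)) *\<^sub>R b))"
    using eq by simp
  also have "\<dots> = (\<integral>\<^sup>+v. f (v - (2 * (v \<bullet> b)) *\<^sub>R b) \<partial>lborel)"
    by (rule nn_integral_distr) auto
  finally show ?thesis ..
qed

lemma norm_reflect: "b \<in> Basis \<Longrightarrow> norm (v - (2 * (v \<bullet> b)) *\<^sub>R b) = norm v"
  by (simp add: norm_eq inner_diff_left inner_diff_right inner_commute)

text \<open>
  A standard Gaussian vector has identity covariance. Mixed moments vanish by reflection symmetry, which in
  terms of nonnegative integrals reads as follows: reflecting the coordinate \<open>b\<close> exchanges the integrals for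
  \<open>c\<^sub>b b + a\<close> and \<open>c\<^sub>b b - a\<close>, and the parallelogram identity evaluates their sum.
\<close>

lemma nn_integral_gauss_quadratic:
  fixes c :: "'a::euclidean_space \<Rightarrow> real"
  assumes "S \<subseteq> Basis"
  shows "(\<integral>\<^sup>+v. ennreal (gauss v) * ennreal ((v \<bullet> (\<Sum>b\<in>S. c b *\<^sub>R b))\<^sup>2) \<partial>lborel) = ennreal (\<Sum>b\<in>S. (c b)\<^sup>2)"
proof -
  have "finite S" using assms finite_Basis finite_subset by blast
  then show ?thesis using assms
  proof (induction S rule: finite_induct)
    case (insert b S)
    let ?a = "\<Sum>b\<in>S. c b *\<^sub>R b" and ?d = "c b *\<^sub>R b"
    let ?I = "\<lambda>a. \<integral>\<^sup>+v. ennreal (gauss v) * ennreal ((v \<bullet> a)\<^sup>2) \<partial>lborel"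
    have b: "b \<in> Basis" using insert by auto
    have ab: "b \<bullet> ?a = 0"
      using insert b by (auto simp: inner_sum_right inner_Basis intro!: sum.neutral)
    have "?I (?d + ?a) = (\<integral>\<^sup>+v. ennreal (gauss (v - (2 * (v \<bullet> b)) *\<^sub>R b)) *
        ennreal (((v - (2 * (v \<bullet> b)) *\<^sub>R b) \<bullet> (?d + ?a))\<^sup>2) \<partial>lborel)"
      by (rule nn_integral_lborel_reflect[OF b, symmetric]) measurable
    also have "\<dots> = ?I (?d - ?a)"
    proof (intro nn_integral_cong)
      fix v
      have "(v - (2 * (v \<bullet> b)) *\<^sub>R b) \<bullet> (?d + ?a) = - (v \<bullet> (?d - ?a))"
        using ab b by (simp add: inner_diff_left inner_diff_right inner_add_right)
      then show "ennreal (gauss (v - (2 * (v \<bullet> b)) *\<^sub>R b)) * ennreal (((v - (2 * (v \<bullet> b)) *\<^sub>R b) \<bullet> (?d + ?a))\<^sup>2)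
          = ennreal (gauss v) * ennreal ((v \<bullet> (?d - ?a))\<^sup>2)"
        by (simp only: gauss_eq norm_reflect[OF b] power2_minus)
    qed
    finally have refl: "?I (?d + ?a) = ?I (?d - ?a)" .
    have "2 * ?I (?d + ?a) = ?I (?d + ?a) + ?I (?d - ?a)" by (simp only: refl mult_2)
    also have "\<dots> = (\<integral>\<^sup>+v. ennreal (gauss v) * ennreal ((v \<bullet> (?d + ?a))\<^sup>2 + (v \<bullet> (?d - ?a))\<^sup>2) \<partial>lborel)"
      by (subst nn_integral_add[symmetric]) (auto simp: distrib_left)
    also have "\<dots> = (\<integral>\<^sup>+v. ennreal (2 * (c b)\<^sup>2) * (ennreal (gauss v) * ennreal ((v \<bullet> b) ^ (2 * 1)))
        + 2 * (ennreal (gauss v) * ennreal ((v \<bullet> ?a)\<^sup>2)) \<partial>lborel)"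
    proof (intro nn_integral_cong)
      fix v
      have "(v \<bullet> (?d + ?a))\<^sup>2 + (v \<bullet> (?d - ?a))\<^sup>2 = 2 * (c b)\<^sup>2 * (v \<bullet> b)\<^sup>2 + 2 * (v \<bullet> ?a)\<^sup>2"
        unfolding inner_add_right inner_diff_right inner_scaleR_right by (simp add: power2_eq_square algebra_simps)
      then have "ennreal (gauss v) * ennreal ((v \<bullet> (?d + ?a))\<^sup>2 + (v \<bullet> (?d - ?a))\<^sup>2)
        = ennreal (gauss v) * ennreal (2 * (c b)\<^sup>2 * (v \<bullet> b)\<^sup>2 + 2 * (v \<bullet> ?a)\<^sup>2)" by (simp only:)
      also have "\<dots> = ennreal (gauss v) * (ennreal (2 * (c b)\<^sup>2) * ennreal ((v \<bullet> b)\<^sup>2) + 2 * ennreal ((v \<bullet> ?a)\<^sup>2))"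
        by (simp add: ennreal_mult)
      finally show "ennreal (gauss v) * ennreal ((v \<bullet> (?d + ?a))\<^sup>2 + (v \<bullet> (?d - ?a))\<^sup>2)
        = ennreal (2 * (c b)\<^sup>2) * (ennreal (gauss v) * ennreal ((v \<bullet> b) ^ (2 * 1)))
        + 2 * (ennreal (gauss v) * ennreal ((v \<bullet> ?a)\<^sup>2))"
        by (simp add: distrib_left mult.left_commute)
    qed
    also have "\<dots> = ennreal (2 * (c b)\<^sup>2) * 1 + 2 * ?I ?a"
      using nn_integral_gauss_moment[OF b, of 1]
      by (subst nn_integral_add; simp add: nn_integral_cmult)
    also have "?I ?a = ennreal (\<Sum>b\<in>S. (c b)\<^sup>2)" using insert by auto
    also have "ennreal (2 * (c b)\<^sup>2) * 1 + 2 * ennreal (\<Sum>b\<in>S. (c b)\<^sup>2) = 2 * ennreal (\<Sum>b\<in>insert b S. (c b)\<^sup>2)"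
      using insert by (simp add: ennreal_mult sum_nonneg distrib_left)
    finally have "2 * ?I (?d + ?a) = 2 * ennreal (\<Sum>b\<in>insert b S. (c b)\<^sup>2)" .
    then have "?I (?d + ?a) = ennreal (\<Sum>b\<in>insert b S. (c b)\<^sup>2)"
      by (simp add: ennreal_mult_cancel_left)
    then show ?case using insert by simp
  qed simp
qed

lemma nn_integral_gauss_inner:
  "(\<integral>\<^sup>+v. ennreal (gauss v) * ennreal ((v \<bullet> a)\<^sup>2) \<partial>lborel) = ennreal ((norm (a::'a::euclidean_space))\<^sup>2)"
  using nn_integral_gauss_quadratic[of Basis "\<lambda>b. a \<bullet> b"]
  by (simp add: euclidean_representation power2_norm_eq_sum_coordinates)

text \<open>
  These two moments make the bound on the difference quotients integrable against the Gaussian.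
\<close>

lemma nn_integral_gauss_norm_power:
  "(\<integral>\<^sup>+v. ennreal (gauss v) * ennreal ((norm (v::'a::euclidean_space)) ^ 2) \<partial>lborel) < \<infinity>"
  "(\<integral>\<^sup>+v. ennreal (gauss v) * ennreal ((norm (v::'a::euclidean_space)) ^ 4) \<partial>lborel) < \<infinity>"
proof -
  have n2: "(norm v)\<^sup>2 = (\<Sum>b\<in>Basis. (v \<bullet> b) ^ (2 * 1))" for v :: 'a
    by (simp add: power2_norm_eq_sum_coordinates)
  have n4: "(norm v) ^ 4 \<le> (\<Sum>b\<in>Basis. real DIM('a) * (v \<bullet> b) ^ (2 * 2))" for v :: 'a
  proof -
    have "(norm v) ^ 4 = ((norm v)\<^sup>2)\<^sup>2" by (simp flip: power_mult)
    also have "\<dots> = (\<Sum>b\<in>Basis. 1 * (v \<bullet> b)\<^sup>2)\<^sup>2"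
      unfolding power2_norm_eq_sum_coordinates by simp
    also have "\<dots> \<le> (\<Sum>b\<in>(Basis::'a set). 1\<^sup>2) * (\<Sum>b\<in>Basis. ((v \<bullet> b)\<^sup>2)\<^sup>2)"
      by (rule Cauchy_Schwarz_ineq_sum)
    finally show ?thesis by (simp add: sum_distrib_left flip: power_mult)
  qed
  have "(\<integral>\<^sup>+v. ennreal (gauss v) * ennreal ((norm (v::'a)) ^ 2) \<partial>lborel)
    = (\<Sum>b\<in>Basis. \<integral>\<^sup>+v. ennreal (gauss v) * ennreal ((v \<bullet> b) ^ (2 * 1)) \<partial>(lborel::'a measure))"
    unfolding n2 by (subst nn_integral_sum[symmetric])
      (auto simp: sum_distrib_left[symmetric] sum_ennreal intro!: nn_integral_cong)
  also have "\<dots> < \<infinity>" using nn_integral_gauss_moment[where k=1 and 'a='a] by (simp add: of_nat_less_top)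
  finally show "(\<integral>\<^sup>+v. ennreal (gauss v) * ennreal ((norm (v::'a::euclidean_space)) ^ 2) \<partial>lborel) < \<infinity>" .
  have "(\<integral>\<^sup>+v. ennreal (gauss v) * ennreal ((norm (v::'a)) ^ 4) \<partial>lborel)
    \<le> (\<integral>\<^sup>+v. (\<Sum>b\<in>Basis. ennreal DIM('a) * (ennreal (gauss v) * ennreal ((v \<bullet> b) ^ (2 * 2)))) \<partial>(lborel::'a measure))"
  proof (intro nn_integral_mono)
    fix v :: 'a
    have "ennreal ((norm v) ^ 4) \<le> ennreal (\<Sum>b\<in>Basis. real DIM('a) * (v \<bullet> b) ^ (2 * 2))"
      by (intro ennreal_leI n4)
    also have "\<dots> = (\<Sum>b\<in>Basis. ennreal DIM('a) * ennreal ((v \<bullet> b) ^ (2 * 2)))"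
      by (subst sum_ennreal[symmetric]) (auto simp: ennreal_mult zero_le_even_power)
    finally show "ennreal (gauss v) * ennreal ((norm v) ^ 4)
        \<le> (\<Sum>b\<in>Basis. ennreal DIM('a) * (ennreal (gauss v) * ennreal ((v \<bullet> b) ^ (2 * 2))))"
      by (simp add: sum_distrib_left[symmetric] mult.left_commute mult_left_mono del: of_nat_mult ennreal_of_nat_eq_real_of_nat)
  qed
  also have "\<dots> = (\<Sum>b\<in>Basis. ennreal DIM('a) * \<integral>\<^sup>+v. ennreal (gauss v) * ennreal ((v \<bullet> b) ^ (2 * 2)) \<partial>(lborel::'a measure))"
    by (subst nn_integral_sum) (auto intro!: sum.cong simp: nn_integral_cmult)
  also have "\<dots> < \<infinity>" using nn_integral_gauss_moment[where k=2 and 'a='a] by (simp add: ennreal_mult_less_top of_nat_less_top)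
  finally show "(\<integral>\<^sup>+v. ennreal (gauss v) * ennreal ((norm (v::'a::euclidean_space)) ^ 4) \<partial>lborel) < \<infinity>" .
qed

context magnetic_sobolev
begin

lemma quotient_measurable_pair[measurable]: "(\<lambda>(v, y). quotient v t y) \<in> borel_measurable (borel \<Otimes>\<^sub>M borel)"
  unfolding quotient_def phase_def by measurable

lemma cov_measurable_pair[measurable]: "(\<lambda>(v, y). cov v y) \<in> borel_measurable (borel \<Otimes>\<^sub>M borel)"
proof -
  have [measurable]: "(\<lambda>v :: real ^ 'n. v $ j) \<in> borel_measurable borel" for j
    by (intro borel_measurable_continuous_onI continuous_intros)
  show ?thesis unfolding cov_def by measurable
qed

definition gauss_average :: "real \<Rightarrow> ennreal" where
  "gauss_average r = (\<integral>\<^sup>+v. ennreal (gauss v) * (\<integral>\<^sup>+y. ennreal ((norm (quotient v r y))\<^sup>2) \<partial>lborel) \<partial>lborel)"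

text \<open>
  At every point the average of \<open>|v \<bullet> w|\<^sup>2\<close> over \<open>v\<close> is \<open>|w|\<^sup>2\<close>, applied to the real and the imaginary
  part of the covariant gradient.
\<close>

lemma gauss_average_cov:
  "(\<integral>\<^sup>+v. ennreal (gauss v) * (\<integral>\<^sup>+y. ennreal ((norm (cov v y))\<^sup>2) \<partial>lborel) \<partial>lborel) = energy"
proof -
  let ?w = "\<lambda>j x. g x $ j - \<i> * complex_of_real (A x $ j) * u x"
  have pt: "(\<integral>\<^sup>+v. ennreal (gauss v) * ennreal ((norm (cov v y))\<^sup>2) \<partial>lborel)
      = (\<Sum>j\<in>UNIV. ennreal ((norm (?w j y))\<^sup>2))" for y
  proof -
    let ?a = "\<chi> j. Re (?w j y)" and ?b = "\<chi> j. Im (?w j y)"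
    have "Re (cov v y) = v \<bullet> ?a" "Im (cov v y) = v \<bullet> ?b" for v
      unfolding cov_def by (simp_all add: inner_vec_def)
    then have c: "(norm (cov v y))\<^sup>2 = (v \<bullet> ?a)\<^sup>2 + (v \<bullet> ?b)\<^sup>2" for v
      by (simp add: cmod_power2)
    have "(\<integral>\<^sup>+v. ennreal (gauss v) * ennreal ((norm (cov v y))\<^sup>2) \<partial>lborel)
      = (\<integral>\<^sup>+v. ennreal (gauss v) * ennreal ((v \<bullet> ?a)\<^sup>2) + ennreal (gauss v) * ennreal ((v \<bullet> ?b)\<^sup>2) \<partial>lborel)"
      unfolding c by (intro nn_integral_cong) (simp add: distrib_left)
    also have "\<dots> = ennreal ((norm ?a)\<^sup>2) + ennreal ((norm ?b)\<^sup>2)"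
      by (subst nn_integral_add) (measurable, simp only: nn_integral_gauss_inner)
    also have "\<dots> = ennreal (\<Sum>j\<in>UNIV. (norm (?w j y))\<^sup>2)"
      by (simp add: norm_vec_def L2_set_def sum_nonneg cmod_power2 sum.distrib flip: ennreal_plus)
    also have "\<dots> = (\<Sum>j\<in>UNIV. ennreal ((norm (?w j y))\<^sup>2))"
      by (rule sum_ennreal[symmetric]) simp
    finally show ?thesis .
  qed
  have "(\<integral>\<^sup>+v. ennreal (gauss v) * (\<integral>\<^sup>+y. ennreal ((norm (cov v y))\<^sup>2) \<partial>lborel) \<partial>lborel)
      = (\<integral>\<^sup>+v. \<integral>\<^sup>+y. ennreal (gauss v) * ennreal ((norm (cov v y))\<^sup>2) \<partial>lborel \<partial>lborel)"
    by (intro nn_integral_cong) (simp add: nn_integral_cmult)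
  also have "\<dots> = (\<integral>\<^sup>+y. \<integral>\<^sup>+v. ennreal (gauss v) * ennreal ((norm (cov v y))\<^sup>2) \<partial>lborel \<partial>lborel)"
    by (rule lborel_pair.Fubini') measurable
  also have "\<dots> = energy"
    unfolding pt energy_def by (rule nn_integral_sum) measurable
  finally show ?thesis .
qed

lemma gauss_quotient_le:
  assumes "t > 0" "t \<le> C"
  shows "ennreal (gauss v) * (\<integral>\<^sup>+y. ennreal ((norm (quotient v t y))\<^sup>2) \<partial>lborel)
    \<le> 2 * energy * (ennreal (gauss v) * ennreal ((norm v)\<^sup>2))
      + ennreal (2 * (L * C)\<^sup>2) * mass * (ennreal (gauss v) * ennreal ((norm v) ^ 4))"
proof -
  have "2 * (L * t * (norm v)\<^sup>2)\<^sup>2 = 2 * (L * t)\<^sup>2 * norm v ^ 4"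
    by (simp add: power_mult_distrib flip: power_mult)
  also have "\<dots> \<le> 2 * (L * C)\<^sup>2 * norm v ^ 4"
    using assms lipschitz_on_nonneg[OF lip]
    by (intro mult_right_mono mult_left_mono power_mono mult_nonneg_nonneg) auto
  finally have "ennreal (2 * (L * t * (norm v)\<^sup>2)\<^sup>2) \<le> ennreal (2 * (L * C)\<^sup>2) * ennreal (norm v ^ 4)"
    by (simp add: ennreal_leI flip: ennreal_mult)
  then have "(\<integral>\<^sup>+y. ennreal ((norm (quotient v t y))\<^sup>2) \<partial>lborel)
      \<le> 2 * (ennreal ((norm v)\<^sup>2) * energy) + ennreal (2 * (L * C)\<^sup>2) * ennreal (norm v ^ 4) * mass"
    by (intro order_trans[OF quotient_L2_bound[OF assms(1)]] add_left_mono mult_right_mono) auto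
  then have "ennreal (gauss v) * (\<integral>\<^sup>+y. ennreal ((norm (quotient v t y))\<^sup>2) \<partial>lborel)
      \<le> ennreal (gauss v) * (2 * (ennreal ((norm v)\<^sup>2) * energy) + ennreal (2 * (L * C)\<^sup>2) * ennreal (norm v ^ 4) * mass)"
    by (rule mult_left_mono) simp
  then show ?thesis by (simp add: distrib_left ac_simps)
qed

definition moment2 :: ennreal where
  "moment2 = (\<integral>\<^sup>+v. ennreal (gauss v) * ennreal ((norm v)\<^sup>2) \<partial>(lborel :: (real ^ 'n) measure))"
definition moment4 :: ennreal where
  "moment4 = (\<integral>\<^sup>+v. ennreal (gauss v) * ennreal ((norm v) ^ 4) \<partial>(lborel :: (real ^ 'n) measure))"

lemma gauss_average_dominant:
  "(\<integral>\<^sup>+v. 2 * energy * (ennreal (gauss (v::real ^ 'n)) * ennreal ((norm v)\<^sup>2))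
      + ennreal (2 * (L * C)\<^sup>2) * mass * (ennreal (gauss v) * ennreal ((norm v) ^ 4)) \<partial>lborel)
    = 2 * energy * moment2 + ennreal (2 * (L * C)\<^sup>2) * mass * moment4"
  unfolding moment2_def moment4_def
  by (simp add: nn_integral_add nn_integral_cmult)

lemma moments_finite: "moment2 < \<infinity>" "moment4 < \<infinity>"
  unfolding moment2_def moment4_def by (rule nn_integral_gauss_norm_power)+

lemma gauss_average_le:
  assumes "t > 0"
  shows "gauss_average t \<le> 2 * energy * moment2 + ennreal (2 * (L * t)\<^sup>2) * mass * moment4"
  unfolding gauss_average_def gauss_average_dominant[symmetric]
  by (intro nn_integral_mono gauss_quotient_le assms order_refl)

lemma gauss_average_tendsto: "(gauss_average \<longlongrightarrow> energy) (at_right 0)"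
  unfolding tendsto_at_iff_sequentially
proof (intro allI impI)
  fix X :: "nat \<Rightarrow> real" assume "\<forall>i. X i \<in> {0<..} - {0}" and lim: "X \<longlonglongrightarrow> 0"
  then have X: "X n > 0" for n by auto
  obtain C where C: "X n \<le> C" for n
    using convergent_imp_Bseq[OF convergentI[OF lim]] unfolding Bseq_def real_norm_def
    by (metis abs_ge_self order_trans)
  have "(\<lambda>n. gauss_average (X n)) \<longlonglongrightarrow>
      (\<integral>\<^sup>+v. ennreal (gauss v) * (\<integral>\<^sup>+y. ennreal ((norm (cov v y))\<^sup>2) \<partial>lborel) \<partial>lborel)"
    unfolding gauss_average_def
  proof (rule nn_integral_dominated_convergence[where w="\<lambda>v. 2 * energy * (ennreal (gauss v) * ennreal ((norm v)\<^sup>2))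
      + ennreal (2 * (L * C)\<^sup>2) * mass * (ennreal (gauss v) * ennreal ((norm v) ^ 4))"])
    show "(\<integral>\<^sup>+v. 2 * energy * (ennreal (gauss (v::real ^ 'n)) * ennreal ((norm v)\<^sup>2))
      + ennreal (2 * (L * C)\<^sup>2) * mass * (ennreal (gauss v) * ennreal ((norm v) ^ 4)) \<partial>lborel) < \<infinity>"
      unfolding gauss_average_dominant
      using moments_finite energy_finite mass_finite by (simp add: ennreal_mult_less_top)
    show "AE v in lborel. (\<lambda>n. ennreal (gauss v) * (\<integral>\<^sup>+y. ennreal ((norm (quotient v (X n) y))\<^sup>2) \<partial>lborel))
        \<longlonglongrightarrow> ennreal (gauss v) * (\<integral>\<^sup>+y. ennreal ((norm (cov v y))\<^sup>2) \<partial>lborel)"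
      using cov_L2
      by (intro AE_I2 tendsto_mult_ennreal tendsto_const quotient_L2_norm_tendsto X lim) (auto simp: less_top[symmetric])
  qed (measurable, auto intro!: gauss_quotient_le X C)
  then show "(gauss_average \<circ> X) \<longlonglongrightarrow> energy"
    unfolding gauss_average_cov comp_def .
qed

end

section \<open>The Bessel kernel as a mixture of Gaussians\<close>

lemma ennreal_mult_assoc: "x \<ge> 0 \<Longrightarrow> ennreal x * (ennreal y * z) = ennreal (x * y) * z"
  by (simp add: ennreal_mult' mult.assoc)

text \<open>
  This absorbs the singular power at \<open>t = 0\<close> in the integral for \<open>K\<^sub>\<nu>\<close>, with \<open>x = z\<^sup>2 / (4 t)\<close>. Without
  integrability the Bochner integral in the definition of \<open>bessel_K\<close> would be the default value \<open>0\<close>.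
\<close>

lemma powr_mult_exp_le:
  fixes x p :: real
  assumes "x > 0" "p > 0"
  shows "x powr p * exp (- x) \<le> p powr p"
proof -
  have "ln (x / p) \<le> x / p - 1" using assms by (intro ln_le_minus_one) simp
  then have "p * (ln x - ln p) \<le> p * (x / p - 1)"
    using assms by (intro mult_left_mono) (auto simp: ln_div)
  also have "\<dots> = x - p" using assms by (simp add: field_simps)
  finally have "p * ln x - x \<le> p * ln p" using assms by (simp add: algebra_simps)
  then have "exp (p * ln x - x) \<le> exp (p * ln p)" by simp
  then show ?thesis using assms by (simp add: powr_def exp_diff exp_minus field_simps)
qed

lemma nn_integral_Gamma:
  assumes "a > (0::real)"
  shows "(\<integral>\<^sup>+t. ennreal (indicator {0<..} t * (exp (- t) * t powr (a - 1))) \<partial>lborel) = ennreal (Gamma a)"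
  unfolding Gamma_conv_nn_integral_real[OF assms]
  by (intro nn_integral_cong arg_cong[where f=ennreal]) (auto simp: exp_minus field_simps split: split_indicator)

lemma bessel_K_nn_integral:
  assumes z: "z > 0" and \<nu>: "\<nu> > 0"
  shows "ennreal (bessel_K \<nu> z) = ennreal (1 / 2 * (z / 2) powr \<nu>) *
    (\<integral>\<^sup>+t. ennreal (indicator {0<..} t * (exp (- (z\<^sup>2 / (4 * t)) - t) * t powr (- 1 - \<nu>))) \<partial>lborel)"
proof -
  let ?f = "\<lambda>t. indicator {0<..} t * (exp (- (z\<^sup>2 / (4 * t)) - t) * t powr (- 1 - \<nu>)) :: real"
  define p where "p = 1 + \<nu>"
  define C where "C = (4 / z\<^sup>2) powr p * p powr p"
  have p: "p > 0" using \<nu> by (simp add: p_def)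
  have C: "C \<ge> 0" by (simp add: C_def)
  have bound: "?f t \<le> C * (indicator {0<..} t * (exp (- t) * t powr (1 - 1)))" for t
  proof (cases "t > 0")
    case True
    define x where "x = z\<^sup>2 / (4 * t)"
    have x: "x > 0" using True z by (simp add: x_def)
    have "t powr (- 1 - \<nu>) = (4 / z\<^sup>2 * x) powr p"
      using True z by (simp add: x_def p_def powr_minus[symmetric] powr_divide powr_minus_divide)
        (simp add: powr_minus_divide[symmetric])
    also have "\<dots> = (4 / z\<^sup>2) powr p * x powr p" by (rule powr_mult)
    finally have *: "t powr (- 1 - \<nu>) = (4 / z\<^sup>2) powr p * x powr p" .
    have "exp (- x - t) = exp (- x) * exp (- t)" by (simp flip: exp_add)
    with * have "?f t = (4 / z\<^sup>2) powr p * (x powr p * exp (- x)) * exp (- t)"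
      using True by (simp add: x_def[symmetric])
    also have "\<dots> \<le> (4 / z\<^sup>2) powr p * (p powr p) * exp (- t)"
      by (intro mult_left_mono mult_right_mono powr_mult_exp_le x p) auto
    finally show ?thesis using True by (simp add: C_def)
  qed simp
  have nn: "?f t \<ge> 0" for t by simp
  have "(\<integral>\<^sup>+t. ennreal (?f t) \<partial>lborel) \<le> (\<integral>\<^sup>+t. ennreal C * ennreal (indicator {0<..} t * (exp (- t) * t powr (1 - 1))) \<partial>lborel)"
    using bound C by (intro nn_integral_mono) (simp add: ennreal_leI flip: ennreal_mult)
  also have "\<dots> = ennreal C * ennreal (Gamma 1)"
    by (subst nn_integral_cmult) (measurable, simp only: nn_integral_Gamma zero_less_one)
  finally have "(\<integral>\<^sup>+t. ennreal (?f t) \<partial>lborel) < \<infinity>"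
    by (rule le_less_trans) (simp add: ennreal_mult_less_top)
  then have "integrable lborel ?f"
    by (intro integrableI_nonneg) (auto simp: nn)
  then have "(\<integral>\<^sup>+t. ennreal (?f t) \<partial>lborel) = ennreal (\<integral>t. ?f t \<partial>lborel)"
    by (rule nn_integral_eq_integral) (simp add: nn)
  then show ?thesis
    by (simp add: bessel_K_def set_lebesgue_integral_def ennreal_mult'[symmetric])
qed

text \<open>
  The Gamma distribution with shape \<open>1 - s\<close> has total mass \<open>1\<close> and mean \<open>\<Gamma> (2 - s) / \<Gamma> (1 - s) = 1 - s\<close>. A
  function with a limit at \<open>0\<close> and at most affine growth differs from that limit by at most \<open>e/2 + C t\<close>, whose
  expectation is \<open>e/2 + C (1 - s)\<close>.
\<close>

lemma gamma_density_concentrates: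
  fixes \<Phi> :: "real \<Rightarrow> ennreal" and \<Phi>0 :: ennreal and a b :: real
  assumes [measurable]: "\<Phi> \<in> borel_measurable borel"
    and fin: "\<Phi>0 < \<infinity>" and lim: "(\<Phi> \<longlongrightarrow> \<Phi>0) (at_right 0)"
    and growth: "\<And>t. t > 0 \<Longrightarrow> \<Phi> t \<le> ennreal a + ennreal (b * t)" and ab: "a \<ge> 0" "b \<ge> 0"
  shows "((\<lambda>s. \<integral>\<^sup>+t. ennreal (indicator {0<..} t * (exp (- t) * t powr (- s)) / Gamma (1 - s)) * \<Phi> t \<partial>lborel)
    \<longlongrightarrow> \<Phi>0) (at_left 1)"
proof (rule tendsto_ennreal_two_sided[OF fin])
  fix e :: real assume e: "e > 0"
  obtain f where f: "\<Phi>0 = ennreal f" "f \<ge> 0" using fin by (cases \<Phi>0) auto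
  have "\<forall>\<^sub>F t in at_right 0. \<Phi> t < \<Phi>0 + ennreal (e / 2)"
    using e f by (intro order_tendstoD(1)[OF lim] order_tendstoD(2)[OF lim]) (auto simp: ennreal_less_iff simp flip: ennreal_plus)
  moreover have "\<forall>\<^sub>F t in at_right 0. \<Phi>0 < \<Phi> t + ennreal (e / 2)"
  proof -
    have "((\<lambda>t. \<Phi> t + ennreal (e / 2)) \<longlongrightarrow> \<Phi>0 + ennreal (e / 2)) (at_right 0)"
      by (intro tendsto_add lim tendsto_const)
    then show ?thesis
      by (rule order_tendstoD(1)) (use e f in \<open>auto simp: ennreal_less_iff simp flip: ennreal_plus\<close>)
  qed
  ultimately have "\<forall>\<^sub>F t in at_right 0. \<Phi> t < \<Phi>0 + ennreal (e / 2) \<and> \<Phi>0 < \<Phi> t + ennreal (e / 2)"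
    by (rule eventually_conj)
  then obtain d where d: "d > 0" "\<And>t. 0 < t \<Longrightarrow> t < d \<Longrightarrow> \<Phi> t < \<Phi>0 + ennreal (e / 2) \<and> \<Phi>0 < \<Phi> t + ennreal (e / 2)"
    unfolding eventually_at_right_field by auto
  \<comment> \<open>For \<open>t \<ge> d\<close> the constants \<open>a\<close> and \<open>f\<close> are bounded by multiples of \<open>t\<close>, using \<open>1 \<le> t / d\<close>.\<close>
  define C where "C = a / d + b + f / d"
  have C: "C \<ge> 0" using ab d f by (simp add: C_def)
  have near: "\<Phi> t \<le> \<Phi>0 + (ennreal (e / 2) + ennreal (C * t))" "\<Phi>0 \<le> \<Phi> t + (ennreal (e / 2) + ennreal (C * t))" if t: "t > 0" for t
  proof -
    have "\<Phi> t \<le> \<Phi>0 + (ennreal (e / 2) + ennreal (C * t)) \<and> \<Phi>0 \<le> \<Phi> t + (ennreal (e / 2) + ennreal (C * t))"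
    proof (cases "t < d")
      case True
      have le: "x + ennreal (e / 2) \<le> x + (ennreal (e / 2) + ennreal (C * t))" for x
        by (intro add_left_mono) simp
      show ?thesis
        using d(2)[OF t True] by (auto intro: order_trans[OF less_imp_le le])
    next
      case False
      then have td: "1 \<le> t / d" using d by simp
      have Ct: "C * t = a * (t / d) + b * t + f * (t / d)" by (simp add: C_def algebra_simps)
      have nn: "0 \<le> a * (t / d)" "0 \<le> b * t" "0 \<le> f * (t / d)" using ab f d(1) t by auto
      have "a + b * t \<le> C * t"
        using mult_left_mono[OF td ab(1)] nn unfolding Ct by simp
      then have 1: "\<Phi> t \<le> ennreal (C * t)"
        using growth[OF t] ab t by (simp add: order_trans[OF _ ennreal_leI] flip: ennreal_plus)
      have "f \<le> C * t"
        using mult_left_mono[OF td f(2)] nn unfolding Ct by simp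
      then have 2: "\<Phi>0 \<le> ennreal (C * t)" unfolding f by (rule ennreal_leI)
      have le: "ennreal (C * t) \<le> x + (ennreal (e / 2) + ennreal (C * t))" for x
        by (simp add: add_increasing)
      show ?thesis by (intro conjI order_trans[OF 1 le] order_trans[OF 2 le])
    qed
    then show "\<Phi> t \<le> \<Phi>0 + (ennreal (e / 2) + ennreal (C * t))" "\<Phi>0 \<le> \<Phi> t + (ennreal (e / 2) + ennreal (C * t))" by auto
  qed
  have "\<forall>\<^sub>F s in at_left 1. s \<in> {max 0 (1 - e / (2 * (C + 1)))<..<1}"
    using e C by (intro eventually_at_leftI[of "max 0 (1 - e / (2 * (C + 1)))"]) auto
  then show "\<forall>\<^sub>F s in at_left 1.
      (\<integral>\<^sup>+t. ennreal (indicator {0<..} t * (exp (- t) * t powr (- s)) / Gamma (1 - s)) * \<Phi> t \<partial>lborel) \<le> \<Phi>0 + ennreal e \<and>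
      \<Phi>0 \<le> (\<integral>\<^sup>+t. ennreal (indicator {0<..} t * (exp (- t) * t powr (- s)) / Gamma (1 - s)) * \<Phi> t \<partial>lborel) + ennreal e"
  proof eventually_elim
    case (elim s)
    then have s: "0 < s" "s < 1" "1 - s < e / (2 * (C + 1))" by auto
    let ?G = "Gamma (1 - s)"
    have G: "?G > 0" using s by (intro Gamma_real_pos) auto
    define p where "p t = ennreal (indicator {0<..} t * (exp (- t) * t powr (- s)) / ?G)" for t
    have [measurable]: "p \<in> borel_measurable borel" unfolding p_def by measurable
    have p0: "p t = 0" if "t \<le> 0" for t using that by (simp add: p_def)
    have mass: "(\<integral>\<^sup>+t. p t \<partial>lborel) = 1"
    proof -
      have "(\<integral>\<^sup>+t. p t \<partial>lborel) = (\<integral>\<^sup>+t. ennreal (1 / ?G) * ennreal (indicator {0<..} t * (exp (- t) * t powr ((1 - s) - 1))) \<partial>lborel)"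
        unfolding p_def using G by (intro nn_integral_cong) (simp flip: ennreal_mult)
      also have "\<dots> = ennreal (1 / ?G) * ennreal ?G"
        using s by (subst nn_integral_cmult) (measurable, subst nn_integral_Gamma, auto)
      finally show ?thesis using G by (simp flip: ennreal_mult)
    qed
    have mean: "(\<integral>\<^sup>+t. p t * ennreal t \<partial>lborel) = ennreal (1 - s)"
    proof -
      have "(\<integral>\<^sup>+t. p t * ennreal t \<partial>lborel)
        = (\<integral>\<^sup>+t. ennreal (1 / ?G) * ennreal (indicator {0<..} t * (exp (- t) * t powr ((2 - s) - 1))) \<partial>lborel)"
      proof (intro nn_integral_cong)
        fix t :: real
        show "p t * ennreal t = ennreal (1 / ?G) * ennreal (indicator {0<..} t * (exp (- t) * t powr ((2 - s) - 1)))"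
        proof (cases "t > 0")
          case True
          have "t powr ((2 - s) - 1) = t powr (- s) * t"
            using True powr_add[of t "- s" 1] by simp
          then show ?thesis using True G by (simp add: p_def mult.assoc flip: ennreal_mult)
        qed (simp add: p_def)
      qed
      also have "\<dots> = ennreal (1 / ?G) * ennreal (Gamma (2 - s))"
        using s by (subst nn_integral_cmult) (measurable, subst nn_integral_Gamma, auto)
      also have "Gamma (2 - s) = (1 - s) * ?G"
      proof -
        have "1 - s \<notin> nonpos_Ints" using nonpos_Ints_nonpos[of "1 - s"] s by auto
        then show ?thesis using Gamma_plus1[of "1 - s"] by simp
      qed
      finally show ?thesis using G s by (simp flip: ennreal_mult)
    qed
    let ?I = "\<integral>\<^sup>+t. p t * \<Phi> t \<partial>lborel"
    have small: "ennreal (e / 2) + ennreal C * ennreal (1 - s) \<le> ennreal e"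
    proof -
      have "C * (1 - s) \<le> (C + 1) * (e / (2 * (C + 1)))" using s C by (intro mult_mono) auto
      also have "\<dots> = e / 2" using C by (simp add: field_simps)
      finally have "e / 2 + C * (1 - s) \<le> e" by simp
      then show ?thesis using e C s by (simp add: ennreal_leI flip: ennreal_mult ennreal_plus)
    qed
    have split: "(\<integral>\<^sup>+t. p t * (\<Psi> t + (ennreal (e / 2) + ennreal (C * t))) \<partial>lborel)
        = (\<integral>\<^sup>+t. p t * \<Psi> t \<partial>lborel) + (ennreal (e / 2) + ennreal C * ennreal (1 - s))"
      if [measurable]: "\<Psi> \<in> borel_measurable borel" for \<Psi> :: "real \<Rightarrow> ennreal"
    proof -
      have "(\<integral>\<^sup>+t. p t * (\<Psi> t + (ennreal (e / 2) + ennreal (C * t))) \<partial>lborel)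
        = (\<integral>\<^sup>+t. p t * \<Psi> t + (ennreal (e / 2) * p t + ennreal C * (p t * ennreal t)) \<partial>lborel)"
        unfolding ennreal_mult'[OF C] distrib_left by (intro nn_integral_cong) (simp only: ac_simps)
      then show ?thesis
        by (simp add: nn_integral_add nn_integral_cmult mass mean)
    qed
    have "?I \<le> (\<integral>\<^sup>+t. p t * (\<Phi>0 + (ennreal (e / 2) + ennreal (C * t))) \<partial>lborel)"
    proof (intro nn_integral_mono)
      fix t
      show "p t * \<Phi> t \<le> p t * (\<Phi>0 + (ennreal (e / 2) + ennreal (C * t)))"
        using near(1)[of t] p0[of t] by (cases "t > 0") (auto intro: mult_left_mono)
    qed
    also have "\<dots> = \<Phi>0 + (ennreal (e / 2) + ennreal C * ennreal (1 - s))"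
      by (subst split) (auto simp: nn_integral_multc mass)
    also have "\<dots> \<le> \<Phi>0 + ennreal e" by (intro add_left_mono small)
    finally have 1: "?I \<le> \<Phi>0 + ennreal e" .
    have "\<Phi>0 = (\<integral>\<^sup>+t. p t * \<Phi>0 \<partial>lborel)" by (simp add: nn_integral_multc mass)
    also have "\<dots> \<le> (\<integral>\<^sup>+t. p t * (\<Phi> t + (ennreal (e / 2) + ennreal (C * t))) \<partial>lborel)"
    proof (intro nn_integral_mono)
      fix t
      show "p t * \<Phi>0 \<le> p t * (\<Phi> t + (ennreal (e / 2) + ennreal (C * t)))"
        using near(2)[of t] p0[of t] by (cases "t > 0") (auto intro: mult_left_mono)
    qed
    also have "\<dots> = ?I + (ennreal (e / 2) + ennreal C * ennreal (1 - s))"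
      by (subst split) auto
    also have "\<dots> \<le> ?I + ennreal e" by (intro add_left_mono small)
    finally show ?case using 1 unfolding p_def by blast
  qed
qed

lemma nn_integral_lborel_scale:
  fixes f :: "'a::euclidean_space \<Rightarrow> ennreal"
  assumes r: "r > 0" and [measurable]: "f \<in> borel_measurable borel"
  shows "(\<integral>\<^sup>+h. f h \<partial>lborel) = ennreal (r ^ DIM('a)) * (\<integral>\<^sup>+v. f (r *\<^sub>R v) \<partial>lborel)"
proof -
  have "(lborel :: 'a measure) = density (distr lborel borel (\<lambda>x. 0 + r *\<^sub>R x)) (\<lambda>_. ennreal (\<bar>r\<bar> ^ DIM('a)))"
    by (rule lborel_affine) (use r in simp)
  then have "(\<integral>\<^sup>+h. f h \<partial>lborel) = (\<integral>\<^sup>+h. f h \<partial>density (distr lborel borel (\<lambda>x. 0 + r *\<^sub>R x)) (\<lambda>_. ennreal (\<bar>r\<bar> ^ DIM('a))))"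
    by (rule arg_cong)
  also have "\<dots> = ennreal (r ^ DIM('a)) * (\<integral>\<^sup>+v. f (r *\<^sub>R v) \<partial>lborel)"
    using r by (subst nn_integral_density) (auto simp: nn_integral_distr nn_integral_cmult)
  finally show ?thesis .
qed

context magnetic_sobolev
begin

definition defect :: "real ^ 'n \<Rightarrow> ennreal" where
  "defect h = (\<integral>\<^sup>+y. ennreal ((norm (u (y + h) - cis (h \<bullet> A (y + (1 / 2) *\<^sub>R h)) * u y))\<^sup>2) \<partial>lborel)"

lemma defect_measurable[measurable]: "defect \<in> borel_measurable borel"
  unfolding defect_def[abs_def] by measurable

lemma gauss_average_measurable[measurable]: "gauss_average \<in> borel_measurable borel"
  unfolding gauss_average_def[abs_def] quotient_def phase_def by measurable

lemma defect_scale: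
  assumes r: "r > 0"
  shows "defect (r *\<^sub>R v) = ennreal (r\<^sup>2) * (\<integral>\<^sup>+y. ennreal ((norm (quotient v r y))\<^sup>2) \<partial>lborel)"
proof -
  have "(norm (u (y + r *\<^sub>R v) - cis ((r *\<^sub>R v) \<bullet> A (y + (1 / 2) *\<^sub>R r *\<^sub>R v)) * u y))\<^sup>2 = r\<^sup>2 * (norm (quotient v r y))\<^sup>2" for y
  proof -
    have "(r *\<^sub>R v) \<bullet> A (y + (1 / 2) *\<^sub>R r *\<^sub>R v) = phase v r y"
      by (simp add: phase_def)
    moreover have "u (y + r *\<^sub>R v) - cis (phase v r y) * u y = cis (phase v r y) * (complex_of_real r * quotient v r y)"
    proof -
      have q: "complex_of_real r * quotient v r y = cis (- phase v r y) * u (y + r *\<^sub>R v) - u y"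
        using r by (simp add: quotient_def)
      have c: "cis (phase v r y) * cis (- phase v r y) = 1" by (simp add: cis_mult)
      show ?thesis unfolding q by (simp add: right_diff_distrib mult.assoc[symmetric] c)
    qed
    ultimately show ?thesis by (simp add: norm_mult power_mult_distrib)
  qed
  then show ?thesis
    unfolding defect_def by (simp add: ennreal_mult nn_integral_cmult)
qed

lemma gaussian_defect_integral:
  assumes r: "r > 0"
  shows "(\<integral>\<^sup>+h. ennreal (exp (- ((norm h)\<^sup>2 / (2 * r\<^sup>2)))) * defect h \<partial>lborel)
    = ennreal (sqrt (2 * pi) ^ CARD('n) * r ^ (CARD('n) + 2)) * gauss_average r"
proof -
  have "(\<integral>\<^sup>+h. ennreal (exp (- ((norm h)\<^sup>2 / (2 * r\<^sup>2)))) * defect h \<partial>lborel)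
      = ennreal (r ^ CARD('n)) * (\<integral>\<^sup>+v. ennreal (exp (- ((norm (r *\<^sub>R v))\<^sup>2 / (2 * r\<^sup>2)))) * defect (r *\<^sub>R v) \<partial>lborel)"
    by (subst nn_integral_lborel_scale[OF r]) auto
  also have "(\<integral>\<^sup>+v. ennreal (exp (- ((norm (r *\<^sub>R v))\<^sup>2 / (2 * r\<^sup>2)))) * defect (r *\<^sub>R v) \<partial>lborel)
      = (\<integral>\<^sup>+v. ennreal (sqrt (2 * pi) ^ CARD('n) * r\<^sup>2) *
          (ennreal (gauss v) * (\<integral>\<^sup>+y. ennreal ((norm (quotient v r y))\<^sup>2) \<partial>lborel)) \<partial>lborel)"
  proof (intro nn_integral_cong)
    fix v :: "real ^ 'n"
    have "exp (- ((norm (r *\<^sub>R v))\<^sup>2 / (2 * r\<^sup>2))) = sqrt (2 * pi) ^ CARD('n) * gauss v"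
      using r by (simp add: gauss_eq power_mult_distrib)
    then show "ennreal (exp (- ((norm (r *\<^sub>R v))\<^sup>2 / (2 * r\<^sup>2)))) * defect (r *\<^sub>R v)
      = ennreal (sqrt (2 * pi) ^ CARD('n) * r\<^sup>2) *
          (ennreal (gauss v) * (\<integral>\<^sup>+y. ennreal ((norm (quotient v r y))\<^sup>2) \<partial>lborel))"
      by (simp add: defect_scale[OF r] ennreal_mult ac_simps)
  qed
  also have "\<dots> = ennreal (sqrt (2 * pi) ^ CARD('n) * r\<^sup>2) * gauss_average r"
    unfolding gauss_average_def by (rule nn_integral_cmult) measurable
  also have "ennreal (r ^ CARD('n)) * (ennreal (sqrt (2 * pi) ^ CARD('n) * r\<^sup>2) * gauss_average r)
      = ennreal (r ^ CARD('n) * (sqrt (2 * pi) ^ CARD('n) * r\<^sup>2)) * gauss_average r"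
    by (rule ennreal_mult_assoc) (use r in simp)
  also have "r ^ CARD('n) * (sqrt (2 * pi) ^ CARD('n) * r\<^sup>2) = sqrt (2 * pi) ^ CARD('n) * r ^ (CARD('n) + 2)"
    by (simp only: power_add mult.left_commute)
  finally show ?thesis .
qed

text \<open>
  The \<open>t\<close>-slice of the kernel is Gaussian with standard deviation \<open>r = sqrt (2 t) / m\<close>. The factor
  \<open>r ^ (n + 2)\<close> that it produces (\<open>n\<close> from the change of variables, \<open>2\<close> from the normalisation of the difference
  quotient) turns \<open>t powr (-1 - \<nu>)\<close> into \<open>t powr (-s)\<close>.
\<close>

lemma bessel_kernel_integral:
  fixes m s :: real
  defines "\<nu> \<equiv> (CARD('n) + 2 * s) / 2"
  assumes m: "m > 0" and s: "0 < s"
  shows "(\<integral>\<^sup>+h. ennreal (bessel_K \<nu> (m * norm h) / norm h powr \<nu>) * defect h \<partial>lborel)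
    = ennreal (1 / 2 * (m / 2) powr \<nu> * sqrt (2 * pi) ^ CARD('n) * (sqrt 2 / m) ^ (CARD('n) + 2)) *
      (\<integral>\<^sup>+t. ennreal (indicator {0<..} t * (exp (- t) * t powr (- s))) * gauss_average (sqrt (2 * t) / m) \<partial>lborel)"
proof -
  let ?k = "\<lambda>h t. ennreal (indicator {0<..} t * (exp (- ((m * norm h)\<^sup>2 / (4 * t)) - t) * t powr (- 1 - \<nu>)))"
  let ?c = "1 / 2 * (m / 2) powr \<nu>" and ?d = "sqrt (2 * pi) ^ CARD('n) * (sqrt 2 / m) ^ (CARD('n) + 2)"
  have \<nu>: "\<nu> > 0" using s by (simp add: \<nu>_def add_pos_pos)
  have "(\<integral>\<^sup>+h. ennreal (bessel_K \<nu> (m * norm h) / norm h powr \<nu>) * defect h \<partial>lborel)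
      = (\<integral>\<^sup>+h. ennreal ?c * (\<integral>\<^sup>+t. ?k h t \<partial>lborel) * defect h \<partial>lborel)"
  proof (rule nn_integral_cong_AE)
    show "AE h in lborel. ennreal (bessel_K \<nu> (m * norm h) / norm h powr \<nu>) * defect h
        = ennreal ?c * (\<integral>\<^sup>+t. ?k h t \<partial>lborel) * defect h"
      \<comment> \<open>The formula for \<open>K\<^sub>\<nu>\<close> needs a positive argument, and \<open>h = 0\<close> is a null set.\<close>
      using AE_lborel_singleton[of 0]
    proof eventually_elim
      case (elim h)
      have K: "ennreal (bessel_K \<nu> (m * norm h))
          = ennreal (1 / 2 * (m * norm h / 2) powr \<nu>) * (\<integral>\<^sup>+t. ?k h t \<partial>lborel)"
        using elim m \<nu> by (intro bessel_K_nn_integral) auto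
      have "1 / 2 * (m * norm h / 2) powr \<nu> = ?c * norm h powr \<nu>"
        using m powr_mult[of "m / 2" "norm h" \<nu>] by (simp add: mult.commute[of "norm h"])
      then have "1 / norm h powr \<nu> * (1 / 2 * (m * norm h / 2) powr \<nu>) = ?c"
        using elim by simp
      then have "ennreal (1 / norm h powr \<nu>) * ennreal (1 / 2 * (m * norm h / 2) powr \<nu>) = ennreal ?c"
        by (subst ennreal_mult[symmetric]) auto
      moreover have "ennreal (bessel_K \<nu> (m * norm h) / norm h powr \<nu>) = ennreal (1 / norm h powr \<nu>) * ennreal (bessel_K \<nu> (m * norm h))"
        by (subst ennreal_mult'[symmetric]) auto
      ultimately have "ennreal (bessel_K \<nu> (m * norm h) / norm h powr \<nu>) = ennreal ?c * (\<integral>\<^sup>+t. ?k h t \<partial>lborel)"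
        unfolding K by (simp only: mult.assoc[symmetric])
      then show ?case by simp
    qed
  qed
  also have "\<dots> = (\<integral>\<^sup>+h. ennreal ?c * (\<integral>\<^sup>+t. ?k h t * defect h \<partial>lborel) \<partial>lborel)"
    unfolding mult.assoc by (intro nn_integral_cong arg_cong2[where f="(*)"] refl nn_integral_multc[symmetric]) measurable
  also have "\<dots> = ennreal ?c * (\<integral>\<^sup>+h. \<integral>\<^sup>+t. ?k h t * defect h \<partial>lborel \<partial>lborel)"
    by (rule nn_integral_cmult) measurable
  also have "(\<integral>\<^sup>+h. \<integral>\<^sup>+t. ?k h t * defect h \<partial>lborel \<partial>lborel) = (\<integral>\<^sup>+t. \<integral>\<^sup>+h. ?k h t * defect h \<partial>lborel \<partial>lborel)"
    by (rule lborel_pair.Fubini') measurable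
  also have "\<dots> = (\<integral>\<^sup>+t. ennreal ?d * (ennreal (indicator {0<..} t * (exp (- t) * t powr (- s))) * gauss_average (sqrt (2 * t) / m)) \<partial>lborel)"
  proof (intro nn_integral_cong)
    fix t :: real
    show "(\<integral>\<^sup>+h. ?k h t * defect h \<partial>lborel)
      = ennreal ?d * (ennreal (indicator {0<..} t * (exp (- t) * t powr (- s))) * gauss_average (sqrt (2 * t) / m))"
    proof (cases "t > 0")
      case t: True
      let ?r = "sqrt (2 * t) / m"
      have r: "?r > 0" using t m by simp
      have k: "?k h t = ennreal (exp (- t) * t powr (- 1 - \<nu>)) * ennreal (exp (- ((norm h)\<^sup>2 / (2 * ?r\<^sup>2))))" for h :: "real ^ 'n"
      proof -
        have "(m * norm h)\<^sup>2 / (4 * t) = (norm h)\<^sup>2 / (2 * ?r\<^sup>2)"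
          using t m by (simp add: power_divide power_mult_distrib field_simps)
        moreover have "exp (- x - t) = exp (- t) * exp (- x)" for x
          by (simp flip: exp_add)
        ultimately have "indicator {0<..} t * (exp (- ((m * norm h)\<^sup>2 / (4 * t)) - t) * t powr (- 1 - \<nu>))
            = exp (- t) * t powr (- 1 - \<nu>) * exp (- ((norm h)\<^sup>2 / (2 * ?r\<^sup>2)))"
          using t by simp
        from arg_cong[OF this, of ennreal] show ?thesis
          by (rule trans) (rule ennreal_mult, auto)
      qed
      have "(\<integral>\<^sup>+h. ?k h t * defect h \<partial>lborel)
        = ennreal (exp (- t) * t powr (- 1 - \<nu>)) * (\<integral>\<^sup>+h. ennreal (exp (- ((norm h)\<^sup>2 / (2 * ?r\<^sup>2)))) * defect h \<partial>lborel)"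
        unfolding k mult.assoc by (rule nn_integral_cmult) measurable
      also have "\<dots> = ennreal (exp (- t) * t powr (- 1 - \<nu>)) * (ennreal (sqrt (2 * pi) ^ CARD('n) * ?r ^ (CARD('n) + 2)) * gauss_average ?r)"
        by (simp only: gaussian_defect_integral[OF r])
      also have "\<dots> = ennreal (exp (- t) * t powr (- 1 - \<nu>) * (sqrt (2 * pi) ^ CARD('n) * ?r ^ (CARD('n) + 2))) * gauss_average ?r"
        by (rule ennreal_mult_assoc) simp
      also have "exp (- t) * t powr (- 1 - \<nu>) * (sqrt (2 * pi) ^ CARD('n) * ?r ^ (CARD('n) + 2)) = ?d * (exp (- t) * t powr (- s))"
      proof -
        have "?r ^ (CARD('n) + 2) = (sqrt 2 / m) ^ (CARD('n) + 2) * sqrt t ^ (CARD('n) + 2)"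
          by (simp only: real_sqrt_mult times_divide_eq_left[symmetric] power_mult_distrib)
        also have "sqrt t ^ (CARD('n) + 2) = sqrt t powr (CARD('n) + 2)"
          using t powr_realpow[of "sqrt t" "CARD('n) + 2"] by simp
        also have "\<dots> = t powr ((CARD('n) + 2) / 2)"
          using t by (simp add: powr_half_sqrt[symmetric] powr_powr)
        finally have "t powr (- 1 - \<nu>) * ?r ^ (CARD('n) + 2) = (sqrt 2 / m) ^ (CARD('n) + 2) * (t powr (- 1 - \<nu>) * t powr ((CARD('n) + 2) / 2))"
          by (simp only: ac_simps)
        also have "t powr (- 1 - \<nu>) * t powr ((CARD('n) + 2) / 2) = t powr (- s)"
          unfolding powr_add[symmetric] \<nu>_def by (simp add: field_simps)
        finally show ?thesis by (simp only: ac_simps)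
      qed
      finally have "(\<integral>\<^sup>+h. ?k h t * defect h \<partial>lborel) = ennreal (?d * (exp (- t) * t powr (- s))) * gauss_average ?r" .
      also have "\<dots> = ennreal ?d * (ennreal (exp (- t) * t powr (- s)) * gauss_average ?r)"
        by (rule ennreal_mult_assoc[symmetric]) (use m in simp)
      finally show ?thesis using t by simp
    qed simp
  qed
  also have "\<dots> = ennreal ?d * (\<integral>\<^sup>+t. ennreal (indicator {0<..} t * (exp (- t) * t powr (- s))) * gauss_average (sqrt (2 * t) / m) \<partial>lborel)"
    by (rule nn_integral_cmult) measurable
  also have "ennreal ?c * (ennreal ?d * I) = ennreal (?c * ?d) * I" for I
    by (rule ennreal_mult_assoc) simp
  finally show ?thesis by (simp only: mult.assoc)
qed

lemma gauss_average_gamma_limit: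
  assumes m: "m > 0"
  shows "((\<lambda>s. \<integral>\<^sup>+t. ennreal (indicator {0<..} t * (exp (- t) * t powr (- s)) / Gamma (1 - s)) * gauss_average (sqrt (2 * t) / m) \<partial>lborel)
    \<longlongrightarrow> energy) (at_left 1)"
proof -
  obtain E where E: "2 * energy * moment2 = ennreal E" "E \<ge> 0"
    using energy_finite moments_finite by (cases "2 * energy * moment2") (auto simp: ennreal_mult_eq_top_iff)
  obtain M where M: "mass * moment4 = ennreal M" "M \<ge> 0"
    using mass_finite moments_finite by (cases "mass * moment4") (auto simp: ennreal_mult_eq_top_iff)
  show ?thesis
  proof (rule gamma_density_concentrates[where a=E and b="4 * L\<^sup>2 / m\<^sup>2 * M"])
    have "filterlim (\<lambda>t. sqrt (2 * t) / m) (at_right 0) (at_right 0)"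
      using m by real_asymp
    then show "((\<lambda>t. gauss_average (sqrt (2 * t) / m)) \<longlongrightarrow> energy) (at_right 0)"
      by (rule filterlim_compose[OF gauss_average_tendsto])
    fix t :: real assume t: "t > 0"
    have "gauss_average (sqrt (2 * t) / m) \<le> 2 * energy * moment2 + ennreal (2 * (L * (sqrt (2 * t) / m))\<^sup>2) * (mass * moment4)"
      using t m gauss_average_le[of "sqrt (2 * t) / m"] by (simp add: mult.assoc)
    also have "\<dots> = ennreal E + ennreal (2 * (L * (sqrt (2 * t) / m))\<^sup>2 * M)"
      unfolding E M using M by (simp flip: ennreal_mult)
    also have "2 * (L * (sqrt (2 * t) / m))\<^sup>2 * M = 4 * L\<^sup>2 / m\<^sup>2 * M * t"
      using t by (simp add: power_mult_distrib power_divide)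
    finally show "gauss_average (sqrt (2 * t) / m) \<le> ennreal E + ennreal (4 * L\<^sup>2 / m\<^sup>2 * M * t)" .
  qed (use energy_finite E M in auto)
qed

end

section \<open>From Lebesgue to Borel measurable functions and the limit\<close>

lemma lebesgue_ex_borel_complex:
  fixes f :: "'a::euclidean_space \<Rightarrow> complex"
  assumes f: "f \<in> borel_measurable lebesgue"
  shows "\<exists>f'\<in>borel_measurable borel. AE x in lborel. f x = f' x"
proof -
  have "(\<lambda>x. Re (f x)) \<in> borel_measurable lebesgue" "(\<lambda>x. Im (f x)) \<in> borel_measurable lebesgue"
    using f by measurable
  from this[THEN completion_ex_borel_measurable_real]
  obtain p q where [measurable]: "p \<in> borel_measurable borel" "q \<in> borel_measurable borel"
    and pq: "AE x in lborel. Re (f x) = p x" "AE x in lborel. Im (f x) = q x"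
    by auto
  have "AE x in lborel. f x = Complex (p x) (q x)"
    using pq by eventually_elim (simp add: complex_eq_iff)
  moreover have "(\<lambda>x. Complex (p x) (q x)) \<in> borel_measurable borel"
    unfolding Complex_eq by measurable
  ultimately show ?thesis by (rule bexI[where x="\<lambda>x. Complex (p x) (q x)"])
qed

lemma set_integrable_lborel_version:
  fixes f f' :: "'a::euclidean_space \<Rightarrow> complex"
  assumes f: "set_integrable lebesgue S f" and S[measurable]: "S \<in> sets borel"
    and f'[measurable]: "f' \<in> borel_measurable borel" and ae: "AE x in lborel. f x = f' x"
  shows "set_integrable lborel S f'"
proof -
  have "integrable lebesgue (\<lambda>x. indicator S x *\<^sub>R f' x)"
  proof (rule integrable_cong_AE_imp[OF f[unfolded set_integrable_def]])
    show "(\<lambda>x. indicator S x *\<^sub>R f' x) \<in> borel_measurable lebesgue"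
      by (rule measurable_completion) measurable
    show "AE x in lebesgue. indicator S x *\<^sub>R f x = indicator S x *\<^sub>R f' x"
      by (rule AE_completion, use ae in eventually_elim) simp
  qed
  then show ?thesis unfolding set_integrable_def by (subst (asm) integrable_completion) measurable
qed

lemma locally_integrable_set_integrable:
  "locally_integrable f \<Longrightarrow> set_integrable lebesgue (cbox a b) f"
  by (simp add: locally_integrable_def)

text \<open>
  Local integrability concerns the restrictions to compact sets; global measurability follows by exhausting the
  space with boxes.
\<close>

lemma locally_integrable_component:
  fixes f :: "real ^ 'n::finite \<Rightarrow> complex ^ 'n"
  assumes "locally_integrable f"
  shows "set_integrable lebesgue (cbox a b) (\<lambda>x. f x $ j)"
    and "(\<lambda>x. f x $ j) \<in> borel_measurable lebesgue"
proof -
  have *: "set_integrable lebesgue (cbox a b) (\<lambda>x. f x $ j)" for a b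
    using integrable_bounded_linear[OF bounded_linear_vec_nth[of j]
        locally_integrable_set_integrable[OF assms, of a b, unfolded set_integrable_def]]
    by (simp add: set_integrable_def)
  show "set_integrable lebesgue (cbox a b) (\<lambda>x. f x $ j)" by (rule *)
  let ?c = "\<lambda>n. real n *\<^sub>R One :: real ^ 'n"
  show "(\<lambda>x. f x $ j) \<in> borel_measurable lebesgue"
  proof (rule borel_measurable_LIMSEQ_metric)
    show "(\<lambda>x. indicator (cbox (- ?c n) (?c n)) x *\<^sub>R (f x $ j)) \<in> borel_measurable lebesgue" for n
      using *[of "- ?c n" "?c n"] unfolding set_integrable_def by (rule borel_measurable_integrable)
    fix x :: "real ^ 'n"
    obtain N where N: "norm x \<le> real N" using real_arch_simple by blast
    have "x \<in> cbox (- ?c n) (?c n)" if "n \<ge> N" for n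
    proof -
      have "\<bar>x \<bullet> b\<bar> \<le> real n" if "b \<in> Basis" for b
        using Basis_le_norm[OF that, of x] N \<open>n \<ge> N\<close> by simp
      then show ?thesis by (auto simp: mem_box abs_le_iff minus_le_iff)
    qed
    then have "\<forall>\<^sub>F n in sequentially. f x $ j = indicator (cbox (- ?c n) (?c n)) x *\<^sub>R (f x $ j)"
      by (intro eventually_sequentiallyI[of N]) simp
    then show "(\<lambda>n. indicator (cbox (- ?c n) (?c n)) x *\<^sub>R (f x $ j)) \<longlonglongrightarrow> f x $ j"
      by (rule Lim_transform_eventually[OF tendsto_const])
  qed
qed

lemma AE_pair_of_AE:
  fixes P :: "'a::euclidean_space \<Rightarrow> bool"
  assumes "AE x in lborel. P x"
  shows "AE z in lborel \<Otimes>\<^sub>M lborel. P (fst z) \<and> P (snd z)"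
proof -
  obtain N where N: "N \<in> null_sets lborel" "{x. \<not> P x} \<subseteq> N"
    using assms by (auto simp: eventually_ae_filter)
  have "N \<times> UNIV \<in> null_sets (lborel \<Otimes>\<^sub>M lborel)" "UNIV \<times> N \<in> null_sets (lborel \<Otimes>\<^sub>M lborel)"
    by (rule lborel.times_in_null_sets1[OF N(1)] lborel.times_in_null_sets2[OF _ N(1)], simp)+
  then have "N \<times> UNIV \<union> UNIV \<times> N \<in> null_sets (lborel \<Otimes>\<^sub>M lborel)"
    by (rule null_sets.Un)
  then show ?thesis by (rule AE_I') (use N(2) in auto)
qed

text \<open>
  Any weak gradient may serve as \<open>g\<close>, in particular the chosen one in \<open>weak_gradient\<close>. Borel representatives
  are needed because the arguments above compose \<open>u\<close> with \<open>(y, h) \<mapsto> y + h\<close> and apply Fubini's theorem to the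
  product of two Borel measures.
\<close>

lemma H1_magnetic_borel_version:
  fixes A :: "real ^ 'n::finite \<Rightarrow> real ^ 'n"
  assumes lip: "L-lipschitz_on UNIV A" and u: "u \<in> H1_magnetic A"
  obtains u' g where "magnetic_sobolev A u' g L" "AE x in lborel. u x = u' x"
    "AE x in lborel. \<forall>j. magnetic_gradient A u x $ j = g x $ j - \<i> * complex_of_real (A x $ j) * u' x"
proof -
  let ?G = "weak_gradient u"
  have weak: "has_weak_gradient u ?G"
  proof -
    have "\<exists>g. has_weak_gradient u g" using u by (simp add: H1_magnetic_def)
    then show ?thesis unfolding weak_gradient_def by (rule someI_ex)
  qed
  then have loc: "locally_integrable u" "locally_integrable ?G" by (auto simp: has_weak_gradient_def)
  have "u \<in> borel_measurable lebesgue" using u by (simp add: H1_magnetic_def)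
  from lebesgue_ex_borel_complex[OF this]
  obtain u' where u'[measurable]: "u' \<in> borel_measurable borel" and uu': "AE x in lborel. u x = u' x"
    by blast
  have "\<forall>j. \<exists>f'\<in>borel_measurable borel. AE x in lborel. ?G x $ j = f' x"
    using lebesgue_ex_borel_complex[OF locally_integrable_component(2)[OF loc(2)]] by blast
  then obtain G' where G'[measurable]: "\<And>j. G' j \<in> borel_measurable borel"
    and GG': "\<And>j. AE x in lborel. ?G x $ j = G' j x"
    by metis
  define g where "g x = (\<chi> j. G' j x)" for x
  have gG: "(\<lambda>x. g x $ j) = G' j" for j by (simp add: g_def)
  have "AE x in lborel. \<forall>j. ?G x $ j = G' j x"
    using GG' by (simp add: AE_all_countable)
  then have grad: "AE x in lborel. \<forall>j. magnetic_gradient A u x $ j = g x $ j - \<i> * complex_of_real (A x $ j) * u' x"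
    using uu' by eventually_elim (simp add: magnetic_gradient_def g_def)
  have A[measurable]: "(\<lambda>x. A x $ j) \<in> borel_measurable borel" for j
    by (intro borel_measurable_continuous_onI continuous_on_component lipschitz_on_continuous_on[OF lip])
  have M: "magnetic_sobolev A u' g L"
  proof
    show "L-lipschitz_on UNIV A" "u' \<in> borel_measurable borel" by fact+
    show "(\<lambda>x. g x $ j) \<in> borel_measurable borel" for j by (simp add: gG G')
    show "set_integrable lborel (cbox a b) u'" for a b
      by (rule set_integrable_lborel_version[OF locally_integrable_set_integrable[OF loc(1)] _ u' uu']) simp
    show "set_integrable lborel (cbox a b) (\<lambda>x. g x $ j)" for j a b
      unfolding gG
      by (rule set_integrable_lborel_version[OF locally_integrable_component(1)[OF loc(2)] _ G' GG']) simp
    show "(\<integral>x. frechet_derivative (box_bump n a b) (at x) (axis j 1) *\<^sub>R u' x \<partial>lborel)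
      = - (\<integral>x. box_bump n a b x *\<^sub>R (g x $ j) \<partial>lborel)" for n a b j
    proof -
      let ?\<phi> = "box_bump n a b" and ?D = "partial_derivative j (box_bump n a b)"
      have [measurable]: "?\<phi> \<in> borel_measurable borel"
        by (intro borel_measurable_continuous_onI flat_algebra_continuous flat_algebra_box_bump)
      have [measurable]: "?D \<in> borel_measurable borel"
        unfolding partial_derivative_def[abs_def] by (intro borel_measurable_continuous_onI box_bump_deriv_continuous)
      have eq: "(\<integral>x. c x *\<^sub>R f x \<partial>lebesgue) = (\<integral>x. c x *\<^sub>R f' x \<partial>lborel)"
        if [measurable]: "c \<in> borel_measurable borel" "f' \<in> borel_measurable borel"
          and ae: "AE x in lborel. f x = f' x" and f: "f \<in> borel_measurable lebesgue"
        for c :: "real ^ 'n \<Rightarrow> real" and f f' :: "real ^ 'n \<Rightarrow> complex"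
      proof -
        have c': "c \<in> borel_measurable lebesgue" by (rule measurable_completion) measurable
        have f'': "f' \<in> borel_measurable lebesgue" by (rule measurable_completion) measurable
        have "(\<integral>x. c x *\<^sub>R f x \<partial>lebesgue) = (\<integral>x. c x *\<^sub>R f' x \<partial>lebesgue)"
        proof (rule integral_cong_AE)
          show "AE x in lebesgue. c x *\<^sub>R f x = c x *\<^sub>R f' x"
            by (rule AE_completion, use ae in eventually_elim) simp
        qed (use c' f f'' in \<open>auto intro!: borel_measurable_scaleR\<close>)
        also have "\<dots> = (\<integral>x. c x *\<^sub>R f' x \<partial>lborel)"
          by (rule integral_completion) measurable
        finally show ?thesis .
      qed
      have "(\<integral>x. ?D x *\<^sub>R u x \<partial>lebesgue) = - (\<integral>x. ?\<phi> x *\<^sub>R (?G x $ j) \<partial>lebesgue)"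
        using weak test_function_box_bump unfolding has_weak_gradient_def by blast
      then have "(\<integral>x. ?D x *\<^sub>R u' x \<partial>lborel) = - (\<integral>x. ?\<phi> x *\<^sub>R G' j x \<partial>lborel)"
        using eq[OF _ u' uu' \<open>u \<in> borel_measurable lebesgue\<close>, of ?D]
          eq[OF _ G' GG' locally_integrable_component(2)[OF loc(2)], of ?\<phi>] by simp
      then show ?thesis by (simp add: partial_derivative_def g_def)
    qed
    have "(\<integral>\<^sup>+x. ennreal ((norm (u' x))\<^sup>2) \<partial>lborel) = (\<integral>\<^sup>+x. ennreal ((norm (u x))\<^sup>2) \<partial>lebesgue)"
      unfolding nn_integral_completion by (rule nn_integral_cong_AE, use uu' in eventually_elim) simp
    then show "(\<integral>\<^sup>+x. ennreal ((norm (u' x))\<^sup>2) \<partial>lborel) < \<infinity>"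
      using u by (simp add: H1_magnetic_def)
    show "(\<integral>\<^sup>+x. ennreal ((norm (g x $ j - \<i> * complex_of_real (A x $ j) * u' x))\<^sup>2) \<partial>lborel) < \<infinity>" for j
    proof -
      have "(\<integral>\<^sup>+x. ennreal ((norm (g x $ j - \<i> * complex_of_real (A x $ j) * u' x))\<^sup>2) \<partial>lborel)
        \<le> (\<integral>\<^sup>+x. ennreal ((norm (magnetic_gradient A u x))\<^sup>2) \<partial>lborel)"
      proof (rule nn_integral_mono_AE, use grad in eventually_elim)
        case (elim x)
        then show ?case
          using power_mono[OF Finite_Cartesian_Product.norm_nth_le[of "magnetic_gradient A u x" j] norm_ge_zero, of 2]
          by (simp add: ennreal_leI)
      qed
      also have "\<dots> < \<infinity>"
        using u by (simp add: H1_magnetic_def nn_integral_completion)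
      finally show ?thesis .
    qed
  qed
  show ?thesis by (rule that[OF M uu' grad])
qed

context magnetic_sobolev
begin

lemma energy_eq_magnetic_gradient:
  assumes "AE x in lborel. \<forall>j. G x $ j = g x $ j - \<i> * complex_of_real (A x $ j) * u x"
  shows "(\<integral>\<^sup>+x. ennreal ((norm (G x :: complex ^ 'n))\<^sup>2) \<partial>lebesgue) = energy"
proof -
  have "(\<integral>\<^sup>+x. ennreal ((norm (G x))\<^sup>2) \<partial>lebesgue)
      = (\<integral>\<^sup>+x. (\<Sum>j\<in>UNIV. ennreal ((norm (g x $ j - \<i> * complex_of_real (A x $ j) * u x))\<^sup>2)) \<partial>lborel)"
    unfolding nn_integral_completion
  proof (rule nn_integral_cong_AE, use assms in eventually_elim)
    case (elim x)
    have "(norm (G x))\<^sup>2 = (\<Sum>j\<in>UNIV. (norm (G x $ j))\<^sup>2)"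
      by (simp add: norm_vec_def L2_set_def sum_nonneg)
    then show ?case using elim by (simp add: sum_ennreal)
  qed
  also have "\<dots> = energy" unfolding energy_def by (rule nn_integral_sum) measurable
  finally show ?thesis .
qed

text \<open>
  The substitution \<open>x = y + h\<close> turns the midpoint of \<open>x\<close> and \<open>y\<close> into \<open>y + h/2\<close>.
\<close>

lemma double_integral_eq_defect_integral:
  fixes k :: "real \<Rightarrow> real"
  assumes uu': "AE x in lborel. u' x = u x" and [measurable]: "k \<in> borel_measurable borel"
  shows "(\<integral>\<^sup>+ (x, y). ennreal
        ((norm (u' x - exp (\<i> * complex_of_real ((x - y) \<bullet> A ((1 / 2) *\<^sub>R (x + y)))) * u' y))\<^sup>2 * k (norm (x - y))) \<partial>lebesgue)
    = (\<integral>\<^sup>+h. ennreal (k (norm h)) * defect h \<partial>lborel)"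
proof -
  let ?F = "\<lambda>x y. ennreal ((norm (u x - cis ((x - y) \<bullet> A ((1 / 2) *\<^sub>R (x + y))) * u y))\<^sup>2 * k (norm (x - y)))"
  have "(\<integral>\<^sup>+ (x, y). ennreal
        ((norm (u' x - exp (\<i> * complex_of_real ((x - y) \<bullet> A ((1 / 2) *\<^sub>R (x + y)))) * u' y))\<^sup>2 * k (norm (x - y))) \<partial>lebesgue)
    = (\<integral>\<^sup>+ (x, y). ?F x y \<partial>(lborel \<Otimes>\<^sub>M lborel))"
    unfolding nn_integral_completion lborel_prod[symmetric]
    by (rule nn_integral_cong_AE, use AE_pair_of_AE[OF uu'] in eventually_elim) (auto simp: cis_conv_exp)
  also have "\<dots> = (\<integral>\<^sup>+y. \<integral>\<^sup>+x. ?F x y \<partial>lborel \<partial>lborel)"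
    by (subst lborel_pair.nn_integral_snd[symmetric]) simp_all
  also have "\<dots> = (\<integral>\<^sup>+y. \<integral>\<^sup>+h. ?F (h + y) y \<partial>lborel \<partial>lborel)"
    by (intro nn_integral_cong nn_integral_lborel_shift[symmetric]) measurable
  also have "\<dots> = (\<integral>\<^sup>+h. \<integral>\<^sup>+y. ?F (h + y) y \<partial>lborel \<partial>lborel)"
    by (rule lborel_pair.Fubini') measurable
  also have "\<dots> = (\<integral>\<^sup>+h. ennreal (k (norm h)) * defect h \<partial>lborel)"
  proof (intro nn_integral_cong)
    fix h :: "real ^ 'n"
    have "?F (h + y) y = ennreal (k (norm h)) * ennreal ((norm (u (y + h) - cis (h \<bullet> A (y + (1 / 2) *\<^sub>R h)) * u y))\<^sup>2)" for y
    proof -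
      have "(1 / 2) *\<^sub>R (h + y + y) = y + (1 / 2) *\<^sub>R h"
        by (simp add: scaleR_add_right add.assoc flip: scaleR_add_left)
      then show ?thesis by (simp add: add.commute[of h y] ennreal_mult'' mult.commute)
    qed
    then show "(\<integral>\<^sup>+y. ?F (h + y) y \<partial>lborel) = ennreal (k (norm h)) * defect h"
      unfolding defect_def by (simp add: nn_integral_cmult)
  qed
  finally show ?thesis .
qed

end

lemma bessel_K_measurable[measurable]: "bessel_K \<nu> \<in> borel_measurable borel"
  unfolding bessel_K_def[abs_def] set_lebesgue_integral_def by measurable

text \<open>
  The powers of \<open>2\<close> and of \<open>\<pi>\<close> cancel completely; only \<open>s m powr (2 s - 2)\<close>, which tends to \<open>1\<close>, remains
  besides the normalisation of the Gamma density.
\<close>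

lemma C_const_normalization:
  assumes m: "m > 0" and s: "0 < s" "s < 1"
  defines "\<nu> \<equiv> (3 + 2 * s) / 2"
  shows "C_const s / 2 * m powr \<nu> * (1 / 2 * (m / 2) powr \<nu> * sqrt (2 * pi) ^ 3 * (sqrt 2 / m) ^ 5)
    = s * m powr (2 * s - 2) * (1 / Gamma (1 - s))"
proof -
  let ?e = "(2 * s - 1) / 2"
  have pi: "sqrt (2 * pi) ^ 3 = 2 powr (3 / 2) * pi powr (3 / 2)"
  proof -
    have "sqrt (2 * pi) ^ 3 = ((2 * pi) powr (1 / 2)) powr 3"
      by (simp add: powr_half_sqrt)
    then show ?thesis by (simp add: powr_powr powr_mult)
  qed
  have two: "(sqrt 2 / m) ^ 5 = 2 powr (5 / 2) * m powr (- 5)"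
  proof -
    have "sqrt 2 ^ 5 = (2 powr (1 / 2)) powr 5" by (simp add: powr_half_sqrt)
    then have "sqrt 2 ^ 5 = 2 powr (5 / 2)" by (simp add: powr_powr)
    then show ?thesis using m by (simp add: power_divide powr_minus_divide)
  qed
  have G: "Gamma (1 - s) > 0" using s by (intro Gamma_real_pos) auto
  have mm: "(m / 2) powr \<nu> = m powr \<nu> * 2 powr (- \<nu>)"
    using m by (simp add: powr_divide powr_minus_divide)
  have q: "(1 / 4 :: real) = 2 powr (- 2)" by (simp add: powr_minus_divide)
  have "C_const s / 2 * m powr \<nu> * (1 / 2 * (m / 2) powr \<nu> * sqrt (2 * pi) ^ 3 * (sqrt 2 / m) ^ 5)
    = s * (1 / Gamma (1 - s)) * ((1 / 4) * 2 powr ?e * 2 powr (- \<nu>) * 2 powr (3 / 2) * 2 powr (5 / 2))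
      * (m powr \<nu> * m powr \<nu> * m powr (- 5)) * (pi powr (3 / 2) / pi powr (3 / 2))"
    unfolding pi two mm C_const_def using G by (simp add: field_simps)
  also have "(1 / 4) * 2 powr ?e * 2 powr (- \<nu>) * 2 powr (3 / 2) * 2 powr (5 / 2) = (2 :: real) powr 0"
    unfolding q powr_add[symmetric] \<nu>_def by (rule arg_cong[where f="(powr) 2"]) (simp add: field_simps)
  also have "m powr \<nu> * m powr \<nu> * m powr (- 5) = m powr (2 * s - 2)"
    unfolding powr_add[symmetric] \<nu>_def by (rule arg_cong[where f="(powr) m"]) (simp add: field_simps)
  finally show ?thesis by simp
qed

theorem theorem1p4:
  fixes m :: real and A :: "real ^ 3 \<Rightarrow> real ^ 3" and u :: "real ^ 3 \<Rightarrow> complex"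
  assumes "m > 0"
    and "\<exists>L. L-lipschitz_on UNIV A"
    and "u \<in> H1_magnetic A"
  shows "((\<lambda>s. ennreal (C_const s / 2 * m powr ((3 + 2 * s) / 2)) *
             magnetic_seminorm_integral m A u s)
           \<longlongrightarrow> (\<integral>\<^sup>+ x. ennreal ((norm (magnetic_gradient A u x))\<^sup>2) \<partial>lebesgue)) (at_left 1)"
proof -
  obtain L where lip: "L-lipschitz_on UNIV A" using assms(2) by blast
  obtain u' g where M: "magnetic_sobolev A u' g L" and uu': "AE x in lborel. u x = u' x"
    and grad: "AE x in lborel. \<forall>j. magnetic_gradient A u x $ j = g x $ j - \<i> * complex_of_real (A x $ j) * u' x"
    using H1_magnetic_borel_version[OF lip assms(3)] by blast
  interpret magnetic_sobolev A u' g L by (rule M)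
  let ?I = "\<lambda>s. \<integral>\<^sup>+t. ennreal (indicator {0<..} t * (exp (- t) * t powr (- s)) / Gamma (1 - s)) *
      gauss_average (sqrt (2 * t) / m) \<partial>lborel"
  have rep: "ennreal (C_const s / 2 * m powr ((3 + 2 * s) / 2)) * magnetic_seminorm_integral m A u s
      = ennreal (s * m powr (2 * s - 2)) * ?I s" if s: "0 < s" "s < 1" for s
  proof -
    define \<nu> where "\<nu> = (3 + 2 * s) / 2"
    let ?c = "C_const s / 2 * m powr \<nu>" and ?d = "1 / 2 * (m / 2) powr \<nu> * sqrt (2 * pi) ^ 3 * (sqrt 2 / m) ^ 5"
    let ?J = "\<integral>\<^sup>+t. ennreal (indicator {0<..} t * (exp (- t) * t powr (- s))) * gauss_average (sqrt (2 * t) / m) \<partial>lborel"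
    have G: "Gamma (1 - s) > 0" using s by (intro Gamma_real_pos) auto
    have "magnetic_seminorm_integral m A u s
        = (\<integral>\<^sup>+h. ennreal (bessel_K \<nu> (m * norm h) / norm h powr \<nu>) * defect h \<partial>lborel)"
      unfolding magnetic_seminorm_integral_def \<nu>_def[symmetric]
      using double_integral_eq_defect_integral[OF uu', of "\<lambda>r. bessel_K \<nu> (m * r) / r powr \<nu>"]
      by (simp add: field_simps)
    also have "\<dots> = ennreal ?d * ?J"
      using bessel_kernel_integral[OF assms(1) s(1)] by (simp add: \<nu>_def)
    finally have "ennreal ?c * magnetic_seminorm_integral m A u s = ennreal ?c * (ennreal ?d * ?J)" by simp
    also have "\<dots> = ennreal (?c * ?d) * ?J"
      using s G by (intro ennreal_mult_assoc) (simp add: C_const_def)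
    also have "?c * ?d = s * m powr (2 * s - 2) * (1 / Gamma (1 - s))"
      unfolding \<nu>_def by (rule C_const_normalization[OF assms(1) s])
    also have "ennreal (s * m powr (2 * s - 2) * (1 / Gamma (1 - s))) * ?J
        = ennreal (s * m powr (2 * s - 2)) * (ennreal (1 / Gamma (1 - s)) * ?J)"
      using s by (intro ennreal_mult_assoc[symmetric]) simp
    also have "ennreal (1 / Gamma (1 - s)) * ?J = ?I s"
      using G by (subst nn_integral_cmult[symmetric])
        (auto intro!: nn_integral_cong simp: ennreal_mult_assoc)
    finally show ?thesis unfolding \<nu>_def .
  qed
  have "((\<lambda>s. s * m powr (2 * s - 2)) \<longlongrightarrow> 1 * m powr (2 * 1 - 2)) (at_left 1)"
    using assms(1) by (intro tendsto_intros) auto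
  then have "((\<lambda>s. ennreal (s * m powr (2 * s - 2)) * ?I s) \<longlongrightarrow> ennreal 1 * energy) (at_left 1)"
    using assms(1) energy_finite
    by (intro tendsto_mult_ennreal gauss_average_gamma_limit tendsto_ennrealI) auto
  then have "((\<lambda>s. ennreal (s * m powr (2 * s - 2)) * ?I s) \<longlongrightarrow> energy) (at_left 1)" by simp
  then have "((\<lambda>s. ennreal (C_const s / 2 * m powr ((3 + 2 * s) / 2)) * magnetic_seminorm_integral m A u s)
      \<longlongrightarrow> energy) (at_left 1)"
    by (rule Lim_transform_eventually)
       (use rep in \<open>auto intro!: eventually_at_leftI[of 0]\<close>)
  then show ?thesis
    unfolding energy_eq_magnetic_gradient[OF grad] .
qed

end
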